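(* In the directed FCFS bipartite matching model, assume the stability condition $\lambda_C<\mu_{\mathcal S(C)}$ for every nonempty $C\subseteq\mathcal C$, and let $(s_j,c_i)\in\mathcal G$ with $r_{s_j,c_i}>0$. For an ordering $(C_1,\dots,C_k)$ of a subset of $\mathcal C$ write $p_h=p_h(C_1,\dots,C_k)=\dfrac{\mu_{\mathcal S(\{C_1,\dots,C_h\})}-\lambda_{\{C_1,\dots,C_h\}}}{\bar\lambda+\bar\mu}$, and for a function $f(C_1,\dots,C_k;l)$ write $$\mathcal E[f]=\frac{1}{r_{s_j,c_i}}\frac{\mu_{s_j}}{\bar\mu}\sum_{k=1}^I\ \sum_{C\subseteq\mathcal C,\,|C|=k}\ \sum_{(C_1,\dots,C_k)\in\mathcal P(C)}\ \sum_{l=1}^k\pi_Y(C_1,\cdot,\dots,C_k,\cdot)\,\mathbf 1\big(C_l=c_i,\ s_j\notin\mathcal S(\{C_1,\dots,C_{l-1}\})\big)\,f(C_1,\dots,C_k;l).$$ Then the generating function $G_{s_j,c_i}(\mathsf Z)=E(\mathsf Z^{L_{s_j,c_i}})$ of the delay $L_{s_j,c_i}$ is $$G_{s_j,c_i}(\mathsf Z)=\mathcal E\left[\prod_{h=l}^k\frac{\mathsf Z\,p_h}{1-\mathsf Z(1-p_h)}\right],$$ and its mean and variance are $$E(L_{s_j,c_i})=\mathcal E\left[\sum_{h=l}^k\frac1{p_h}\right],\qquad \operatorname{Var}(L_{s_j,c_i})=\mathcal E\left[\sum_{h=l}^k\frac{1-p_h}{p_h^2}+\Big(\sum_{h=l}^k\frac1{p_h}\Big)^2\right]-E(L_{s_j,c_i})^2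 .$$
   Context: Model. $\mathcal C=\{c_1,\dots,c_I\}$ (agent types) and $\mathcal S=\{s_1,\dots,s_J\}$ (good types) are disjoint finite sets, $\mathcal G\subseteq\mathcal S\times\mathcal C$ is a bipartite compatibility graph, $\bar\lambda,\bar\mu>0$, and $\alpha,\beta$ are probability vectors on $\mathcal C,\mathcal S$. Put $\lambda_{c_i}=\bar\lambda\alpha_{c_i}$, $\mu_{s_j}=\bar\mu\beta_{s_j}$. The sequence $(z^n)_{n\in\mathbb Z}$ is i.i.d. with $P(z^n=c_i)=\lambda_{c_i}/(\bar\lambda+\bar\mu)$, $P(z^n=s_j)=\mu_{s_j}/(\bar\lambda+\bar\mu)$. For $C\subseteq\mathcal C$: $\mathcal S(C)=\{s_j:(s_j,c)\in\mathcal G\text{ for some }c\in C\}$, $\lambda_C=\sum_{c\in C}\lambda_c$; for $S\subseteq\mathcal S$: $\mu_S=\sum_{s\in S}\mu_s$. $\mathcal P(C)$ is the set of orderings of $C$. Directed FCFS matching: each item is matched at most once, and a good $z^n=s_j$ is matched with an agent $z^m=c_i$ if and only if (i) $n>m$; (ii) $(s_j,c_i)\in\mathcal G$; (iii) for every $k<m$ with $z^k=c_{i'}$ and $(s_j,c_{i'})\in\mathcal G$ there is $l<n$ such that $z^l$ is matched with $z^k$. A good with no such match remains unmatched (lost). Under the stability condition there is almost surely a unique such matching of $(z^n)_{n\in\mathbb Z}$ in which all agents are matched. Matching rate $r_{s_j,c_i}$: the long-run fraction, among all goods in the sequence, of goods that are of type $s_j$ and are matched to an agent of type $c_i$. Delay: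 $L_{s_j,c_i}$ is the value of $n-m$ for a (stationary, typical) matched pair $z^m=c_i$, $z^n=s_j$, i.e. its law is the conditional law of $n-m$ given that $z^n=s_j$ and that $z^n$ is matched to an agent of type $c_i$ (at position $m$). $X(N)$ is the list, in order of position, of the types of agents in positions $\le N$ not matched to goods in positions $\le N$. $\pi_Y(C_1,\cdot,\dots,C_k,\cdot)$ is the stationary probability that the distinct agent types appearing in $X(N)$, in order of first appearance, are exactly $C_1,\dots,C_k$. Explicitly, $\pi_Y(C_1,\cdot,\dots,C_k,\cdot)=B\prod_{\ell=1}^k\frac{\lambda_{C_\ell}}{\mu_{\mathcal S(\{C_1,\dots,C_\ell\})}-\lambda_{\{C_1,\dots,C_\ell\}}}$, where $B=P(X(N)=\emptyset)$ makes these probabilities, together with $\pi_Y(\emptyset)=B$, sum to $1$ over all orderings of all subsets of $\mathcal C$. *)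

theory Defs
  imports
    "HOL-Probability.Probability"
    "HOL-Combinatorics.Multiset_Permutations"
begin

text \<open>
  Agent types and good types are finite types \<open>'c\<close> and \<open>'s\<close>, so an item is an element of
  \<open>'c + 's\<close>: \<open>Inl c\<close> is an agent of type \<open>c\<close> and \<open>Inr s\<close> a good of type \<open>s\<close>.  A matching of a
  sequence \<open>x :: int \<Rightarrow> 'c + 's\<close> is a set of pairs \<open>(m, n)\<close>: the agent at position \<open>m\<close> is matched
  with the good at position \<open>n\<close>.
\<close>

definition compatible_goods :: "('s \<times> 'c) set \<Rightarrow> 'c set \<Rightarrow> 's set" where
  "compatible_goods G C = {s. \<exists>c\<in>C. (s, c) \<in> G}"

text \<open>
  The conjunct \<open>\<not> (\<exists>l<n. (m, l) \<in> A)\<close> makes explicit that an agent matched to an earlier good is no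
  longer available at \<open>n\<close>.  Without it the equivalence would contradict the requirement that
  each item is matched at most once.
\<close>

definition directed_fcfs_matching ::
    "('s \<times> 'c) set \<Rightarrow> (int \<Rightarrow> 'c + 's) \<Rightarrow> (int \<times> int) set \<Rightarrow> bool" where
  "directed_fcfs_matching G x A \<longleftrightarrow>
     (\<forall>m n. (m, n) \<in> A \<longrightarrow> (\<exists>c s. x m = Inl c \<and> x n = Inr s)) \<and>
     (\<forall>m n n'. (m, n) \<in> A \<and> (m, n') \<in> A \<longrightarrow> n = n') \<and>
     (\<forall>m m' n. (m, n) \<in> A \<and> (m', n) \<in> A \<longrightarrow> m = m') \<and>
     (\<forall>m n c s. x m = Inl c \<and> x n = Inr s \<longrightarrow>
        ((m, n) \<in> A \<longleftrightarrow>
           m < n \<and> (s, c) \<in> G \<and>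
           (\<forall>k<m. \<forall>c'. x k = Inl c' \<and> (s, c') \<in> G \<longrightarrow> (\<exists>l<n. (k, l) \<in> A)) \<and>
           \<not> (\<exists>l<n. (m, l) \<in> A)))"

definition all_agents_matched :: "(int \<Rightarrow> 'c + 's) \<Rightarrow> (int \<times> int) set \<Rightarrow> bool" where
  "all_agents_matched x A \<longleftrightarrow> (\<forall>m c. x m = Inl c \<longrightarrow> (\<exists>n. (m, n) \<in> A))"

text \<open>
  The sequence together with its matching is invariant in law under translation of positions.
  Pathwise, the matching rules and \<^const>\<open>all_agents_matched\<close> do not determine the matching: with
  one type of each kind and more goods than agents, one may match the \<open>i\<close>-th agent with the
  \<open>(i + d)\<close>-th good for all sufficiently negative \<open>i\<close>, for an arbitrary shift \<open>d\<close>, and continue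
  by the first come first served rule from there; the backlog then grows linearly towards
  position \<open>-\<infinity>\<close>.  Stationarity excludes such matchings.
\<close>

definition stationary_matching ::
    "'w measure \<Rightarrow> (int \<Rightarrow> 'w \<Rightarrow> 'c + 's) \<Rightarrow> ('w \<Rightarrow> (int \<times> int) set) \<Rightarrow> bool" where
  "stationary_matching M z A \<longleftrightarrow>
     (\<forall>m n. {w \<in> space M. (m, n) \<in> A w} \<in> sets M) \<and>
     (let N = (\<Pi>\<^sub>M n\<in>(UNIV :: int set). count_space UNIV) \<Otimes>\<^sub>M
              (\<Pi>\<^sub>M p\<in>(UNIV :: (int \<times> int) set). count_space UNIV)
      in \<forall>i. distr M N (\<lambda>w. (\<lambda>n. z (n + i) w, \<lambda>(m, n). (m + i, n + i) \<in> A w)) =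
             distr M N (\<lambda>w. (\<lambda>n. z n w, \<lambda>(m, n). (m, n) \<in> A w)))"

definition matched_to ::
    "(int \<Rightarrow> 'c + 's) \<Rightarrow> (int \<times> int) set \<Rightarrow> 's \<Rightarrow> 'c \<Rightarrow> int \<Rightarrow> bool" where
  "matched_to x A s c n \<longleftrightarrow> x n = Inr s \<and> (\<exists>m. (m, n) \<in> A \<and> x m = Inl c)"

definition matching_rate ::
    "'w measure \<Rightarrow> (int \<Rightarrow> 'w \<Rightarrow> 'c + 's) \<Rightarrow> ('w \<Rightarrow> (int \<times> int) set) \<Rightarrow> 's \<Rightarrow> 'c \<Rightarrow> real" where
  "matching_rate M z A s c =
     (THE r. AE w in M.
        (\<lambda>N::nat. real (card {n \<in> {1..int N}. matched_to (\<lambda>i. z i w) (A w) s c n}) /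
                  real (card {n \<in> {1..int N}. \<exists>s'. z n w = Inr s'})) \<longlonglongrightarrow> r)"

text \<open>
  For a matched good at position \<open>n\<close>, the number \<open>d\<close> below is unique.
\<close>

definition delay :: "(int \<times> int) set \<Rightarrow> int \<Rightarrow> nat" where
  "delay A n = (LEAST d. (n - int d, n) \<in> A)"

definition delay_law ::
    "'w measure \<Rightarrow> (int \<Rightarrow> 'w \<Rightarrow> 'c + 's) \<Rightarrow> ('w \<Rightarrow> (int \<times> int) set) \<Rightarrow> 's \<Rightarrow> 'c \<Rightarrow> int \<Rightarrow>
     nat measure" where
  "delay_law M z A s c n =
     distr (uniform_measure M {w \<in> space M. matched_to (\<lambda>i. z i w) (A w) s c n})
       (count_space UNIV) (\<lambda>w. delay (A w) n)"

text \<open>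
  Under stability the set of unmatched positions below is almost surely finite; on the null event
  where it is infinite, \<^const>\<open>sorted_list_of_set\<close> returns the empty list.
\<close>

definition unmatched_agents :: "(int \<Rightarrow> 'c + 's) \<Rightarrow> (int \<times> int) set \<Rightarrow> int \<Rightarrow> 'c list" where
  "unmatched_agents x A N =
     map (\<lambda>m. projl (x m))
       (sorted_list_of_set {m. m \<le> N \<and> isl (x m) \<and> \<not> (\<exists>n\<le>N. (m, n) \<in> A)})"

text \<open>
  \<^const>\<open>remdups\<close> keeps the last occurrence of each element, hence the reversals.
\<close>

definition first_appearances :: "'a list \<Rightarrow> 'a list" where
  "first_appearances xs = rev (remdups (rev xs))"

definition pi_Y ::
    "'w measure \<Rightarrow> (int \<Rightarrow> 'w \<Rightarrow> 'c + 's) \<Rightarrow> ('w \<Rightarrow> (int \<times> int) set) \<Rightarrow> int \<Rightarrow> 'c list \<Rightarrow> real" where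
  "pi_Y M z A N Cs =
     measure M {w \<in> space M. first_appearances (unmatched_agents (\<lambda>i. z i w) (A w) N) = Cs}"

text \<open>
  The list \<open>[C\<^sub>1, \<dots>, C\<^sub>k]\<close> is 0-indexed: \<open>C\<^sub>l\<close> is \<open>Cs ! (l - 1)\<close>, and
  \<open>{C\<^sub>1, \<dots>, C\<^sub>h}\<close> is \<open>set (take h Cs)\<close>.
\<close>

definition geom_param ::
    "('s \<times> 'c) set \<Rightarrow> real \<Rightarrow> real \<Rightarrow> ('c \<Rightarrow> real) \<Rightarrow> ('s \<Rightarrow> real) \<Rightarrow> 'c list \<Rightarrow> nat \<Rightarrow> real" where
  "geom_param G lbar mbar lam mu Cs h =
     (sum mu (compatible_goods G (set (take h Cs))) - sum lam (set (take h Cs))) / (lbar + mbar)"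

text \<open>
  The operator \<open>\<E>\<close>, for real and for complex \<open>f\<close>; \<open>P\<close> stands for \<open>\<pi>\<^sub>Y\<close>.
\<close>

definition delay_mean ::
    "('s \<times> 'c::finite) set \<Rightarrow> real \<Rightarrow> ('s \<Rightarrow> real) \<Rightarrow> real \<Rightarrow> ('c list \<Rightarrow> real) \<Rightarrow> 's \<Rightarrow> 'c \<Rightarrow>
     ('c list \<Rightarrow> nat \<Rightarrow> 'a::real_vector) \<Rightarrow> 'a" where
  "delay_mean G mbar mu r P s c f =
     (1 / r * (mu s / mbar)) *\<^sub>R
     (\<Sum>k = 1..CARD('c). \<Sum>C | card C = k. \<Sum>Cs\<in>permutations_of_set C. \<Sum>l = 1..k.
        (P Cs * of_bool (Cs ! (l - 1) = c \<and> s \<notin> compatible_goods G (set (take (l - 1) Cs)))) *\<^sub>R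
          f Cs l)"

end

theory Submission
  imports Defs
begin

text \<open>
  Record, at each time, the positions from the oldest unmatched agent on, forgetting everything except
  the types and places of the unmatched agents. This word is a Markov chain driven by the i.i.d. items,
  with a stationary distribution of product form: behind unmatched agents of the types \<open>D\<close>, an agent of
  type \<open>c\<close> has weight \<open>\<lambda>\<^sub>c\<close> and an empty place \<open>1 - \<mu>(S(D))\<close> (after normalising the total rate to 1);
  invariance is a telescoping sum. A copy started from the empty word is dominated by any copy driven by
  the same items; the surplus of unmatched agents never grows, and it drops whenever the smaller copy is
  empty and goods of all types of positive rate arrive next. By the 0-1 law this happens infinitely
  often, so all initial words couple, and
  in a stationary matching the word has the product-form law and is independent of the next item.
  Given the order \<open>C\<^sub>1, \<dots>, C\<^sub>k\<close> of first appearances the word splits into \<open>k\<close> blocks of independent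
  geometric lengths with parameters \<open>p\<^sub>h\<close>, and the delay of a good that takes \<open>C\<^sub>l\<close> is the sum of the
  lengths of the blocks \<open>l, \<dots>, k\<close>. The matching rate is identified with the corresponding
  probability by an ergodic theorem, for which constancy of the limit again comes from the 0-1 law.
\<close>

section \<open>Words of waiting agents\<close>

text \<open>Empty places are kept because a delay counts positions, not agents: it is the distance
  from the served agent to the end of the word. The obstacle is that the hypotheses give neither the
  law of the word nor its independence of the next item. The matching is only stationary jointly
  with the items and may look into the future. The comparison must therefore hold path by path, for
  every initial word, however it was chosen. Domination provides this, and stationarity then moves
  the start of the comparison towards minus infinity. Stability enters twice: it makes every
  \<open>p\<close> of a nonempty set positive, so that the geometric sums over the blocks converge,
  and it supplies a compatible good of positive rate for every agent type. A uniform lower bound for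
  the chance of being empty is read off from the invariant distribution, which takes the place of a
  recurrence argument. For the matching rate, shift-invariant events of items and matching are not
  known to be trivial; the 0-1 law is applied to the copy started empty, a function of the items
  alone, with which the word of the matching eventually agrees.\<close>

text \<open>A word lists consecutive positions, the oldest one first; \<open>None\<close> stands for a position that holds
  no waiting agent.\<close>

type_synonym 'c word = "'c option list"

definition serves :: "('s \<times> 'c) set \<Rightarrow> 's \<Rightarrow> 'c option \<Rightarrow> bool" where
  "serves G s o' \<longleftrightarrow> (\<exists>c. o' = Some c \<and> (s, c) \<in> G)"

lemma serves_simps [simp]: "\<not> serves G s None" "serves G s (Some c) \<longleftrightarrow> (s, c) \<in> G"
  by (auto simp: serves_def)

text \<open>The oldest letter comes first, so blanking the leftmost compatible letter is the first
  come first served rule. The place of the served agent stays as an idle letter, which keeps the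
  distances between the other letters.\<close>

fun kill :: "('s \<times> 'c) set \<Rightarrow> 's \<Rightarrow> 'c word \<Rightarrow> 'c word" where
  "kill G s [] = []"
| "kill G s (o' # w) = (if serves G s o' then None # w else o' # kill G s w)"

text \<open>A good occupies a position of its own, whether it is matched or lost; hence the idle
  letter it leaves at the end.\<close>

fun arrive :: "('s \<times> 'c) set \<Rightarrow> 'c word \<Rightarrow> 'c + 's \<Rightarrow> 'c word" where
  "arrive G w (Inl c) = w @ [Some c]"
| "arrive G w (Inr s) = kill G s w @ [None]"

definition run :: "('s \<times> 'c) set \<Rightarrow> 'c word \<Rightarrow> ('c + 's) list \<Rightarrow> 'c word" where
  "run G = foldl (arrive G)"

definition trim :: "'c word \<Rightarrow> 'c word" where
  "trim w = dropWhile (\<lambda>o'. o' = None) w"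

definition cnt :: "'c word \<Rightarrow> nat" where
  "cnt w = length (filter (\<lambda>o'. o' \<noteq> None) w)"

text \<open>The smaller word arises from the larger one by blanking agents. Equal lengths keep the
  two copies aligned by position.\<close>

definition dominated :: "'c word \<Rightarrow> 'c word \<Rightarrow> bool" where
  "dominated = list_all2 (\<lambda>o1 o2. o1 = None \<or> o1 = o2)"

lemma cnt_simps [simp]: "cnt [] = 0" "cnt (None # w) = cnt w" "cnt (Some c # w) = Suc (cnt w)"
  "cnt (v @ w) = cnt v + cnt w" "cnt (replicate k None) = 0"
  by (auto simp: cnt_def)

lemma run_simps [simp]: "run G w [] = w" "run G w (y # ys) = run G (arrive G w y) ys"
  "run G w (xs @ ys) = run G (run G w xs) ys"
  by (auto simp: run_def)

lemma length_kill [simp]: "length (kill G s w) = length w"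
  by (induction w) auto

lemma length_arrive [simp]: "length (arrive G w y) = Suc (length w)"
  by (cases y) auto

lemma length_run [simp]: "length (run G w ys) = length w + length ys"
  by (induction ys arbitrary: w) auto

lemma kill_append_None [simp]: "kill G s (replicate k None @ w) = replicate k None @ kill G s w"
  by (induction k) auto

lemma arrive_append_None: "arrive G (replicate k None @ w) y = replicate k None @ arrive G w y"
  by (cases y) auto

lemma run_append_None: "run G (replicate k None @ w) ys = replicate k None @ run G w ys"
  by (induction ys arbitrary: w) (auto simp: arrive_append_None)

lemma trim_append_None [simp]: "trim (replicate k None @ w) = trim w"
  by (induction k) (auto simp: trim_def)

lemma trim_decomp: obtains k where "w = replicate k None @ trim w"
proof -
  have "w = takeWhile (\<lambda>o'. o' = None) w @ trim w"
    by (simp add: trim_def)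
  moreover have "takeWhile (\<lambda>o'. o' = None) w =
      replicate (length (takeWhile (\<lambda>o'. o' = None) w)) None"
    by (induction w) auto
  ultimately show ?thesis
    using that by metis
qed

lemma trim_trim [simp]: "trim (trim w) = trim w"
  by (metis trim_append_None trim_decomp)

lemma cnt_trim [simp]: "cnt (trim w) = cnt w"
  by (metis add_0 cnt_simps(4,5) trim_decomp)

text \<open>Idle letters in front never influence a later service. Trimmed words can therefore serve
  as the states of a chain.\<close>

lemma trim_run: "trim (run G (trim w) ys) = trim (run G w ys)"
  by (metis run_append_None trim_append_None trim_decomp)

lemma trim_arrive: "trim (arrive G (trim w) y) = trim (arrive G w y)"
  using trim_run[of G w "[y]"] by simp

lemma cnt_eq_0_iff: "cnt w = 0 \<longleftrightarrow> w = replicate (length w) None"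
proof (induction w)
  case (Cons o' w) then show ?case by (cases o') auto
qed auto

lemma trim_eq_Nil_iff: "trim w = [] \<longleftrightarrow> cnt w = 0"
proof
  assume "cnt w = 0"
  then have "w = replicate (length w) None @ []" by (simp add: cnt_eq_0_iff)
  then show "trim w = []" by (metis trim_append_None trim_def dropWhile.simps(1))
next
  assume "trim w = []" then show "cnt w = 0" by (metis cnt_simps(1) cnt_trim)
qed

lemma trim_eq_Cons: "trim w = o' # v \<Longrightarrow> \<exists>c. o' = Some c"
  by (metis (mono_tags, lifting) dropWhile_eq_Cons_conv not_None_eq trim_def)

lemma cnt_kill_le: "cnt (kill G s w) \<le> cnt w" "cnt w \<le> Suc (cnt (kill G s w))"
proof (induction w)
  case (Cons o' w)
  { case 1 show ?case using Cons by (cases o') auto }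
  { case 2 show ?case using Cons by (cases o') auto }
qed auto

section \<open>Domination and the surplus of waiting agents\<close>

lemma dominated_kill_self: "dominated (kill G s w) w"
  by (induction w) (auto simp: dominated_def list.rel_refl)

lemma dominated_trans: "dominated u v \<Longrightarrow> dominated v w \<Longrightarrow> dominated u w"
  unfolding dominated_def by (erule (1) list_all2_trans[rotated]) auto

lemma dominated_None: "dominated (replicate (length w) None) w"
  by (induction w) (auto simp: dominated_def)

lemma dominated_cnt: "dominated w w' \<Longrightarrow> cnt w \<le> cnt w'"
  unfolding dominated_def
proof (induction rule: list_all2_induct)
  case (Cons x xs y ys) then show ?case by (cases x; cases y) auto
qed auto

lemma dominated_cnt_eq: "dominated w w' \<Longrightarrow> cnt w = cnt w' \<Longrightarrow> w = w'"
  unfolding dominated_def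
proof (induction rule: list_all2_induct)
  case (Cons x xs y ys)
  have "cnt xs \<le> cnt ys" using Cons(2) by (intro dominated_cnt) (simp add: dominated_def)
  then show ?case using Cons by (cases x; cases y) auto
qed auto

text \<open>The copies can only part where the larger one serves an agent that the smaller one does
  not have. The larger copy then loses exactly one agent and the smaller one at most one, further to
  the right, so the order survives and the surplus does not grow. The inequality uses sums because
  subtraction of naturals truncates.\<close>

lemma dominated_kill:
  assumes "dominated w w'"
  shows "dominated (kill G s w) (kill G s w') \<and>
    cnt (kill G s w') + cnt w \<le> cnt w' + cnt (kill G s w)"
  using assms unfolding dominated_def
proof (induction rule: list_all2_induct)
  case Nil then show ?case by simp
next
  case (Cons x xs y ys)
  show ?case
  proof (cases "x = y")
    case True
    then show ?thesis using Cons by (cases x) auto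
  next
    case False
    then obtain c where x: "x = None" and y: "y = Some c" using Cons by (cases y) auto
    show ?thesis
    proof (cases "(s, c) \<in> G")
      case True
      have "dominated xs ys" using Cons(2) by (simp add: dominated_def)
      then have "dominated (kill G s xs) ys" by (rule dominated_trans[OF dominated_kill_self])
      then show ?thesis
        using x y True cnt_kill_le[where G = G and s = s and w = xs] by (auto simp: dominated_def)
    next
      case False
      then show ?thesis using x y Cons by auto
    qed
  qed
qed

lemma dominated_arrive:
  assumes "dominated w w'"
  shows "dominated (arrive G w y) (arrive G w' y) \<and>
    cnt (arrive G w' y) + cnt w \<le> cnt w' + cnt (arrive G w y)"
proof (cases y)
  case (Inl c)
  then show ?thesis using assms by (auto simp: dominated_def intro!: list_all2_appendI)
next
  case (Inr s)
  then show ?thesis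
    using dominated_kill[OF assms, of G s] by (auto simp: dominated_def intro!: list_all2_appendI)
qed

lemma dominated_run:
  assumes "dominated w w'"
  shows "dominated (run G w ys) (run G w' ys) \<and>
    cnt (run G w' ys) + cnt w \<le> cnt w' + cnt (run G w ys)"
  using assms
proof (induction ys arbitrary: w w')
  case (Cons y ys)
  from dominated_arrive[OF Cons.prems, of G y] Cons.IH[of "arrive G w y" "arrive G w' y"]
  show ?case by auto
qed auto

lemma cnt_kill_less:
  assumes "Some c \<in> set w" "(s, c) \<in> G"
  shows "cnt (kill G s w) < cnt w"
  using assms
proof (induction w)
  case (Cons o' w) then show ?case by (cases o') auto
qed auto

lemma Some_in_kill: "Some c \<in> set w \<Longrightarrow> Some c \<in> set (kill G s w) \<or> cnt (kill G s w) < cnt w"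
proof (induction w)
  case (Cons o' w) then show ?case by (cases o') auto
qed auto

lemma cnt_run_goods_le: "cnt (run G w (map Inr ss)) \<le> cnt w"
proof (induction ss arbitrary: w)
  case (Cons s ss)
  then show ?case using cnt_kill_le(1)[where G = G and s = s and w = w] Cons[of "kill G s w @ [None]"] by auto
qed auto

text \<open>Goods add no agents, so one service suffices. Either a good before \<open>s\<close>
  already serves somebody, or the agent of type \<open>c\<close> is still present when
  \<open>s\<close> arrives, and then \<open>s\<close> serves someone.\<close>

lemma cnt_run_goods_less:
  assumes "Some c \<in> set w" "s \<in> set ss" "(s, c) \<in> G"
  shows "cnt (run G w (map Inr ss)) < cnt w"
  using assms
proof (induction ss arbitrary: w)
  case (Cons s' ss)
  let ?w = "kill G s' w @ [None]"
  have *: "cnt (run G ?w (map Inr ss)) \<le> cnt ?w" by (rule cnt_run_goods_le)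
  show ?case
  proof (cases "cnt (kill G s' w) < cnt w")
    case True then show ?thesis using * by simp
  next
    case False
    then have "Some c \<in> set ?w" "s \<noteq> s'" using Some_in_kill[OF Cons.prems(1), of G s'] cnt_kill_less[OF Cons.prems(1,3)] by auto
    then have "cnt (run G ?w (map Inr ss)) < cnt ?w"
      using Cons.IH[of ?w] Cons.prems(2,3) by auto
    then show ?thesis using cnt_kill_le(1)[where G = G and s = s' and w = w] by simp
  qed
qed auto

lemma cnt_pos: "cnt w > 0 \<Longrightarrow> \<exists>c. Some c \<in> set w"
  by (auto simp: cnt_def filter_empty_conv)

text \<open>When the copy started empty is empty, every agent waiting in another copy is surplus,
  and the goods \<open>gs\<close> that arrive next remove at least one of them if each type is
  served by some good in \<open>gs\<close>.\<close>

definition flush :: "('s \<times> 'c) set \<Rightarrow> 's list \<Rightarrow> (nat \<Rightarrow> 'c + 's) \<Rightarrow> nat \<Rightarrow> bool" where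
  "flush G gs y n \<longleftrightarrow> trim (run G [] (map y [0..<n])) = [] \<and>
     map (\<lambda>i. y (n + i)) [0..<length gs] = map Inr gs"

lemma map_upt_add: "map y [0..<m + n] = map y [0..<m] @ map (\<lambda>i. y (m + i)) [0..<n]"
  by (rule nth_equalityI) (auto simp: nth_append)

text \<open>The surplus of \<open>run G w\<close> over the empty start never grows, and each flush with a positive
  surplus makes it smaller.\<close>

lemma eventually_coupled:
  fixes y :: "nat \<Rightarrow> 'c + 's"
  assumes serve: "\<And>c. \<exists>s\<in>set gs. (s, c) \<in> G"
    and inf: "\<exists>\<^sub>\<infinity>n. flush G gs y n"
  shows "\<exists>n0. \<forall>n\<ge>n0. run G w (map y [0..<n]) = replicate (length w) None @ run G [] (map y [0..<n])"
proof -
  \<comment> \<open>Padding with idle letters gives both copies the same length, as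
    \<open>dominated\<close> requires.\<close>
  define u where "u n = replicate (length w) None @ run G [] (map y [0..<n])" for n
  define v where "v n = run G w (map y [0..<n])" for n
  define d where "d n = cnt (v n) - cnt (u n)" for n
  have u: "u n = run G (replicate (length w) None) (map y [0..<n])" for n
    using run_append_None[of G "length w" "[]"] by (simp add: u_def)
  have dom: "dominated (u n) (v n)" for n
    unfolding u v_def using dominated_run[OF dominated_None] by blast
  have step: "d (n + k) \<le> d n" for n k
  proof -
    define xs where "xs = map (\<lambda>i. y (n + i)) [0..<k]"
    have "u (n + k) = run G (u n) xs" "v (n + k) = run G (v n) xs"
      unfolding u v_def map_upt_add xs_def by simp_all
    then have "cnt (v (n + k)) + cnt (u n) \<le> cnt (v n) + cnt (u (n + k))"
      using dominated_run[OF dom[of n], of G xs] by simp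
    then show ?thesis unfolding d_def by linarith
  qed
  \<comment> \<open>A nonincreasing sequence of naturals stays at its least value once it is
    reached; a later flush would lower it further unless that value is 0.\<close>
  define D where "D = (LEAST k. \<exists>n. d n = k)"
  obtain n0 where n0: "d n0 = D"
    unfolding D_def using LeastI[of "\<lambda>k. \<exists>n. d n = k" "d 0"] by blast
  have D: "D \<le> d n" for n
    unfolding D_def by (rule Least_le) auto
  obtain n where n: "n \<ge> n0" "flush G gs y n"
    using inf by (meson INFM_nat_le)
  have cu: "cnt (u n) = 0"
    using n(2) by (simp add: flush_def u_def trim_eq_Nil_iff)
  have dn: "d n = D" using step[of n0 "n - n0"] n(1) D[of n] n0 by simp
  have "D = 0"
  proof (rule ccontr)
    assume "D \<noteq> 0"
    then have pos: "cnt (v n) > 0" using dn cu by (simp add: d_def)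
    then obtain c where c: "Some c \<in> set (v n)" using cnt_pos by blast
    obtain s where s: "s \<in> set gs" "(s, c) \<in> G" using serve by blast
    have "v (n + length gs) = run G (v n) (map Inr gs)"
      using n(2) unfolding v_def map_upt_add flush_def by simp
    then have "cnt (v (n + length gs)) < cnt (v n)"
      using cnt_run_goods_less[OF c s] by simp
    then have "d (n + length gs) < d n" using cu by (simp add: d_def)
    then show False using D[of "n + length gs"] dn by simp
  qed
  then have "d m = 0" if "m \<ge> n0" for m
    using step[of n0 "m - n0"] n0 that by simp
  then have "cnt (u m) = cnt (v m)" if "m \<ge> n0" for m
    using dominated_cnt[OF dom[of m]] that by (simp add: d_def le_antisym)
  then have "v m = u m" if "m \<ge> n0" for m
    using dominated_cnt_eq[OF dom[of m]] that by simp
  then show ?thesis unfolding u_def v_def by blast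
qed

section \<open>Product-form weights\<close>

definition types :: "'c word \<Rightarrow> 'c set" where
  "types w = {c. Some c \<in> set w}"

lemma types_simps [simp]: "types [] = {}" "types (None # w) = types w"
  "types (Some c # w) = insert c (types w)" "types (v @ w) = types v \<union> types w"
  by (auto simp: types_def)

lemma compatible_goods_simps [simp]: "compatible_goods G {} = {}"
  "s \<in> compatible_goods G (insert c D) \<longleftrightarrow> (s, c) \<in> G \<or> s \<in> compatible_goods G D"
  "s \<in> compatible_goods G (D \<union> E) \<longleftrightarrow> s \<in> compatible_goods G D \<or> s \<in> compatible_goods G E"
  "s \<in> compatible_goods G {c} \<longleftrightarrow> (s, c) \<in> G"
  by (auto simp: compatible_goods_def)

lemma finite_words [simp]: "finite {w :: 'c::finite word. length w = n \<and> P w}"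
  by (rule finite_subset[OF _ finite_lists_length_eq[of UNIV n]]) auto

lemma trim_None_neq: "trim (None # v) \<noteq> None # v"
  by (metis trim_eq_Cons option.distinct(1))

lemma trim_eq_self: "trim w = w \<longleftrightarrow> w = [] \<or> (\<exists>c v. w = Some c # v)"
proof (cases w)
  case (Cons o' v) then show ?thesis
    using trim_None_neq[of v] by (cases o') (auto simp: trim_def)
qed (simp add: trim_def)

locale fcfs_weights =
  fixes G :: "('s::finite \<times> 'c::finite) set" and a :: "'c \<Rightarrow> real" and b :: "'s \<Rightarrow> real"
  assumes a_nonneg: "a c \<ge> 0" and b_nonneg: "b s \<ge> 0"
    and total: "sum a UNIV + sum b UNIV = 1"
    and stable: "C \<noteq> {} \<Longrightarrow> sum a C < sum b (compatible_goods G C)"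
begin

definition q :: "'c set \<Rightarrow> real" where
  "q D = 1 - sum b (compatible_goods G D)"

definition p :: "'c set \<Rightarrow> real" where
  "p D = sum b (compatible_goods G D) - sum a D"

text \<open>The unnormalised stationary distribution. An idle letter behind waiting agents of the types \<open>D\<close>
  has as weight the probability that an item is not a good that would take one of them.\<close>

fun wt :: "'c set \<Rightarrow> 'c word \<Rightarrow> real" where
  "wt D [] = 1"
| "wt D (None # w) = q D * wt D w"
| "wt D (Some c # w) = a c * wt (insert c D) w"

lemma q_nonneg: "q D \<ge> 0"
proof -
  have "sum b (compatible_goods G D) \<le> sum b UNIV"
    by (rule sum_mono2) (auto simp: b_nonneg)
  moreover have "sum a UNIV \<ge> 0" by (rule sum_nonneg) (auto simp: a_nonneg)
  ultimately show ?thesis using total by (simp add: q_def)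
qed

lemma wt_nonneg: "wt D w \<ge> 0"
  by (induction D w rule: wt.induct) (auto simp: q_nonneg a_nonneg)

lemma p_pos: "D \<noteq> {} \<Longrightarrow> p D > 0"
  using stable by (simp add: p_def)

text \<open>A letter behind the types \<open>D\<close> that brings no new type is idle or an agent
  of a type in \<open>D\<close>, with total weight \<open>q D + sum a D\<close>. The deficit from 1
  becomes the parameter of the block length.\<close>

lemma p_q: "q D + sum a D = 1 - p D"
  by (simp add: p_def q_def)

lemma p_le_1: "p D \<le> 1"
  using p_q[of D] q_nonneg[of D] sum_nonneg[of D a] a_nonneg by simp

lemma q_less_1: "D \<noteq> {} \<Longrightarrow> q D < 1"
  using p_pos[of D] p_q[of D] sum_nonneg[of D a] a_nonneg by simp

lemma wt_append: "wt D (v @ w) = wt D v * wt (D \<union> types v) w"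
  by (induction D v rule: wt.induct) auto

lemma wt_replicate_None: "wt D (replicate k None) = q D ^ k"
  by (induction k) auto

section \<open>Balance equations for the product-form weights\<close>

lemma q_diff: "q D - q (insert c D) = (\<Sum>s | (s, c) \<in> G \<and> s \<notin> compatible_goods G D. b s)"
proof -
  have "sum b (compatible_goods G (insert c D)) =
      sum b (compatible_goods G D \<union> {s. (s, c) \<in> G \<and> s \<notin> compatible_goods G D})"
    by (rule arg_cong[of _ _ "sum b"]) auto
  also have "\<dots> = sum b (compatible_goods G D) + (\<Sum>s | (s, c) \<in> G \<and> s \<notin> compatible_goods G D. b s)"
    by (subst sum.union_disjoint) auto
  finally show ?thesis by (simp add: q_def)
qed

text \<open>The flow into \<open>w\<close> through services by \<open>s\<close> that do not change
  the length. The set \<open>D\<close> of types in front makes a recursion along the word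
  possible.\<close>

definition pre :: "'c set \<Rightarrow> 's \<Rightarrow> 'c word \<Rightarrow> real" where
  "pre D s w = (\<Sum>w0 | length w0 = length w \<and> kill G s w0 = w. wt D w0)"

lemma pre_Nil: "pre D s [] = 1"
proof -
  have "{w0. length w0 = 0 \<and> kill G s w0 = []} = {[]}" by auto
  then show ?thesis by (simp add: pre_def)
qed

text \<open>If the agent in front could have been served by \<open>s\<close>, it would have been
  blanked before anyone behind it; hence the value 0.\<close>

lemma pre_Some: "pre D s (Some c # w) = (if (s, c) \<in> G then 0 else a c * pre (insert c D) s w)"
proof -
  have "{w0. length w0 = length (Some c # w) \<and> kill G s w0 = Some c # w} =
     (if (s, c) \<in> G then {} else Cons (Some c) ` {w0. length w0 = length w \<and> kill G s w0 = w})"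
    (is "?A = ?B")
  proof
    show "?A \<subseteq> ?B"
    proof
      fix w0 assume "w0 \<in> ?A"
      then show "w0 \<in> ?B" by (cases w0) (auto split: if_splits)
    qed
  qed (auto split: if_splits)
  then show ?thesis
    by (auto simp: pre_def sum.reindex sum_distrib_left)
qed

text \<open>The idle letter in front either was idle before, and the service happened behind it or
  not at all, or it held the agent just served, and nothing behind it changed.\<close>

lemma pre_None:
  "pre D s (None # w) = q D * pre D s w + (\<Sum>c | (s, c) \<in> G. a c * wt (insert c D) w)"
proof -
  let ?A1 = "Cons None ` {w0. length w0 = length w \<and> kill G s w0 = w}"
  let ?A2 = "(\<lambda>c. Some c # w) ` {c. (s, c) \<in> G}"
  have "{w0. length w0 = length (None # w) \<and> kill G s w0 = None # w} = ?A1 \<union> ?A2"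
    (is "?A = ?B")
  proof
    show "?A \<subseteq> ?B"
    proof
      fix w0 assume "w0 \<in> ?A"
      then show "w0 \<in> ?B" by (cases w0) (auto simp: serves_def split: if_splits)
    qed
  qed auto
  then have "pre D s (None # w) = sum (wt D) (?A1 \<union> ?A2)"
    by (simp add: pre_def)
  also have "\<dots> = sum (wt D) ?A1 + sum (wt D) ?A2"
    by (rule sum.union_disjoint) auto
  also have "sum (wt D) ?A1 = q D * pre D s w"
    by (subst sum.reindex) (auto simp: pre_def sum_distrib_left)
  also have "sum (wt D) ?A2 = (\<Sum>c | (s, c) \<in> G. a c * wt (insert c D) w)"
    by (subst sum.reindex) (auto simp: inj_on_def)
  finally show ?thesis .
qed

text \<open>Turning an idle position with earlier types \<open>D\<close> into an agent of type \<open>c\<close> lowers the weight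
  of the idle letters behind it from \<open>q D\<close> to \<open>q (insert c D)\<close>, and the difference of the two is
  exactly the probability of a good that serves \<open>c\<close> first.  Hence the sum over the positions
  telescopes.\<close>

lemma pre_telescope:
  "(\<Sum>s | s \<notin> compatible_goods G D. b s * pre D s w) =
     (\<Sum>s | s \<notin> compatible_goods G (D \<union> types w). b s) * wt D w +
     (\<Sum>c\<in>UNIV. a c * (wt D w - wt (insert c D) w))"
proof (induction w arbitrary: D)
  case Nil
  then show ?case by (simp add: pre_Nil)
next
  case (Cons o' w)
  show ?case
  proof (cases o')
    case (Some c')
    have "(\<Sum>s | s \<notin> compatible_goods G D. b s * pre D s (Some c' # w)) =
        (\<Sum>s | s \<notin> compatible_goods G (insert c' D). a c' * (b s * pre (insert c' D) s w))"
      by (rule sum.mono_neutral_cong_right) (auto simp: pre_Some)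
    also have "\<dots> = a c' * (\<Sum>s | s \<notin> compatible_goods G (insert c' D). b s * pre (insert c' D) s w)"
      by (simp add: sum_distrib_left)
    also have "\<dots> = (\<Sum>s | s \<notin> compatible_goods G (D \<union> types (Some c' # w)). b s) * wt D (Some c' # w)
        + (\<Sum>c\<in>UNIV. a c * (wt D (Some c' # w) - wt (insert c D) (Some c' # w)))"
      by (subst Cons.IH) (simp add: algebra_simps sum_distrib_left insert_commute sum_subtractf)
    finally show ?thesis using Some by simp
  next
    case None
    have "(\<Sum>s | s \<notin> compatible_goods G D. b s * (\<Sum>c | (s, c) \<in> G. a c * wt (insert c D) w)) =
        (\<Sum>s | s \<notin> compatible_goods G D. \<Sum>c | c \<in> UNIV \<and> (s, c) \<in> G. a c * wt (insert c D) w * b s)"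
      by (simp add: sum_distrib_left mult_ac)
    also have "\<dots> = (\<Sum>c\<in>UNIV. \<Sum>s | s \<in> {s. s \<notin> compatible_goods G D} \<and> (s, c) \<in> G. a c * wt (insert c D) w * b s)"
      by (rule sum.swap_restrict) auto
    also have "\<dots> = (\<Sum>c\<in>UNIV. a c * wt (insert c D) w * (q D - q (insert c D)))"
      by (intro sum.cong refl) (auto simp: q_diff sum_distrib_left conj_commute)
    finally have *: "(\<Sum>s | s \<notin> compatible_goods G D. b s * (\<Sum>c | (s, c) \<in> G. a c * wt (insert c D) w))
      = (\<Sum>c\<in>UNIV. a c * wt (insert c D) w * (q D - q (insert c D)))" .
    have "(\<Sum>s | s \<notin> compatible_goods G D. b s * pre D s (None # w)) =
        q D * (\<Sum>s | s \<notin> compatible_goods G D. b s * pre D s w) +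
        (\<Sum>s | s \<notin> compatible_goods G D. b s * (\<Sum>c | (s, c) \<in> G. a c * wt (insert c D) w))"
      by (simp add: pre_None distrib_left sum.distrib sum_distrib_left mult_ac)
    also have "\<dots> = (\<Sum>s | s \<notin> compatible_goods G (D \<union> types (None # w)). b s) * wt D (None # w)
        + (\<Sum>c\<in>UNIV. a c * (wt D (None # w) - wt (insert c D) (None # w)))"
      unfolding * Cons.IH
      by (simp add: algebra_simps sum_distrib_left sum_subtractf sum.distrib)
    finally show ?thesis using None by simp
  qed
qed

lemma sum_b_compl: "(\<Sum>s | s \<notin> compatible_goods G D. b s) = q D - sum a UNIV"
proof -
  have "sum b UNIV = sum b (compatible_goods G D) + (\<Sum>s | s \<notin> compatible_goods G D. b s)"
    by (subst sum.union_disjoint[symmetric]) (auto intro!: arg_cong[of _ _ "sum b"])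
  then show ?thesis using total by (simp add: q_def)
qed

fun pr :: "'c + 's \<Rightarrow> real" where
  "pr (Inl c) = a c"
| "pr (Inr s) = b s"

lemma pr_nonneg: "pr y \<ge> 0"
  by (cases y) (auto simp: a_nonneg b_nonneg)

lemma sum_pr: "sum pr UNIV = 1"
proof -
  have "(UNIV :: ('c + 's) set) = Inl ` UNIV \<union> Inr ` UNIV"
    by (auto simp: image_iff) (metis sumE)
  then have "sum pr UNIV = sum pr (Inl ` UNIV \<union> Inr ` UNIV)" by simp
  also have "\<dots> = sum a UNIV + sum b UNIV"
    by (subst sum.union_disjoint) (auto simp: sum.reindex)
  finally show ?thesis using total by simp
qed

text \<open>The transitions that end in \<open>w @ [None]\<close>; those of the second set serve the oldest agent,
  so that idle letters in front of \<open>w\<close> are trimmed away.\<close>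

definition preds :: "'c word \<Rightarrow> nat \<Rightarrow> ('c word \<times> ('c + 's)) set" where
  "preds w K = (SIGMA w0 : {w0. length w0 = length w}. Inr ` {s. kill G s w0 = w}) \<union>
     (\<lambda>(j, c, s). (Some c # replicate j None @ w, Inr s)) ` ({..<K} \<times> {(c, s). (s, c) \<in> G})"

lemma finite_preds [simp]: "finite (preds w K)"
proof -
  have "finite {w0 :: 'c word. length w0 = length w}" using finite_words[of "length w" "\<lambda>_. True"] by simp
  then show ?thesis unfolding preds_def by (intro finite_UnI finite_SigmaI finite_imageI) auto
qed

text \<open>An idle letter in front survives every service, so a predecessor of the same length of a
  trimmed word is itself trimmed.\<close>

lemma preds_trim:
  assumes "trim w = w" "(w0, y) \<in> preds w K"
  shows "trim w0 = w0 \<and> trim (arrive G w0 y) = trim (w @ [None])"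
  using assms(2) unfolding preds_def
proof (elim UnE)
  assume "(w0, y) \<in> (SIGMA w0 : {w0. length w0 = length w}. Inr ` {s. kill G s w0 = w})"
  then obtain s where s: "y = Inr s" "length w0 = length w" "kill G s w0 = w" by auto
  have "trim w0 = w0"
    using assms(1) s(2,3) unfolding trim_eq_self by (cases w0) (auto split: if_splits)
  then show ?thesis using s by simp
next
  assume "(w0, y) \<in> (\<lambda>(j, c, s). (Some c # replicate j None @ w, Inr s)) ` ({..<K} \<times> {(c, s). (s, c) \<in> G})"
  then obtain j c s where y: "y = Inr s" "w0 = Some c # replicate j None @ w" "(s, c) \<in> G" by auto
  have "arrive G w0 y = replicate (Suc j) None @ (w @ [None])"
    using y by simp
  then have "trim (arrive G w0 y) = trim (w @ [None])"
    by (metis trim_append_None)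
  then show ?thesis using y by (auto simp: trim_eq_self)
qed

text \<open>The telescope leaves a loss of \<open>a c * wt {c} w\<close> for each type
  \<open>c\<close>, and the transitions that serve the oldest agent give it back: \<open>j\<close>
  idle letters behind that agent have weight \<open>q {c} ^ j\<close>, and the goods that serve it
  have total probability \<open>1 - q {c}\<close>. Bounding \<open>j\<close> by \<open>K\<close>
  leaves the geometric tail that is subtracted.\<close>

lemma sum_preds:
  "(\<Sum>(w0, y)\<in>preds w K. wt {} w0 * pr y) =
     q (types w) * wt {} w - (\<Sum>c\<in>UNIV. a c * wt {c} w * q {c} ^ K)"
proof -
  let ?A = "SIGMA w0 : {w0. length w0 = length w}. Inr ` {s. kill G s w0 = w}"
  let ?I = "{..<K} \<times> {(c, s). (s, c) \<in> G}"
  let ?f = "\<lambda>(j, c, s). (Some c # replicate j None @ w, Inr s :: 'c + 's)"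
  let ?h = "\<lambda>(w0, y). wt {} w0 * pr y"
  have fin: "finite {w0 :: 'c word. length w0 = length w}"
    using finite_words[of "length w" "\<lambda>_. True"] by simp
  have finA: "finite ?A" using fin by (intro finite_SigmaI finite_imageI) auto
  have inj: "inj_on ?f ?I"
    by (auto simp: inj_on_def)
  have finI: "finite (?f ` ?I)" by simp
  have lenA: "length (fst x) = length w" if "x \<in> ?A" for x
    using that by (cases x) simp
  have lenI: "length (fst x) > length w" if "x \<in> ?f ` ?I" for x
    using that by (clarsimp)
  have disj: "?A \<inter> ?f ` ?I = {}"
  proof (rule equals0I)
    fix x assume "x \<in> ?A \<inter> ?f ` ?I"
    then show False using lenA[of x] lenI[of x] by (metis IntD1 IntD2 less_irrefl)
  qed
  have "sum ?h (preds w K) = sum ?h ?A + sum ?h (?f ` ?I)"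
    unfolding preds_def by (rule sum.union_disjoint[OF finA finI disj])
  also have "sum ?h ?A = (\<Sum>w0 | length w0 = length w. \<Sum>s | s \<in> UNIV \<and> kill G s w0 = w. b s * wt {} w0)"
    using fin by (subst sum.Sigma[symmetric]) (auto simp: sum.reindex mult.commute)
  also have "\<dots> = (\<Sum>s\<in>UNIV. \<Sum>w0 | w0 \<in> {w0. length w0 = length w} \<and> kill G s w0 = w. b s * wt {} w0)"
    by (rule sum.swap_restrict) (use fin in auto)
  also have "\<dots> = (\<Sum>s | s \<notin> compatible_goods G {}. b s * pre {} s w)"
    by (simp add: pre_def sum_distrib_left)
  also have "\<dots> = (q (types w) - sum a UNIV) * wt {} w + (\<Sum>c\<in>UNIV. a c * (wt {} w - wt {c} w))"
    by (subst pre_telescope) (simp add: sum_b_compl)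
  also have "sum ?h (?f ` ?I) = (\<Sum>(j, c, s)\<in>?I. a c * wt {c} w * (q {c} ^ j * b s))"
    by (subst sum.reindex[OF inj]) (auto simp: wt_append wt_replicate_None types_def intro!: sum.cong)
  also have "\<dots> = (\<Sum>j<K. \<Sum>(c, s)\<in>{(c, s). (s, c) \<in> G}. a c * wt {c} w * (q {c} ^ j * b s))"
    by (subst sum.cartesian_product[symmetric]) simp
  also have "\<dots> = (\<Sum>j<K. \<Sum>c\<in>UNIV. \<Sum>s | (s, c) \<in> G. a c * wt {c} w * (q {c} ^ j * b s))"
  proof (rule sum.cong[OF refl])
    fix j
    have "{(c, s). (s, c) \<in> G} = (SIGMA c : UNIV. {s. (s, c) \<in> G})" by auto
    then show "(\<Sum>(c, s)\<in>{(c, s). (s, c) \<in> G}. a c * wt {c} w * (q {c} ^ j * b s)) =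
       (\<Sum>c\<in>UNIV. \<Sum>s | (s, c) \<in> G. a c * wt {c} w * (q {c} ^ j * b s))"
      by (simp add: sum.Sigma)
  qed
  also have "\<dots> = (\<Sum>c\<in>UNIV. a c * wt {c} w * ((\<Sum>j<K. q {c} ^ j) * (1 - q {c})))"
  proof -
    have "(\<Sum>s | (s, c) \<in> G. a c * wt {c} w * (q {c} ^ j * b s)) =
        a c * wt {c} w * (q {c} ^ j * (1 - q {c}))" for j c
      by (simp add: q_def compatible_goods_def sum_distrib_left)
    then show ?thesis
      by (subst sum.swap) (simp add: sum_distrib_left sum_distrib_right)
  qed
  also have "\<dots> = (\<Sum>c\<in>UNIV. a c * wt {c} w * (1 - q {c} ^ K))"
  proof -
    have "(\<Sum>j<K. q {c} ^ j) * (1 - q {c}) = 1 - q {c} ^ K" for c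
      using one_diff_power_eq[of "q {c}" K] by (simp add: mult.commute)
    then show ?thesis by simp
  qed
  also have "(q (types w) - sum a UNIV) * wt {} w + (\<Sum>c\<in>UNIV. a c * (wt {} w - wt {c} w)) + \<dots> =
      q (types w) * wt {} w - (\<Sum>c\<in>UNIV. a c * wt {c} w * q {c} ^ K)"
    by (simp add: algebra_simps sum_subtractf) (simp add: sum_distrib_right)
  finally show ?thesis .
qed

lemma sum_preds_LIMSEQ:
  "(\<lambda>K. \<Sum>(w0, y)\<in>preds w K. wt {} w0 * pr y) \<longlonglongrightarrow> q (types w) * wt {} w"
proof -
  have "(\<lambda>K. q {c} ^ K) \<longlonglongrightarrow> 0" for c
    using q_nonneg[of "{c}"] q_less_1[of "{c}"] by (intro LIMSEQ_realpow_zero) auto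
  then have "(\<lambda>K. q (types w) * wt {} w - (\<Sum>c\<in>UNIV. a c * wt {c} w * q {c} ^ K)) \<longlonglongrightarrow>
      q (types w) * wt {} w - (\<Sum>c\<in>UNIV. a c * wt {c} w * 0)"
    by (intro tendsto_diff tendsto_const tendsto_sum tendsto_mult)
  then show ?thesis by (simp add: sum_preds)
qed

end

section \<open>Summation over words with given first appearances\<close>

text \<open>Carrying absolute convergence along with the value serves two ends: it justifies Fubini
  for the block decomposition, and it yields integrability under a pmf together with the
  expectation.\<close>

definition abs_sums :: "('i \<Rightarrow> 'k::banach) \<Rightarrow> 'i set \<Rightarrow> 'k \<Rightarrow> bool" where
  "abs_sums f A S \<longleftrightarrow> (f has_sum S) A \<and> (\<lambda>x. norm (f x)) summable_on A"

lemma abs_sums_cong: "(\<And>x. x \<in> A \<Longrightarrow> f x = g x) \<Longrightarrow> S = T \<Longrightarrow> abs_sums f A S \<longleftrightarrow> abs_sums g A T"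
  unfolding abs_sums_def by (auto cong: has_sum_cong summable_on_cong)

lemma abs_sums_finite: "finite A \<Longrightarrow> S = sum f A \<Longrightarrow> abs_sums f A S"
  by (auto simp: abs_sums_def)

lemma abs_sums_cmult:
  fixes f :: "'i \<Rightarrow> 'k::{banach, real_normed_field}"
  shows "abs_sums f A S \<Longrightarrow> abs_sums (\<lambda>x. k * f x) A (k * S)"
  unfolding abs_sums_def by (auto simp: norm_mult intro: has_sum_cmult_right summable_on_cmult_right)

lemma abs_sums_add:
  assumes f: "abs_sums f A S" and g: "abs_sums g A T"
  shows "abs_sums (\<lambda>x. f x + g x) A (S + T)"
proof -
  have "(\<lambda>x. norm (f x) + norm (g x)) summable_on A"
    using f g by (simp add: abs_sums_def summable_on_add)
  then have "(\<lambda>x. norm (f x + g x)) summable_on A"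
    by (rule Infinite_Sum.abs_summable_on_comparison_test') (rule norm_triangle_ineq)
  then show ?thesis using f g by (simp add: abs_sums_def has_sum_add)
qed

lemma abs_sums_reindex: "inj_on h A \<Longrightarrow> abs_sums f (h ` A) S \<longleftrightarrow> abs_sums (\<lambda>x. f (h x)) A S"
  unfolding abs_sums_def
  by (simp add: has_sum_reindex summable_on_reindex o_def)

lemma abs_sums_Sigma:
  fixes f :: "'i \<times> 'j \<Rightarrow> 'k::{banach}"
  assumes "\<And>x. x \<in> A \<Longrightarrow> abs_sums (\<lambda>y. f (x, y)) (B x) (g x)"
    and "\<And>x. x \<in> A \<Longrightarrow> ((\<lambda>y. norm (f (x, y))) has_sum h x) (B x)"
    and "h summable_on A" and "(g has_sum S) A"
  shows "abs_sums f (Sigma A B) S"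
proof -
  have "(\<lambda>z. norm (f z)) summable_on Sigma A B"
    by (rule summable_on_SigmaI[where g = h]) (use assms in auto)
  moreover from this have "f summable_on Sigma A B"
    by (rule abs_summable_summable)
  ultimately show ?thesis
    using assms(1,4) unfolding abs_sums_def by (auto intro!: has_sum_SigmaI[where g = g])
qed

lemma abs_sums_product:
  fixes f :: "'i \<Rightarrow> 'k::{banach, real_normed_field}"
  assumes f: "abs_sums f A S" and g: "abs_sums g B T"
  shows "abs_sums (\<lambda>(x, y). f x * g y) (A \<times> B) (S * T)"
proof (rule abs_sums_Sigma[where g = "\<lambda>x. f x * T" and h = "\<lambda>x. norm (f x) * infsum (\<lambda>y. norm (g y)) B"])
  show "abs_sums (\<lambda>y. case (x, y) of (x, y) \<Rightarrow> f x * g y) B (f x * T)" for x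
    using abs_sums_cmult[OF g] by simp
  show "((\<lambda>y. norm (case (x, y) of (x, y) \<Rightarrow> f x * g y)) has_sum
     norm (f x) * (\<Sum>\<^sub>\<infinity>y\<in>B. norm (g y))) B" for x
    using g by (auto simp: norm_mult abs_sums_def intro!: has_sum_cmult_right)
  show "(\<lambda>x. norm (f x) * (\<Sum>\<^sub>\<infinity>y\<in>B. norm (g y))) summable_on A"
    using f by (auto simp: abs_sums_def intro!: summable_on_cmult_left)
  show "((\<lambda>x. f x * T) has_sum S * T) A"
    using f by (auto simp: abs_sums_def intro!: has_sum_cmult_left)
qed

lemma abs_sums_UN:
  assumes "finite I" "\<And>i. i \<in> I \<Longrightarrow> abs_sums f (A i) (S i)"
    and "disjoint_family_on A I"
  shows "abs_sums f (\<Union>i\<in>I. A i) (\<Sum>i\<in>I. S i)"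
  using assms
proof (induction I rule: finite_induct)
  case empty then show ?case by (auto simp: abs_sums_def)
next
  case (insert i I)
  have "disjoint_family_on A I" using insert.prems(2) by (auto simp: disjoint_family_on_def)
  then have IH: "abs_sums f (\<Union>i\<in>I. A i) (\<Sum>i\<in>I. S i)" using insert by auto
  moreover have disj: "A i \<inter> (\<Union>i\<in>I. A i) = {}"
    using insert.prems(2) insert.hyps(2) by (auto simp: disjoint_family_on_def)
  moreover have "abs_sums f (A i) (S i)" using insert.prems by auto
  ultimately have "abs_sums f (A i \<union> (\<Union>i\<in>I. A i)) (S i + (\<Sum>i\<in>I. S i))"
    by (auto simp: abs_sums_def intro!: has_sum_Un_disjoint summable_on_Un_disjoint)
  then show ?case using insert.hyps by simp
qed

lemma abs_sums_nat: "f sums S \<Longrightarrow> summable (\<lambda>n. norm (f n)) \<Longrightarrow> abs_sums f UNIV S"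
  unfolding abs_sums_def by (auto intro: norm_summable_imp_has_sum norm_summable_imp_summable_on)

lemma abs_sums_geometric:
  fixes z :: "'k::{banach, real_normed_field}"
  shows "norm z < 1 \<Longrightarrow> abs_sums (\<lambda>n. z ^ n) UNIV (1 / (1 - z))"
  by (auto intro!: abs_sums_nat geometric_sums simp: norm_power summable_geometric)

lemma abs_sums_geometric_deriv:
  assumes "0 \<le> x" "x < (1 :: real)"
  shows "abs_sums (\<lambda>n. x ^ n * real (1 + n)) UNIV (1 / (1 - x)\<^sup>2)"
proof -
  have "(\<lambda>n. x ^ n * real (1 + n)) sums (1 / (1 - x)\<^sup>2)"
    using geometric_deriv_sums[of x] assms by (simp add: mult.commute)
  then show ?thesis
    using assms by (intro abs_sums_nat) (auto simp: sums_iff)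
qed

text \<open>The Cauchy product of the differentiated geometric series with the geometric series has
  coefficients \<open>(k + 1) * (k + 2) / 2\<close>, and \<open>(k + 1) * (k + 2) - (k + 1)\<close>
  is the square of \<open>k + 1\<close>.\<close>

lemma abs_sums_geometric_deriv2:
  assumes "0 \<le> x" "x < (1 :: real)"
  shows "abs_sums (\<lambda>n. x ^ n * (real (1 + n))\<^sup>2) UNIV (2 / (1 - x) ^ 3 - 1 / (1 - x)\<^sup>2)"
proof -
  let ?f = "\<lambda>n. x ^ n * real (1 + n)"
  have s1: "?f sums (1 / (1 - x)\<^sup>2)"
    using geometric_deriv_sums[of x] assms by (simp add: mult.commute)
  have s0: "(\<lambda>n. x ^ n) sums (1 / (1 - x))" using assms by (intro geometric_sums) auto
  have "(\<lambda>k. \<Sum>i\<le>k. ?f i * x ^ (k - i)) sums ((\<Sum>k. ?f k) * (\<Sum>k. x ^ k))"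
    by (rule Cauchy_product_sums) (use s1 s0 assms in \<open>auto simp: sums_iff\<close>)
  also have "(\<lambda>k. \<Sum>i\<le>k. ?f i * x ^ (k - i)) = (\<lambda>k. x ^ k * (real (1 + k) * real (2 + k) / 2))"
  proof
    fix k
    have "(\<Sum>i\<le>k. ?f i * x ^ (k - i)) = (\<Sum>i\<le>k. x ^ k * real (1 + i))"
      by (intro sum.cong refl) (simp add: power_add[symmetric] mult_ac)
    also have "\<dots> = x ^ k * (\<Sum>i\<le>k. real (1 + i))" by (rule sum_distrib_left[symmetric])
    also have "(\<Sum>i\<le>k. real (1 + i)) = real (1 + k) * real (2 + k) / 2"
      by (induction k) (auto simp: field_simps)
    finally show "(\<Sum>i\<le>k. ?f i * x ^ (k - i)) = x ^ k * (real (1 + k) * real (2 + k) / 2)" .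
  qed
  finally have "(\<lambda>k. x ^ k * (real (1 + k) * real (2 + k) / 2)) sums (1 / (1 - x)\<^sup>2 * (1 / (1 - x)))"
    using s1 s0 by (simp add: sums_iff)
  from sums_diff[OF sums_mult[OF this, of 2] s1]
  have "(\<lambda>n. x ^ n * (real (1 + n))\<^sup>2) sums (2 * (1 / (1 - x)\<^sup>2 * (1 / (1 - x))) - 1 / (1 - x)\<^sup>2)"
    by (rule sums_cong[THEN iffD1, rotated]) (simp add: field_simps power2_eq_square)
  then have "(\<lambda>n. x ^ n * (real (1 + n))\<^sup>2) sums (2 / (1 - x) ^ 3 - 1 / (1 - x)\<^sup>2)"
    by (simp add: power2_eq_square power3_eq_cube)
  then show ?thesis using assms by (intro abs_sums_nat) (auto simp: sums_iff)
qed

section \<open>Words with prescribed first appearances\<close>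

fun agents :: "'c word \<Rightarrow> 'c list" where
  "agents [] = []"
| "agents (None # w) = agents w"
| "agents (Some c # w) = c # agents w"

lemma agents_append [simp]: "agents (v @ w) = agents v @ agents w"
  by (induction v rule: agents.induct) auto

lemma set_agents [simp]: "set (agents w) = types w"
  by (induction w rule: agents.induct) auto

lemma set_first_appearances [simp]: "set (first_appearances xs) = set xs"
  by (simp add: first_appearances_def)

lemma distinct_first_appearances [simp]: "distinct (first_appearances xs)"
  by (simp add: first_appearances_def)

lemma first_appearances_snoc: "first_appearances (xs @ [x]) =
   (if x \<in> set xs then first_appearances xs else first_appearances xs @ [x])"
  by (simp add: first_appearances_def)

lemma first_appearances_append: "first_appearances (xs @ ys) =
    first_appearances xs @ first_appearances (filter (\<lambda>y. y \<notin> set xs) ys)"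
proof (induction ys rule: rev_induct)
  case (snoc y ys)
  then show ?case
    unfolding append_assoc[symmetric] first_appearances_snoc
    by (auto simp: first_appearances_snoc)
qed (simp add: first_appearances_def)

lemma first_appearances_eq_Nil [simp]: "first_appearances xs = [] \<longleftrightarrow> xs = []"
  by (simp add: first_appearances_def)

definition words_of :: "'c list \<Rightarrow> 'c word set" where
  "words_of Cs = {w. trim w = w \<and> first_appearances (agents w) = Cs}"

lemma types_words_of: "w \<in> words_of Cs \<Longrightarrow> types w = set Cs"
  unfolding words_of_def by (metis (mono_tags, lifting) mem_Collect_eq set_agents set_first_appearances)

lemma words_of_Nil: "words_of [] = {[]}"
proof -
  have "w = []" if "trim w = w" "agents w = []" for w :: "'c word"
    using that by (auto simp: trim_eq_self)
  then show ?thesis by (auto simp: words_of_def trim_def first_appearances_def)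
qed

lemma trim_append_Some: "trim (v @ Some c # w) = v @ Some c # w \<longleftrightarrow> trim v = v"
  by (cases v) (auto simp: trim_eq_self)

text \<open>The word is cut at the first agent of the last new type \<open>C\<close>. In front of it
  stands a word for \<open>Cs\<close>; behind it any letter may stand that brings no new type.
  Iterating the cut yields the blocks.\<close>

lemma words_of_snoc:
  assumes "C \<notin> set Cs"
  shows "words_of (Cs @ [C]) =
    (\<lambda>(w, v). w @ Some C # v) ` (words_of Cs \<times> {v. types v \<subseteq> insert C (set Cs)})"
    (is "?A = ?B")
proof
  have fa: "first_appearances (agents (w @ Some C # v)) = first_appearances (agents w) @ C #
     first_appearances (filter (\<lambda>y. y \<noteq> C \<and> y \<notin> types w) (agents v))" if "C \<notin> types w" for w v
  proof -
    have "agents (w @ Some C # v) = (agents w @ [C]) @ agents v" by simp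
    then show ?thesis
      using that by (simp only: first_appearances_append)
        (simp add: first_appearances_def filter_empty_conv)
  qed
  show "?A \<subseteq> ?B"
  proof
    fix x assume x: "x \<in> ?A"
    then have "Some C \<in> set x" using types_words_of[OF x] by (auto simp: types_def)
    then obtain w v where wv: "x = w @ Some C # v" "Some C \<notin> set w"
      by (meson split_list_first)
    have nC: "C \<notin> types w" using wv by (auto simp: types_def)
    have eq: "first_appearances (agents w) @ C #
       first_appearances (filter (\<lambda>y. y \<noteq> C \<and> y \<notin> types w) (agents v)) = Cs @ [C]"
      using x fa[OF nC, of v] wv by (simp add: words_of_def)
    \<comment> \<open>\<open>C\<close> occurs neither in \<open>Cs\<close> nor in the front part, so
      both sides split at the same place.\<close>
    then have w: "first_appearances (agents w) = Cs"
      using assms nC by (auto simp: append_eq_append_conv2 Cons_eq_append_conv append_eq_Cons_conv)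
    with eq have "filter (\<lambda>y. y \<noteq> C \<and> y \<notin> types w) (agents v) = []" by simp
    moreover have "types w = set Cs" using w by (metis set_agents set_first_appearances)
    ultimately have "types v \<subseteq> insert C (set Cs)"
      by (auto simp: filter_empty_conv)
    moreover have "trim w = w" using x wv by (simp add: words_of_def trim_append_Some)
    ultimately show "x \<in> ?B" using w wv by (force simp: words_of_def)
  qed
  show "?B \<subseteq> ?A"
  proof
    fix x assume "x \<in> ?B"
    then obtain w v where wv: "x = w @ Some C # v" "w \<in> words_of Cs" "types v \<subseteq> insert C (set Cs)"
      by auto
    have t: "types w = set Cs" using wv(2) by (rule types_words_of)
    then have "filter (\<lambda>y. y \<noteq> C \<and> y \<notin> types w) (agents v) = []"
      using wv(3) by (auto simp: filter_empty_conv)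
    then show "x \<in> ?A" using fa[of w v] wv(1,2) t assms
      by (simp add: words_of_def trim_append_Some)
  qed
qed

lemma inj_on_words_of_snoc:
  assumes "C \<notin> set Cs"
  shows "inj_on (\<lambda>(w, v). w @ Some C # v) (words_of Cs \<times> {v. types v \<subseteq> insert C (set Cs)})"
proof (rule inj_onI, clarify)
  fix w v w' v'
  assume "w \<in> words_of Cs" "w' \<in> words_of Cs" and eq: "w @ Some C # v = w' @ Some C # v'"
  then have "Some C \<notin> set w" "Some C \<notin> set w'"
    using assms types_words_of by (fastforce simp: types_def)+
  with eq show "w = w' \<and> v = v'"
    by (auto simp: append_eq_append_conv2 append_eq_Cons_conv Cons_eq_append_conv)
qed

text \<open>The delay if the oldest waiting agent of type \<open>c\<close> is matched with the next item.\<close>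

definition wait :: "'c \<Rightarrow> 'c word \<Rightarrow> nat" where
  "wait c w = length (dropWhile (\<lambda>o'. o' \<noteq> Some c) w)"

lemma wait_eq_0: "c \<notin> types w \<Longrightarrow> wait c w = 0"
  by (auto simp: wait_def types_def)

text \<open>A new block behind an agent of type \<open>c\<close> adds its length
  \<open>1 + length v\<close>. If \<open>c\<close> first occurs as the letter \<open>C\<close>
  itself, the front contributes the default value 0, so the formula is the same.\<close>

lemma wait_append_Some:
  assumes "c \<in> insert C (types w)"
  shows "wait c (w @ Some C # v) = wait c w + (1 + length v)"
proof (cases "c \<in> types w")
  case True
  then show ?thesis by (auto simp: wait_def types_def dropWhile_append1)
next
  case False
  then have "\<And>o'. o' \<in> set w \<Longrightarrow> o' \<noteq> Some c" by (auto simp: types_def)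
  then show ?thesis using assms False
    by (auto simp: wait_def dropWhile_append2 types_def)
qed

lemma wait_words_of_absent: "w \<in> words_of Cs \<Longrightarrow> c \<notin> set Cs \<Longrightarrow> wait c w = 0"
  using types_words_of[of w Cs] by (simp add: wait_eq_0)

lemma wait_words_of_snoc: "w \<in> words_of Cs \<Longrightarrow> c \<in> insert C (set Cs) \<Longrightarrow>
    wait c (w @ Some C # v) = wait c w + (1 + length v)"
  using types_words_of[of w Cs] by (intro wait_append_Some) simp

section \<open>Geometric block lengths and sums over one class of words\<close>

context fcfs_weights
begin

text \<open>No letter enlarges the set \<open>D\<close>, so each of them contributes the factor
  \<open>q D + sum a D\<close> independently of the others.\<close>

lemma sum_wt_length: "(\<Sum>v | length v = n \<and> types v \<subseteq> D. wt D v) = (1 - p D) ^ n"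
proof (induction n)
  case 0
  have "{v :: 'c word. length v = 0 \<and> types v \<subseteq> D} = {[]}" by auto
  then show ?case by (simp only:) simp
next
  case (Suc n)
  let ?S = "{v :: 'c word. length v = n \<and> types v \<subseteq> D}"
  have eq: "{v :: 'c word. length v = Suc n \<and> types v \<subseteq> D} = (\<lambda>(o', v). o' # v) ` (insert None (Some ` D) \<times> ?S)"
    (is "?A = ?B")
  proof
    show "?A \<subseteq> ?B"
    proof
      fix x assume x: "x \<in> ?A"
      then obtain o' v where ov: "x = o' # v" by (cases x) auto
      then show "x \<in> ?B" using x by (cases o') auto
    qed
  qed auto
  have "(\<Sum>v | length v = Suc n \<and> types v \<subseteq> D. wt D v) =
     (\<Sum>(o', v)\<in>insert None (Some ` D) \<times> ?S. wt D (o' # v))"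
    unfolding eq by (subst sum.reindex) (auto simp: inj_on_def case_prod_unfold)
  also have "\<dots> = (\<Sum>o'\<in>insert None (Some ` D). \<Sum>v\<in>?S. wt D (o' # v))"
    by (rule sum.cartesian_product[symmetric])
  also have "\<dots> = (q D + (\<Sum>c\<in>D. a c)) * (1 - p D) ^ n"
    using Suc by (simp add: sum.reindex insert_absorb distrib_right flip: sum_distrib_left sum_distrib_right)
  finally show ?case using p_q[of D] by simp
qed

lemma abs_sums_block:
  fixes g :: "nat \<Rightarrow> 'k::{banach, real_normed_field}"
  assumes "abs_sums (\<lambda>n. of_real ((1 - p D) ^ n) * g n) UNIV S"
  shows "abs_sums (\<lambda>v. of_real (wt D v) * g (length v)) {v. types v \<subseteq> D} S"
proof -
  let ?B = "\<lambda>n. {v :: 'c word. length v = n \<and> types v \<subseteq> D}"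
  have "abs_sums (\<lambda>(n, v). of_real (wt D v) * g (length v)) (Sigma UNIV ?B) S"
  proof (rule abs_sums_Sigma[where g = "\<lambda>n. of_real ((1 - p D) ^ n) * g n"
      and h = "\<lambda>n. norm (of_real ((1 - p D) ^ n) * g n)"])
    fix n
    have "(\<Sum>v\<in>?B n. of_real (wt D v) * g (length v)) = (\<Sum>v\<in>?B n. of_real (wt D v)) * g n"
      by (simp add: sum_distrib_right)
    also have "\<dots> = of_real ((1 - p D) ^ n) * g n"
      by (simp flip: of_real_sum add: sum_wt_length)
    finally show "abs_sums (\<lambda>v. case (n, v) of (n, v) \<Rightarrow> of_real (wt D v) * g (length v)) (?B n)
        (of_real ((1 - p D) ^ n) * g n)"
      by (intro abs_sums_finite) auto
    have "(\<Sum>v\<in>?B n. norm (of_real (wt D v) * g (length v))) = (\<Sum>v\<in>?B n. wt D v) * norm (g n)"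
      by (simp add: sum_distrib_right norm_mult wt_nonneg)
    also have "\<dots> = norm (of_real ((1 - p D) ^ n) * g n)"
      using p_le_1[of D] by (simp add: sum_wt_length norm_mult norm_power del: of_real_power of_real_diff)
    finally show "((\<lambda>v. norm (case (n, v) of (n, v) \<Rightarrow> of_real (wt D v) * g (length v)))
        has_sum norm (of_real ((1 - p D) ^ n) * g n)) (?B n)"
      by (intro has_sum_finiteI) auto
  next
    show "(\<lambda>n. norm (of_real ((1 - p D) ^ n) * g n)) summable_on UNIV"
      using assms by (simp add: abs_sums_def)
    show "((\<lambda>n. of_real ((1 - p D) ^ n) * g n) has_sum S) UNIV"
      using assms by (simp add: abs_sums_def)
  qed
  then have "abs_sums (\<lambda>v. of_real (wt D v) * g (length v)) (snd ` Sigma UNIV ?B) S"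
    by (subst abs_sums_reindex) (auto simp: inj_on_def case_prod_unfold)
  also have "snd ` Sigma UNIV ?B = {v. types v \<subseteq> D}" by force
  finally show ?thesis .
qed

text \<open>This is the product in the explicit formula for \<open>pi_Y\<close> without the constant
  \<open>B\<close>; the total rate cancels in each factor.\<close>

definition W :: "'c list \<Rightarrow> real" where
  "W Cs = (\<Prod>h<length Cs. a (Cs ! h) / p (set (take (Suc h) Cs)))"

lemma W_snoc: "W (Cs @ [C]) = W Cs * (a C / p (insert C (set Cs)))"
proof -
  have "(\<Prod>h<length Cs. a ((Cs @ [C]) ! h) / p (set (take (Suc h) (Cs @ [C])))) = W Cs"
    unfolding W_def by (rule prod.cong) (auto simp: nth_append)
  then show ?thesis by (simp add: W_def)
qed

lemma wt_snoc_block: "w \<in> words_of Cs \<Longrightarrow>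
   wt {} (w @ Some C # v) = wt {} w * (a C * wt (insert C (set Cs)) v)"
  using types_words_of[of w Cs] by (simp add: wt_append)

lemma abs_sums_words_of_snoc:
  assumes "C \<notin> set Cs"
    and "abs_sums (\<lambda>(w, v). f (w @ Some C # v)) (words_of Cs \<times> {v. types v \<subseteq> insert C (set Cs)}) S"
  shows "abs_sums f (words_of (Cs @ [C])) S"
  unfolding words_of_snoc[OF assms(1)] abs_sums_reindex[OF inj_on_words_of_snoc[OF assms(1)]]
  using assms(2) by (simp add: case_prod_unfold)

text \<open>The first factor ranges over the part of the word before \<open>C\<close>, the second one over the part
  behind it, whose length is geometrically distributed.\<close>

lemma abs_sums_words_of_product:
  fixes f :: "'c word \<Rightarrow> 'k::{banach, real_normed_field}"
  assumes "C \<notin> set Cs"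
    and "abs_sums (\<lambda>w. of_real (wt {} w) * f w) (words_of Cs) S"
    and "abs_sums (\<lambda>n. of_real ((1 - p (insert C (set Cs))) ^ n) * g n) UNIV T"
  shows "abs_sums (\<lambda>(w, v). of_real (wt {} (w @ Some C # v)) * (f w * g (length v)))
    (words_of Cs \<times> {v. types v \<subseteq> insert C (set Cs)}) (of_real (a C) * (S * T))"
proof -
  have "abs_sums (\<lambda>x. of_real (a C) * ((\<lambda>(w, v). (of_real (wt {} w) * f w) *
      (of_real (wt (insert C (set Cs)) v) * g (length v))) x))
     (words_of Cs \<times> {v. types v \<subseteq> insert C (set Cs)}) (of_real (a C) * (S * T))"
    by (intro abs_sums_cmult abs_sums_product assms(2) abs_sums_block assms(3))
  then show ?thesis
    by (rule abs_sums_cong[THEN iffD1, rotated -1]) (auto simp: wt_snoc_block mult_ac)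
qed

lemma abs_sums_W:
  assumes "distinct Cs"
  shows "abs_sums (wt {}) (words_of Cs) (W Cs)"
  using assms
proof (induction Cs rule: rev_induct)
  case Nil
  show ?case by (simp add: words_of_Nil abs_sums_finite W_def)
next
  case (snoc C Cs)
  let ?p = "p (insert C (set Cs))"
  have p: "0 < ?p" "?p \<le> 1" using p_pos p_le_1 by auto
  have C: "C \<notin> set Cs" using snoc by simp
  have "abs_sums (\<lambda>n. (1 - ?p) ^ n) UNIV (1 / (1 - (1 - ?p)))"
    using p by (intro abs_sums_geometric) auto
  then have "abs_sums (\<lambda>(w, v). wt {} (w @ Some C # v))
      (words_of Cs \<times> {v. types v \<subseteq> insert C (set Cs)}) (a C * (W Cs * (1 / ?p)))"
    using abs_sums_words_of_product[OF C, of "\<lambda>_. 1 :: real" "W Cs" "\<lambda>_. 1" "1 / ?p"] snoc by simp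
  from abs_sums_words_of_snoc[OF C this] show ?case
    by (simp add: W_snoc mult_ac)
qed

text \<open>One-based, like \<open>l\<close> in the theorem. An absent type gets the index it would
  have if it were appended next, so the range \<open>idx c Cs..length Cs\<close> is then empty and
  \<open>idx\<close> is unchanged when that type is appended.\<close>

definition idx :: "'c \<Rightarrow> 'c list \<Rightarrow> nat" where
  "idx c Cs = Suc (length (takeWhile (\<lambda>x. x \<noteq> c) Cs))"

lemma idx_absent: "c \<notin> set Cs \<Longrightarrow> idx c Cs = Suc (length Cs)"
  unfolding idx_def by (subst takeWhile_eq_all_conv[THEN iffD2]) auto

lemma idx_snoc: "c \<in> insert C (set Cs) \<Longrightarrow> idx c (Cs @ [C]) = idx c Cs"
  using idx_absent[of c Cs] by (cases "c \<in> set Cs") (auto simp: idx_def takeWhile_append)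

lemma idx_le: "idx c Cs \<le> Suc (length Cs)"
  by (simp add: idx_def length_takeWhile_le)

abbreviation pp :: "'c list \<Rightarrow> nat \<Rightarrow> real" where
  "pp Cs h \<equiv> p (set (take h Cs))"

lemma abs_sums_words_of_absent:
  fixes f :: "nat \<Rightarrow> 'k::{banach, real_normed_field}"
  assumes "distinct Cs" "c \<notin> set Cs"
  shows "abs_sums (\<lambda>w. of_real (wt {} w) * f (wait c w)) (words_of Cs) (of_real (W Cs) * f 0)"
proof -
  have "abs_sums (wt {}) (words_of Cs) (W Cs)" using assms by (intro abs_sums_W) simp
  then have "abs_sums (\<lambda>w. of_real (wt {} w) :: 'k) (words_of Cs) (of_real (W Cs))"
    by (simp add: abs_sums_def has_sum_of_real)
  from abs_sums_cmult[OF this, of "f 0"]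
  show ?thesis
    by (rule abs_sums_cong[THEN iffD1, rotated -1])
      (use assms(2) in \<open>auto simp: wait_words_of_absent\<close>)
qed

text \<open>Under the weights the blocks are independent. From the block opened by \<open>c\<close>
  on, each block multiplies the sum by the generating function of a geometric law on the positive
  integers: one letter opens the block, and \<open>length v\<close> letters follow.\<close>

lemma abs_sums_gf:
  fixes Z :: complex
  assumes "distinct Cs" and Z: "norm Z \<le> 1"
  shows "abs_sums (\<lambda>w. of_real (wt {} w) * Z ^ wait c w) (words_of Cs)
     (of_real (W Cs) * (\<Prod>h = idx c Cs..length Cs. Z * of_real (pp Cs h) / (1 - Z * (1 - of_real (pp Cs h)))))"
  using assms(1)
proof (induction Cs rule: rev_induct)
  case Nil
  show ?case using abs_sums_words_of_absent[of "[]" c "\<lambda>n. Z ^ n"] by (simp add: idx_absent)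
next
  case (snoc C Cs)
  have C: "C \<notin> set Cs" using snoc by simp
  let ?p = "p (insert C (set Cs))"
  have p: "0 < ?p" "?p \<le> 1" using p_pos p_le_1 by auto
  show ?case
  proof (cases "c \<in> insert C (set Cs)")
    case False
    then show ?thesis
      using abs_sums_words_of_absent[of "Cs @ [C]" c "\<lambda>n. Z ^ n"] snoc.prems by (simp add: idx_absent)
  next
    case True
    let ?F = "\<lambda>p. Z * of_real p / (1 - Z * (1 - of_real p))"
    \<comment> \<open>The ratio of the series has norm below 1 even on the unit circle, because
      \<open>?p\<close> is positive.\<close>
    have "norm (Z * (1 - of_real ?p)) = norm Z * (1 - ?p)"
      using p by (metis abs_of_nonneg diff_ge_0_iff_ge norm_mult norm_of_real of_real_1 of_real_diff)
    also have "\<dots> \<le> 1 * (1 - ?p)" using Z p by (intro mult_right_mono) auto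
    finally have "norm (Z * (1 - of_real ?p)) < 1" using p by simp
    then have "abs_sums (\<lambda>n. Z * (Z * (1 - of_real ?p)) ^ n) UNIV (Z * (1 / (1 - Z * (1 - of_real ?p))))"
      by (intro abs_sums_cmult abs_sums_geometric)
    then have g: "abs_sums (\<lambda>n. of_real ((1 - ?p) ^ n) * Z ^ (1 + n)) UNIV (Z * (1 / (1 - Z * (1 - of_real ?p))))"
      by (simp add: power_mult_distrib mult_ac)
    have "abs_sums (\<lambda>(w, v). of_real (wt {} (w @ Some C # v)) * (Z ^ wait c w * Z ^ (1 + length v)))
      (words_of Cs \<times> {v. types v \<subseteq> insert C (set Cs)})
      (of_real (a C) * ((of_real (W Cs) * (\<Prod>h = idx c Cs..length Cs. ?F (pp Cs h))) *
        (Z * (1 / (1 - Z * (1 - of_real ?p))))))"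
      using snoc C by (intro abs_sums_words_of_product g) auto
    \<comment> \<open>The factor \<open>?p\<close> in the numerator of \<open>?F ?p\<close>
      compensates the division by \<open>?p\<close> in \<open>W\<close>.\<close>
    then have "abs_sums (\<lambda>(w, v). of_real (wt {} (w @ Some C # v)) * Z ^ wait c (w @ Some C # v))
      (words_of Cs \<times> {v. types v \<subseteq> insert C (set Cs)})
      (of_real (W (Cs @ [C])) * ((\<Prod>h = idx c Cs..length Cs. ?F (pp Cs h)) * ?F ?p))"
      by (rule abs_sums_cong[THEN iffD1, rotated -1])
        (use True p in \<open>auto simp: wait_words_of_snoc power_add W_snoc\<close>)
    moreover have "(\<Prod>h = idx c (Cs @ [C])..length (Cs @ [C]). ?F (pp (Cs @ [C]) h)) =
        (\<Prod>h = idx c Cs..length Cs. ?F (pp Cs h)) * ?F ?p"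
      using idx_le[of c Cs] by (simp add: idx_snoc[OF True] cong: prod.cong_simp)
    ultimately show ?thesis using abs_sums_words_of_snoc[OF C] by simp
  qed
qed

lemma abs_sums_mean:
  assumes "distinct Cs"
  shows "abs_sums (\<lambda>w. wt {} w * real (wait c w)) (words_of Cs)
     (W Cs * (\<Sum>h = idx c Cs..length Cs. 1 / pp Cs h))"
  using assms
proof (induction Cs rule: rev_induct)
  case Nil
  show ?case using abs_sums_words_of_absent[of "[]" c "real"] by (simp add: idx_absent)
next
  case (snoc C Cs)
  have C: "C \<notin> set Cs" using snoc by simp
  let ?p = "p (insert C (set Cs))"
  have p: "0 < ?p" "?p \<le> 1" using p_pos p_le_1 by auto
  show ?case
  proof (cases "c \<in> insert C (set Cs)")
    case False
    then show ?thesis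
      using abs_sums_words_of_absent[of "Cs @ [C]" c real] snoc.prems by (simp add: idx_absent)
  next
    case True
    let ?m = "\<Sum>h = idx c Cs..length Cs. 1 / pp Cs h"
    have g0: "abs_sums (\<lambda>n. (1 - ?p) ^ n) UNIV (1 / ?p)"
      using abs_sums_geometric[of "1 - ?p"] p by simp
    have g1: "abs_sums (\<lambda>n. (1 - ?p) ^ n * real (1 + n)) UNIV (1 / ?p\<^sup>2)"
      using abs_sums_geometric_deriv[of "1 - ?p"] p by simp
    \<comment> \<open>The delay splits into the part in front, with mass \<open>1 / ?p\<close> for
      the last block, and the last block, with \<open>W Cs\<close> for the front.\<close>
    have "abs_sums (\<lambda>x. (case x of (w, v) \<Rightarrow> wt {} (w @ Some C # v) * (real (wait c w) * 1)) +
        (case x of (w, v) \<Rightarrow> wt {} (w @ Some C # v) * (1 * real (1 + length v))))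
      (words_of Cs \<times> {v. types v \<subseteq> insert C (set Cs)})
      (a C * ((W Cs * ?m) * (1 / ?p)) + a C * (W Cs * (1 / ?p\<^sup>2)))"
      using abs_sums_words_of_product[OF C, of "\<lambda>w. real (wait c w)" _ "\<lambda>_. 1" "1 / ?p"]
        abs_sums_words_of_product[OF C, of "\<lambda>w. 1" _ "\<lambda>n. real (1 + n)" "1 / ?p\<^sup>2"]
        abs_sums_W[of Cs] snoc g0 g1
      by (intro abs_sums_add) auto
    then have "abs_sums (\<lambda>(w, v). wt {} (w @ Some C # v) * real (wait c (w @ Some C # v)))
      (words_of Cs \<times> {v. types v \<subseteq> insert C (set Cs)})
      (W (Cs @ [C]) * (?m + 1 / ?p))"
      by (rule abs_sums_cong[THEN iffD1, rotated -1])
        (use True p in \<open>auto simp: wait_words_of_snoc W_snoc field_simps power2_eq_square\<close>)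
    moreover have "(\<Sum>h = idx c (Cs @ [C])..length (Cs @ [C]). 1 / pp (Cs @ [C]) h) = ?m + 1 / ?p"
      using idx_le[of c Cs] by (simp add: idx_snoc[OF True] cong: sum.cong_simp)
    ultimately show ?thesis using abs_sums_words_of_snoc[OF C] by simp
  qed
qed

text \<open>For a fixed order of types the delay is a sum of independent geometric variables, so its
  second moment is the sum of their variances \<open>(1 - p) / p^2\<close> plus the square of the
  mean. The induction expands the square over the last block, whose cross term needs the mean from
  \<open>abs_sums_mean\<close>.\<close>

lemma abs_sums_second_moment:
  assumes "distinct Cs"
  shows "abs_sums (\<lambda>w. wt {} w * (real (wait c w))\<^sup>2) (words_of Cs)
     (W Cs * ((\<Sum>h = idx c Cs..length Cs. (1 - pp Cs h) / (pp Cs h)\<^sup>2) +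
       (\<Sum>h = idx c Cs..length Cs. 1 / pp Cs h)\<^sup>2))"
  using assms
proof (induction Cs rule: rev_induct)
  case Nil
  show ?case using abs_sums_words_of_absent[of "[]" c "\<lambda>n. (real n)\<^sup>2"] by (simp add: idx_absent)
next
  case (snoc C Cs)
  have C: "C \<notin> set Cs" using snoc by simp
  let ?p = "p (insert C (set Cs))"
  have p: "0 < ?p" "?p \<le> 1" using p_pos p_le_1 by auto
  show ?case
  proof (cases "c \<in> insert C (set Cs)")
    case False
    then show ?thesis
      using abs_sums_words_of_absent[of "Cs @ [C]" c "\<lambda>n. (real n)\<^sup>2"] snoc.prems by (simp add: idx_absent)
  next
    case True
    let ?m = "\<Sum>h = idx c Cs..length Cs. 1 / pp Cs h"
    let ?s = "\<Sum>h = idx c Cs..length Cs. (1 - pp Cs h) / (pp Cs h)\<^sup>2"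
    have g0: "abs_sums (\<lambda>n. (1 - ?p) ^ n) UNIV (1 / ?p)"
      using abs_sums_geometric[of "1 - ?p"] p by simp
    have g1: "abs_sums (\<lambda>n. (1 - ?p) ^ n * real (1 + n)) UNIV (1 / ?p\<^sup>2)"
      using abs_sums_geometric_deriv[of "1 - ?p"] p by simp
    have g2: "abs_sums (\<lambda>n. (1 - ?p) ^ n * (real (1 + n))\<^sup>2) UNIV (2 / ?p ^ 3 - 1 / ?p\<^sup>2)"
      using abs_sums_geometric_deriv2[of "1 - ?p"] p by simp
    have m: "abs_sums (\<lambda>w. wt {} w * real (wait c w)) (words_of Cs) (W Cs * ?m)"
      using snoc by (intro abs_sums_mean) simp
    have "abs_sums (\<lambda>x. (case x of (w, v) \<Rightarrow> wt {} (w @ Some C # v) * ((real (wait c w))\<^sup>2 * 1)) +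
        (2 * (case x of (w, v) \<Rightarrow> wt {} (w @ Some C # v) * (real (wait c w) * real (1 + length v))) +
        (case x of (w, v) \<Rightarrow> wt {} (w @ Some C # v) * (1 * (real (1 + length v))\<^sup>2))))
      (words_of Cs \<times> {v. types v \<subseteq> insert C (set Cs)})
      (a C * ((W Cs * (?s + ?m\<^sup>2)) * (1 / ?p)) + (2 * (a C * ((W Cs * ?m) * (1 / ?p\<^sup>2))) +
         a C * (W Cs * (2 / ?p ^ 3 - 1 / ?p\<^sup>2))))"
      using abs_sums_words_of_product[OF C, of "\<lambda>w. (real (wait c w))\<^sup>2" _ "\<lambda>_. 1" "1 / ?p"]
        abs_sums_words_of_product[OF C, of "\<lambda>w. real (wait c w)" _ "\<lambda>n. real (1 + n)" "1 / ?p\<^sup>2"]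
        abs_sums_words_of_product[OF C, of "\<lambda>w. 1" _ "\<lambda>n. (real (1 + n))\<^sup>2" "2 / ?p ^ 3 - 1 / ?p\<^sup>2"]
        abs_sums_W[of Cs] snoc g0 g1 g2 m
      by (intro abs_sums_add abs_sums_cmult) auto
    then have "abs_sums (\<lambda>(w, v). wt {} (w @ Some C # v) * (real (wait c (w @ Some C # v)))\<^sup>2)
      (words_of Cs \<times> {v. types v \<subseteq> insert C (set Cs)})
      (W (Cs @ [C]) * ((?s + (1 - ?p) / ?p\<^sup>2) + (?m + 1 / ?p)\<^sup>2))"
      by (rule abs_sums_cong[THEN iffD1, rotated -1])
        (use True p in \<open>auto simp: wait_words_of_snoc W_snoc field_simps power2_eq_square power3_eq_cube\<close>)
    moreover have "(\<Sum>h = idx c (Cs @ [C])..length (Cs @ [C]). 1 / pp (Cs @ [C]) h) = ?m + 1 / ?p"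
      using idx_le[of c Cs] by (simp add: idx_snoc[OF True] cong: sum.cong_simp)
    moreover have "(\<Sum>h = idx c (Cs @ [C])..length (Cs @ [C]). (1 - pp (Cs @ [C]) h) / (pp (Cs @ [C]) h)\<^sup>2)
        = ?s + (1 - ?p) / ?p\<^sup>2"
      using idx_le[of c Cs] by (simp add: idx_snoc[OF True] cong: sum.cong_simp)
    ultimately show ?thesis using abs_sums_words_of_snoc[OF C] by simp
  qed
qed

end

section \<open>The stationary distribution\<close>

text \<open>The total masses agree, so the inequality on the complement of a point gives the reverse
  inequality at the point.\<close>

lemma pmf_eqI_le:
  assumes "\<And>x. pmf P x \<le> pmf Q x"
  shows "P = Q"
proof (rule pmf_eqI, rule antisym)
  fix x
  show "pmf P x \<le> pmf Q x" by fact
  have 1: "measure_pmf.prob R (UNIV - {x}) = 1 - pmf R x" for R :: "'a pmf"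
    using measure_pmf.prob_compl[of "{x}" R] by (simp add: measure_pmf_single)
  have "measure_pmf.prob P (UNIV - {x}) \<le> measure_pmf.prob Q (UNIV - {x})"
    unfolding measure_pmf_conv_infsetsum
    by (rule infsetsum_mono) (auto simp: assms pmf_abs_summable)
  then show "pmf Q x \<le> pmf P x" unfolding 1 by simp
qed

lemma abs_sums_imp_nn_integral:
  fixes f :: "'i \<Rightarrow> real"
  assumes "abs_sums f A S" "\<And>x. f x \<ge> 0"
  shows "(\<integral>\<^sup>+x. ennreal (f x) \<partial>count_space A) = ennreal S"
proof -
  have "Infinite_Set_Sum.abs_summable_on f A"
    using assms(1) by (simp add: abs_sums_def abs_summable_equivalent[symmetric])
  then have "(\<integral>\<^sup>+x. ennreal (f x) \<partial>count_space A) = ennreal (infsetsum f A)"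
    using assms(2) by (intro nn_integral_conv_infsetsum) auto
  also have "infsetsum f A = infsum f A"
    by (rule infsetsum_infsum) fact
  also have "\<dots> = S" using assms(1) by (simp add: abs_sums_def infsumI)
  finally show ?thesis .
qed

lemma abs_sums_expectation:
  fixes f :: "'i \<Rightarrow> 'k::{banach, second_countable_topology}"
  assumes s: "abs_sums (\<lambda>x. pmf P x *\<^sub>R f x) UNIV S"
  shows "integrable (measure_pmf P) f" and "measure_pmf.expectation P f = S"
proof -
  have a: "Infinite_Set_Sum.abs_summable_on (\<lambda>x. pmf P x *\<^sub>R f x) UNIV"
    using s by (simp add: abs_sums_def abs_summable_equivalent[symmetric])
  show "integrable (measure_pmf P) f"
    using a unfolding measure_pmf_eq_density Infinite_Set_Sum.abs_summable_on_def
    by (subst integrable_density) auto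
  have "measure_pmf.expectation P f = infsetsum (\<lambda>x. pmf P x *\<^sub>R f x) UNIV"
    unfolding infsetsum_def measure_pmf_eq_density by (subst integral_density) auto
  also have "\<dots> = infsum (\<lambda>x. pmf P x *\<^sub>R f x) UNIV"
    by (rule infsetsum_infsum) fact
  also have "\<dots> = S"
    using s by (simp add: abs_sums_def infsumI)
  finally show "measure_pmf.expectation P f = S" .
qed

lemma disjoint_words_of: "disjoint_family_on words_of X"
  by (auto simp: disjoint_family_on_def words_of_def)

lemma UN_words_of: "(\<Union>Cs\<in>{Cs. distinct Cs}. words_of Cs) = {w. trim w = w}"
  by (auto simp: words_of_def)

lemma finite_distinct_lists: "finite {Cs :: 'c::finite list. distinct Cs \<and> P Cs}"
  by (rule finite_subset[OF _ finite_subset_distinct[of UNIV]]) auto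

context fcfs_weights
begin

definition item :: "('c + 's) pmf" where
  "item = embed_pmf pr"

lemma pmf_item [simp]: "pmf item y = pr y"
  unfolding item_def
proof (rule pmf_embed_pmf)
  show "(\<integral>\<^sup>+y. ennreal (pr y) \<partial>count_space UNIV) = 1"
    using sum_pr by (subst nn_integral_count_space_finite) (auto simp: pr_nonneg)
qed (rule pr_nonneg)

text \<open>Its reciprocal is the constant \<open>B\<close>, the stationary probability of the empty
  word.\<close>

definition Wtot :: real where
  "Wtot = (\<Sum>Cs | distinct Cs. W Cs)"

lemma W_nonneg: "W Cs \<ge> 0"
  unfolding W_def
proof (rule prod_nonneg, safe)
  fix h assume "h < length Cs"
  then have "p (set (take (Suc h) Cs)) > 0" by (intro p_pos) auto
  then show "0 \<le> a (Cs ! h) / p (set (take (Suc h) Cs))"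
    by (intro divide_nonneg_pos a_nonneg)
qed

lemma Wtot_pos: "Wtot > 0"
proof -
  have "W [] \<le> Wtot"
    unfolding Wtot_def using finite_distinct_lists[of "\<lambda>_. True"]
    by (intro member_le_sum) (auto simp: W_nonneg)
  then show ?thesis by (simp add: W_def)
qed

definition stat :: "'c word pmf" where
  "stat = embed_pmf (\<lambda>w. if trim w = w then wt {} w / Wtot else 0)"

lemma abs_sums_trimmed:
  fixes f :: "'c word \<Rightarrow> 'k::{banach, real_normed_field}"
  assumes "\<And>Cs. distinct Cs \<Longrightarrow> abs_sums (\<lambda>w. of_real (wt {} w) * f w) (words_of Cs) (S Cs)"
  shows "abs_sums (\<lambda>w. of_real (if trim w = w then wt {} w / Wtot else 0) * f w) UNIV
    ((\<Sum>Cs | distinct Cs. S Cs) / of_real Wtot)"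
proof -
  have "abs_sums (\<lambda>w. of_real (wt {} w) * f w) {w. trim w = w} (\<Sum>Cs | distinct Cs. S Cs)"
    unfolding UN_words_of[symmetric] using finite_distinct_lists[of "\<lambda>_. True"] assms
    by (intro abs_sums_UN disjoint_words_of) auto
  from abs_sums_cmult[OF this, of "1 / of_real Wtot"]
  have *: "abs_sums (\<lambda>w. of_real (if trim w = w then wt {} w / Wtot else 0) * f w) {w. trim w = w}
     ((\<Sum>Cs | distinct Cs. S Cs) / of_real Wtot)"
    by (rule abs_sums_cong[THEN iffD1, rotated -1]) auto
  show ?thesis
    using * unfolding abs_sums_def
    by (auto elim!: has_sum_cong_neutral[THEN iffD1, rotated -1] summable_on_cong_neutral[THEN iffD1, rotated -1] split: if_splits)
qed

lemma pmf_stat: "pmf stat w = (if trim w = w then wt {} w / Wtot else 0)"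
  unfolding stat_def
proof (rule pmf_embed_pmf)
  have "abs_sums (\<lambda>w. of_real (if trim w = w then wt {} w / Wtot else 0) * 1) UNIV
    ((\<Sum>Cs | distinct Cs. W Cs) / of_real Wtot)"
    using abs_sums_W by (intro abs_sums_trimmed) simp
  moreover have "(\<Sum>Cs | distinct Cs. W Cs) / of_real Wtot = 1"
    using Wtot_pos by (simp add: Wtot_def[symmetric])
  ultimately have "abs_sums (\<lambda>w. if trim w = w then wt {} w / Wtot else 0) UNIV 1"
    by simp
  from abs_sums_imp_nn_integral[OF this]
  show "(\<integral>\<^sup>+w. ennreal (if trim w = w then wt {} w / Wtot else 0) \<partial>count_space UNIV) = 1"
    using Wtot_pos wt_nonneg by simp
qed (use Wtot_pos wt_nonneg in auto)

lemma expectation_stat: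
  fixes f :: "'c word \<Rightarrow> 'k::{banach, real_normed_field, second_countable_topology}"
  assumes "\<And>Cs. distinct Cs \<Longrightarrow> abs_sums (\<lambda>w. of_real (wt {} w) * f w) (words_of Cs) (S Cs)"
  shows "integrable (measure_pmf stat) f"
    and "measure_pmf.expectation stat f = (\<Sum>Cs | distinct Cs. S Cs) / of_real Wtot"
proof -
  have "abs_sums (\<lambda>w. pmf stat w *\<^sub>R f w) UNIV ((\<Sum>Cs | distinct Cs. S Cs) / of_real Wtot)"
    using abs_sums_trimmed[OF assms] by (simp add: pmf_stat scaleR_conv_of_real)
  from abs_sums_expectation[OF this] show "integrable (measure_pmf stat) f"
    "measure_pmf.expectation stat f = (\<Sum>Cs | distinct Cs. S Cs) / of_real Wtot" by simp_all
qed

definition step :: "'c word \<Rightarrow> 'c + 's \<Rightarrow> 'c word" where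
  "step w y = trim (arrive G w y)"

text \<open>Both sides are probability distributions, so an inequality suffices, and for it only finitely
  many transitions into each state are needed at a time.\<close>

lemma stat_invariant: "map_pmf (\<lambda>(w, y). step w y) (pair_pmf stat item) = stat" (is "?Q = stat")
proof (rule sym, rule pmf_eqI_le)
  fix t
  let ?E = "{(w, y). step w y = t}"
  have Q: "pmf ?Q t = measure_pmf.prob (pair_pmf stat item) ?E"
    by (simp add: pmf_map vimage_def case_prod_unfold)
  have le: "(\<Sum>(w, y)\<in>F. pmf stat w * pr y) \<le> pmf ?Q t" if "finite F" "F \<subseteq> ?E" for F
  proof -
    have "(\<Sum>(w, y)\<in>F. pmf stat w * pr y) = measure_pmf.prob (pair_pmf stat item) F"
      using that(1) by (subst measure_measure_pmf_finite) (auto simp: pmf_pair intro!: sum.cong)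
    also have "\<dots> \<le> pmf ?Q t"
      unfolding Q by (rule measure_pmf.finite_measure_mono) (use that in auto)
    finally show ?thesis .
  qed
  have main: "q (types w) * wt {} w / Wtot \<le> pmf ?Q t" if w: "trim w = w" "trim (w @ [None]) = t" for w
  proof -
    have "(\<Sum>(w0, y)\<in>preds w K. wt {} w0 * pr y) / Wtot \<le> pmf ?Q t" for K
    proof -
      have "(\<Sum>(w0, y)\<in>preds w K. wt {} w0 * pr y) / Wtot = (\<Sum>(w0, y)\<in>preds w K. pmf stat w0 * pr y)"
        unfolding sum_divide_distrib
        by (rule sum.cong) (auto simp: pmf_stat dest!: preds_trim[OF w(1)])
      also have "\<dots> \<le> pmf ?Q t"
        by (rule le) (auto simp: step_def w(2) dest!: preds_trim[OF w(1)])
      finally show ?thesis .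
    qed
    moreover have "(\<lambda>K. (\<Sum>(w0, y)\<in>preds w K. wt {} w0 * pr y) / Wtot) \<longlonglongrightarrow> q (types w) * wt {} w / Wtot"
      using Wtot_pos by (intro tendsto_divide sum_preds_LIMSEQ tendsto_const) auto
    ultimately show ?thesis by (intro LIMSEQ_le_const2) auto
  qed
  show "pmf stat t \<le> pmf ?Q t"
  proof (cases "trim t = t")
    case False
    then show ?thesis by (simp add: pmf_stat)
  next
    case trim: True
    show ?thesis
    proof (cases t rule: rev_cases)
      case Nil
      \<comment> \<open>The empty word is fed by transitions that append an idle letter and are
        trimmed away completely; the balance is exact because \<open>q {} = 1\<close>.\<close>
      have "trim ([] @ [None]) = t" using Nil by (simp add: trim_def)
      from main[OF _ this] show ?thesis
        using Nil by (simp add: pmf_stat trim_def q_def)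
    next
      case (snoc w o')
      show ?thesis
      proof (cases o')
        case None
        have "trim w = w"
          using trim snoc None by (cases w) (auto simp: trim_eq_self)
        from main[OF this] show ?thesis
          using trim snoc None by (simp add: pmf_stat wt_append mult.commute)
      next
        case (Some c)
        have w: "trim w = w"
          using trim snoc Some by (simp add: trim_append_Some)
        \<comment> \<open>An agent at the end has just arrived, so this single transition carries
          the whole weight \<open>wt {} w * a c\<close>.\<close>
        have "(\<Sum>(w, y)\<in>{(w, Inl c)}. pmf stat w * pr y) \<le> pmf ?Q t"
          by (rule le) (use snoc Some trim in \<open>auto simp: step_def\<close>)
        then show ?thesis
          using trim w snoc Some by (simp add: pmf_stat wt_append)
      qed
    qed
  qed
qed

section \<open>The chain and its chance of being empty\<close>

definition chain :: "nat \<Rightarrow> 'c word \<Rightarrow> 'c word pmf" where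
  "chain n w = map_pmf (\<lambda>ys. trim (run G w ys)) (replicate_pmf n item)"

lemma chain_Suc: "chain (Suc n) w = bind_pmf item (\<lambda>y. chain n (step w y))"
  unfolding chain_def replicate_pmf.simps map_bind_pmf
  by (simp add: step_def trim_run map_pmf_def bind_assoc_pmf bind_return_pmf)

lemma stat_chain: "bind_pmf stat (chain n) = stat"
proof (induction n)
  case 0
  have "bind_pmf stat (chain 0) = bind_pmf stat return_pmf"
    by (rule bind_pmf_cong) (auto simp: chain_def set_pmf_iff pmf_stat split: if_splits)
  then show ?case by (simp add: bind_return_pmf')
next
  case (Suc n)
  have "bind_pmf stat (chain (Suc n)) = bind_pmf (map_pmf (\<lambda>(w, y). step w y) (pair_pmf stat item)) (chain n)"
    unfolding chain_Suc[abs_def]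
    by (simp add: pair_pmf_def map_pmf_def bind_assoc_pmf bind_return_pmf)
  then show ?case using Suc by (simp add: stat_invariant)
qed

lemma trim_run_empty:
  assumes "trim (run G w ys) = []"
  shows "trim (run G [] ys) = []"
proof -
  have "cnt (run G (replicate (length w) None) ys) \<le> cnt (run G w ys)"
    using dominated_run[OF dominated_None] dominated_cnt by blast
  then show ?thesis
    using assms run_append_None[of G "length w" "[]" ys] by (simp add: trim_eq_Nil_iff)
qed

text \<open>By domination no initial word is emptier at time \<open>n\<close> than the empty one.
  Averaging the initial word over \<open>stat\<close> gives exactly \<open>1 / Wtot\<close>, a bound
  that does not depend on \<open>n\<close>.\<close>

lemma chain_empty_ge: "1 / Wtot \<le> pmf (chain n []) []"
proof -
  have "1 / Wtot = pmf (bind_pmf stat (chain n)) []"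
    by (simp add: stat_chain pmf_stat trim_def)
  also have "\<dots> = measure_pmf.expectation stat (\<lambda>w. pmf (chain n w) [])"
    by (rule pmf_bind)
  also have "\<dots> \<le> measure_pmf.expectation stat (\<lambda>w. pmf (chain n []) [])"
  proof (rule integral_mono)
    show "integrable (measure_pmf stat) (\<lambda>w. pmf (chain n w) [])"
      by (rule measure_pmf.integrable_const_bound[where B = 1]) (auto simp: pmf_le_1)
    fix w
    show "pmf (chain n w) [] \<le> pmf (chain n []) []"
      unfolding chain_def pmf_map
      by (rule measure_pmf.finite_measure_mono) (auto dest: trim_run_empty)
  qed auto
  finally show ?thesis by simp
qed

end

section \<open>Averages of stationary sequences\<close>

lemma measurable_map_list [measurable (raw)]:
  assumes "\<And>i. i \<in> set l \<Longrightarrow> f i \<in> measurable N (count_space (UNIV :: 'b::countable set))"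
  shows "(\<lambda>x. map (\<lambda>i. f i x) l) \<in> measurable N (count_space UNIV)"
  using assms
proof (induction l)
  case (Cons i l)
  have "(\<lambda>x. f i x # map (\<lambda>i. f i x) l) \<in> measurable N (count_space UNIV)"
  proof (rule measurable_compose_countable[where f = "\<lambda>b x. b # map (\<lambda>i. f i x) l"])
    show "f i \<in> measurable N (count_space UNIV)" using Cons.prems by simp
    show "(\<lambda>x. b # map (\<lambda>i. f i x) l) \<in> measurable N (count_space UNIV)" for b
      using Cons by (intro measurable_compose[where f = "\<lambda>x. map (\<lambda>i. f i x) l" and g = "(#) b"]) auto
  qed
  then show ?case by simp
qed simp

lemma pmf_replicate_pmf:
  "pmf (replicate_pmf n P) ys = (if length ys = n then prod_list (map (pmf P) ys) else 0)"
proof (induction n arbitrary: ys)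
  case (Suc n)
  have eq: "replicate_pmf (Suc n) P = map_pmf (\<lambda>(x, xs). x # xs) (pair_pmf P (replicate_pmf n P))"
    by (simp add: pair_pmf_def map_pmf_def bind_assoc_pmf bind_return_pmf)
  show ?case
  proof (cases ys)
    case Nil
    then show ?thesis unfolding eq by (auto intro!: pmf_map_outside)
  next
    case (Cons y ys')
    have "inj (\<lambda>(x, xs). x # xs :: 'a list)" by (auto simp: inj_def)
    from pmf_map_inj'[OF this, of _ "(y, ys')"]
    show ?thesis unfolding eq Cons by (simp add: pmf_pair Suc.IH)
  qed
qed (auto simp: pmf_return)

section \<open>Averages and coverings by blocks\<close>

lemma sum_lessThan_split:
  fixes g :: "nat \<Rightarrow> 'k::comm_monoid_add"
  shows "(\<Sum>j<n + m. g (i + j)) = (\<Sum>j<n. g (i + j)) + (\<Sum>j<m. g (i + n + j))"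
  by (induction m) (auto simp: ac_simps)

text \<open>Blocks of average at least \<open>t\<close> are laid one after the other from the left.
  What remains uncovered at the right end is shorter than \<open>L\<close> and contributes a
  nonnegative amount.\<close>

lemma tiling_bound:
  fixes g :: "nat \<Rightarrow> real"
  assumes g: "\<And>i. g i \<ge> 0" and t: "t \<ge> 0"
    and block: "\<And>i. \<exists>n\<in>{1..L}. (\<Sum>j<n. g (i + j)) \<ge> t * real n"
  shows "(\<Sum>j<N. g (i + j)) \<ge> t * (real N - real L)"
proof (induction N arbitrary: i rule: less_induct)
  case (less N)
  show ?case
  proof (cases "N < L")
    case True
    then have "t * (real N - real L) \<le> 0" using t by (intro mult_nonneg_nonpos) auto
    also have "0 \<le> (\<Sum>j<N. g (i + j))" by (intro sum_nonneg) (auto simp: g)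
    finally show ?thesis .
  next
    case False
    obtain n where n: "1 \<le> n" "n \<le> L" "(\<Sum>j<n. g (i + j)) \<ge> t * real n" using block[of i] by auto
    have IH: "(\<Sum>j<N - n. g (i + n + j)) \<ge> t * (real (N - n) - real L)"
      using n False by (intro less.IH) auto
    have "(\<Sum>j<n + (N - n). g (i + j)) = (\<Sum>j<n. g (i + j)) + (\<Sum>j<N - n. g (i + n + j))"
      by (rule sum_lessThan_split)
    then show ?thesis using n IH False by (simp add: algebra_simps of_nat_diff)
  qed
qed

text \<open>The additive constant \<open>K\<close> makes the event of the 0-1 law insensitive to finitely many terms.\<close>

definition exceeds :: "(nat \<Rightarrow> real) \<Rightarrow> real \<Rightarrow> bool" where
  "exceeds g t \<longleftrightarrow> (\<forall>K::nat. \<exists>\<^sub>\<infinity>N. (\<Sum>j<N. g j) > t * real N + real K)"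

context prob_space
begin

text \<open>The covering argument of Katznelson and Weiss for the ergodic theorem.\<close>

lemma stationary_mean_ge:
  fixes f :: "nat \<Rightarrow> 'a \<Rightarrow> real"
  assumes [measurable]: "\<And>i. f i \<in> borel_measurable M"
    and f01: "\<And>i x. 0 \<le> f i x" "\<And>i x. f i x \<le> 1"
    and mean: "\<And>i. expectation (f i) = \<mu>"
    and block: "\<And>i L. prob {x \<in> space M. \<forall>n\<in>{1..L}. (\<Sum>j<n. f (i + j) x) < t * real n} =
        prob {x \<in> space M. \<forall>n\<in>{1..L}. (\<Sum>j<n. f j x) < t * real n}"
    and t: "0 \<le> t" "t \<le> 1"
    and ex: "AE x in M. \<exists>n\<ge>1. (\<Sum>j<n. f j x) \<ge> t * real n"
  shows "t \<le> \<mu>"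
proof -
  \<comment> \<open>From these positions no block of length at most \<open>L\<close> reaches the
    average \<open>t\<close>. Adding the indicator of this event turns such a position into an
    admissible block of length one, as \<open>t\<close> is at most 1.\<close>
  define bad where "bad L i = {x \<in> space M. \<forall>n\<in>{1..L}. (\<Sum>j<n. f (i + j) x) < t * real n}" for L i
  have bad_sets [measurable]: "bad L i \<in> events" for L i
    unfolding bad_def by measurable
  have prob_bad: "prob (bad L i) = prob (bad L 0)" for L i
    using block[of L i] by (simp add: bad_def)
  have main: "t \<le> \<mu> + prob (bad (Suc L) 0)" for L
  proof -
    let ?L = "Suc L"
    have le: "t * (real N - real ?L) \<le> real N * (\<mu> + prob (bad ?L 0))" for N
    proof -
      have int: "integrable M (\<lambda>x. f i x + indicator (bad ?L i) x)" for i
        by (rule Bochner_Integration.integrable_add)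
          (auto intro!: integrable_const_bound[where B = 1] simp: f01)
      have "t * (real N - real ?L) = expectation (\<lambda>x. t * (real N - real ?L))"
        using prob_space by simp
      also have "\<dots> \<le> expectation (\<lambda>x. \<Sum>j<N. f j x + indicator (bad ?L j) x)"
      proof (rule integral_mono)
        fix x assume x: "x \<in> space M"
        have "\<exists>n\<in>{1..?L}. (\<Sum>j<n. f (i + j) x + indicator (bad ?L (i + j)) x) \<ge> t * real n" for i
        proof (cases "x \<in> bad ?L i")
          case True
          then show ?thesis using t f01(1)[of i x] by (intro bexI[of _ 1]) auto
        next
          case False
          then obtain n where n: "n \<in> {1..?L}" "(\<Sum>j<n. f (i + j) x) \<ge> t * real n"
            using x by (auto simp: bad_def not_less)
          have "(\<Sum>j<n. f (i + j) x) \<le> (\<Sum>j<n. f (i + j) x + indicator (bad ?L (i + j)) x)"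
            by (intro sum_mono) auto
          then show ?thesis using n by (intro bexI[of _ n]) auto
        qed
        then show "t * (real N - real ?L) \<le> (\<Sum>j<N. f j x + indicator (bad ?L j) x)"
          using tiling_bound[of "\<lambda>j. f j x + indicator (bad ?L j) x" t ?L N 0] t(1) f01(1) by auto
      qed (use int in auto)
      also have "\<dots> = (\<Sum>j<N. expectation (f j) + prob (bad ?L j))"
      proof -
        have "expectation (\<lambda>x. f j x + indicator (bad ?L j) x) = expectation (f j) + prob (bad ?L j)" for j
        proof (subst Bochner_Integration.integral_add)
          show "integrable M (f j)"
            by (rule integrable_const_bound[where B = 1]) (auto simp: f01)
          show "integrable M (indicat_real (bad ?L j))"
            by (rule integrable_const_bound[where B = 1]) auto
        qed auto
        then show ?thesis using int by (subst Bochner_Integration.integral_sum) auto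
      qed
      also have "\<dots> = (\<Sum>j<N. \<mu> + prob (bad ?L 0))"
        by (intro sum.cong refl arg_cong2[where f = "(+)"] mean prob_bad)
      finally show ?thesis by simp
    qed
    have "(\<lambda>N. t - t * real ?L / real N) \<longlonglongrightarrow> t - 0"
      by (intro tendsto_diff tendsto_const tendsto_divide_0[OF tendsto_const]
          filterlim_at_top_imp_at_infinity filterlim_real_sequentially)
    moreover have "t - t * real ?L / real N \<le> \<mu> + prob (bad ?L 0)" if "N \<ge> 1" for N
      using le[of N] that by (simp add: field_simps)
    ultimately show ?thesis by (intro LIMSEQ_le_const2) (auto simp del: of_nat_Suc)
  qed
  \<comment> \<open>Almost surely some block starting at 0 reaches the average \<open>t\<close>, so
    the decreasing events have a null intersection and the error term disappears.\<close>
  have "(\<lambda>L. prob (bad (Suc L) 0)) \<longlonglongrightarrow> prob (\<Inter>L. bad (Suc L) 0)"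
    by (rule finite_Lim_measure_decseq) (auto simp: decseq_def bad_def)
  also have "prob (\<Inter>L. bad (Suc L) 0) = 0"
  proof -
    have "AE x in M. x \<notin> (\<Inter>L. bad (Suc L) 0)"
      using ex
    proof eventually_elim
      case (elim x)
      then obtain n where n: "n \<ge> 1" "(\<Sum>j<n. f j x) \<ge> t * real n" by auto
      then have "x \<notin> bad (Suc (n - 1)) 0" by (auto simp: bad_def not_less)
      then show ?case by blast
    qed
    then show ?thesis by (simp add: prob_eq_0)
  qed
  finally have "(\<lambda>L. \<mu> + prob (bad (Suc L) 0)) \<longlonglongrightarrow> \<mu> + 0"
    by (intro tendsto_intros)
  then show ?thesis using main by (intro LIMSEQ_le_const[where X = "\<lambda>L. \<mu> + prob (bad (Suc L) 0)"]) auto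
qed

text \<open>By the 0-1 law a level \<open>t\<close> above the mean that is exceeded infinitely often
  with positive probability is so almost surely, which contradicts
  \<open>stationary_mean_ge\<close>. Levels above 1 are never exceeded, since the terms are at most
  1.\<close>

lemma stationary_average_le:
  fixes f :: "nat \<Rightarrow> 'a \<Rightarrow> real"
  assumes "\<And>i. f i \<in> borel_measurable M"
    and f01: "\<And>i x. 0 \<le> f i x" "\<And>i x. f i x \<le> 1"
    and mean: "\<And>i. expectation (f i) = \<mu>"
    and block: "\<And>i L t. prob {x \<in> space M. \<forall>n\<in>{1..L}. (\<Sum>j<n. f (i + j) x) < t * real n} =
        prob {x \<in> space M. \<forall>n\<in>{1..L}. (\<Sum>j<n. f j x) < t * real n}"
    and zero_one: "\<And>t. (AE x in M. exceeds (\<lambda>j. f j x) t) \<or> (AE x in M. \<not> exceeds (\<lambda>j. f j x) t)"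
  shows "AE x in M. \<forall>e>0. \<exists>K. \<forall>\<^sub>F N in sequentially. (\<Sum>j<N. f j x) \<le> (\<mu> + e) * real N + real K"
proof -
  have \<mu>: "0 \<le> \<mu>" using f01(1) by (subst mean[of 0, symmetric]) (auto intro: integral_nonneg_AE)
  have "AE x in M. \<not> exceeds (\<lambda>j. f j x) t" if t: "t > \<mu>" for t
  proof (cases "t \<le> 1")
    case True
    have "\<not> (AE x in M. exceeds (\<lambda>j. f j x) t)"
    proof
      assume "AE x in M. exceeds (\<lambda>j. f j x) t"
      then have "AE x in M. \<exists>n\<ge>1. (\<Sum>j<n. f j x) \<ge> t * real n"
      proof eventually_elim
        case (elim x)
        then have "\<exists>\<^sub>\<infinity>N. (\<Sum>j<N. f j x) > t * real N + real 0" unfolding exceeds_def by blast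
        then have "\<exists>N\<ge>1. (\<Sum>j<N. f j x) > t * real N + real 0"
          unfolding INFM_nat_le by blast
        then show ?case by force
      qed
      moreover have "0 \<le> t" using \<mu> t by simp
      ultimately have "t \<le> \<mu>"
        by (intro stationary_mean_ge[OF assms(1) f01 mean block _ True])
      then show False using t by simp
    qed
    then show ?thesis using zero_one[of t] by blast
  next
    case False
    have "\<not> exceeds (\<lambda>j. f j x) t" for x
    proof
      assume "exceeds (\<lambda>j. f j x) t"
      then have "\<exists>\<^sub>\<infinity>N. (\<Sum>j<N. f j x) > t * real N + real 0" unfolding exceeds_def by blast
      then obtain N where N: "(\<Sum>j<N. f j x) > t * real N + real 0"
        using INFM_EX by blast
      have "(\<Sum>j<N. f j x) \<le> (\<Sum>j<N. 1)" by (intro sum_mono) (auto simp: f01)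
      also have "\<dots> \<le> t * real N" using False by (simp add: mult_le_cancel_right1)
      finally show False using N by simp
    qed
    then show ?thesis by simp
  qed
  then have "AE x in M. \<forall>k. \<not> exceeds (\<lambda>j. f j x) (\<mu> + 1 / real (Suc k))"
    by (subst AE_all_countable) auto
  then show ?thesis
  proof eventually_elim
    case (elim x)
    show ?case
    proof (intro allI impI)
      fix e :: real assume "e > 0"
      then obtain k where k: "1 / real (Suc k) < e" using nat_approx_posE by blast
      obtain K where "\<forall>\<^sub>F N in sequentially. (\<Sum>j<N. f j x) \<le> (\<mu> + 1 / real (Suc k)) * real N + real K"
        using elim unfolding exceeds_def not_all frequently_cofinite[symmetric] cofinite_eq_sequentially
          frequently_def not_not not_less by blast
      then have "\<forall>\<^sub>F N in sequentially. (\<Sum>j<N. f j x) \<le> (\<mu> + e) * real N + real K"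
      proof eventually_elim
        case (elim N)
        have "(\<mu> + 1 / real (Suc k)) * real N \<le> (\<mu> + e) * real N"
          using k by (intro mult_right_mono) auto
        then show ?case using elim by linarith
      qed
      then show "\<exists>K. \<forall>\<^sub>F N in sequentially. (\<Sum>j<N. f j x) \<le> (\<mu> + e) * real N + real K" by blast
    qed
  qed
qed

text \<open>The upper bound for \<open>1 - g\<close> is a lower bound for \<open>g\<close>; the
  additive constants vanish after division by \<open>N\<close>.\<close>

lemma average_tendsto:
  fixes g :: "nat \<Rightarrow> real"
  assumes le: "\<And>e. e > 0 \<Longrightarrow> \<exists>K. \<forall>\<^sub>F N in sequentially. (\<Sum>j<N. g j) \<le> (\<mu> + e) * real N + real K"
    and ge: "\<And>e. e > 0 \<Longrightarrow> \<exists>K. \<forall>\<^sub>F N in sequentially. (\<Sum>j<N. 1 - g j) \<le> (1 - \<mu> + e) * real N + real K"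
  shows "(\<lambda>N. (\<Sum>j<N. g j) / real N) \<longlonglongrightarrow> \<mu>"
proof (rule tendstoI)
  fix e :: real assume "e > 0"
  then have e: "e / 2 > 0" by simp
  obtain K where K: "\<forall>\<^sub>F N in sequentially. (\<Sum>j<N. g j) \<le> (\<mu> + e / 2) * real N + real K"
    using le[OF e] by blast
  obtain K' where K': "\<forall>\<^sub>F N in sequentially. (\<Sum>j<N. 1 - g j) \<le> (1 - \<mu> + e / 2) * real N + real K'"
    using ge[OF e] by blast
  have large: "\<forall>\<^sub>F N in sequentially. real N > R" for R :: real
    using filterlim_real_sequentially by (simp add: filterlim_at_top_dense)
  show "\<forall>\<^sub>F N in sequentially. dist ((\<Sum>j<N. g j) / real N) \<mu> < e"
    using K K' large[of "2 * real K / e"] large[of "2 * real K' / e"] large[of 0]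
  proof eventually_elim
    case (elim N)
    have "real K < e / 2 * real N" "real K' < e / 2 * real N"
      using elim(3,4) \<open>e > 0\<close> by (auto simp: field_simps)
    then have "(\<Sum>j<N. g j) < (\<mu> + e) * real N" "(\<Sum>j<N. g j) > (\<mu> - e) * real N"
      using elim(1,2) by (auto simp: algebra_simps sum_subtractf)
    then show ?case using elim(5) by (simp add: dist_real_def abs_less_iff field_simps)
  qed
qed

end

section \<open>Coupling with the empty start\<close>

text \<open>From \<open>j0\<close> on the partial sums differ by a fixed number, which the
  quantifier over \<open>K\<close> absorbs.\<close>

lemma exceeds_cong:
  assumes "\<exists>j0. \<forall>j\<ge>j0. g j = g' j"
  shows "exceeds g t \<longleftrightarrow> exceeds g' t"
proof -
  have *: "exceeds g' t" if ex: "exceeds g t" and eq: "\<forall>j\<ge>j0. g j = g' j" for g g' j0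
    unfolding exceeds_def
  proof
    fix K :: nat
    define D where "D = (\<Sum>j<j0. g j - g' j)"
    obtain K' :: nat where K': "real K' \<ge> real K + D" using real_arch_simple by blast
    have S: "(\<Sum>j<N. g j) = D + (\<Sum>j<N. g' j)" if "N \<ge> j0" for N
      using sum_lessThan_split[of "\<lambda>j. g j - g' j" 0 j0 "N - j0"] that eq
      by (simp add: D_def sum_subtractf)
    show "\<exists>\<^sub>\<infinity>N. (\<Sum>j<N. g' j) > t * real N + real K"
      unfolding INFM_nat_le
    proof
      fix m
      obtain N where N: "N \<ge> max m j0" "(\<Sum>j<N. g j) > t * real N + real K'"
        using ex unfolding exceeds_def INFM_nat_le by blast
      then show "\<exists>N\<ge>m. (\<Sum>j<N. g' j) > t * real N + real K"
        using S[of N] K' by (intro exI[of _ N]) auto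
    qed
  qed
  obtain j0 where "\<forall>j\<ge>j0. g j = g' j" using assms by blast
  then show ?thesis using * by (metis (no_types, lifting))
qed

lemma (in prob_space) prob_tendsto_0:
  assumes "\<And>n. {x \<in> space M. P n x} \<in> events"
    and "AE x in M. \<forall>\<^sub>F n in sequentially. \<not> P n x"
  shows "(\<lambda>n. prob {x \<in> space M. P n x}) \<longlonglongrightarrow> 0"
proof -
  have "(\<lambda>n. expectation (indicator {x \<in> space M. P n x} :: _ \<Rightarrow> real)) \<longlonglongrightarrow> expectation (\<lambda>_. 0)"
  proof (rule integral_dominated_convergence[where w = "\<lambda>_. 1"])
    show "AE x in M. (\<lambda>n. indicator {x \<in> space M. P n x} x :: real) \<longlonglongrightarrow> 0"
      using assms(2)
    proof eventually_elim
      case (elim x)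
      then have "\<forall>\<^sub>F n in sequentially. (indicator {x \<in> space M. P n x} x :: real) = 0"
        by eventually_elim auto
      then show ?case by (rule tendsto_eventually)
    qed
  qed (use assms(1) in auto)
  then show ?thesis using assms(1) by simp
qed

lemma (in prob_space) prob_diff_le:
  assumes [measurable]: "Measurable.pred M P" "Measurable.pred M Q"
  shows "\<bar>prob {x \<in> space M. P x} - prob {x \<in> space M. Q x}\<bar> \<le> prob {x \<in> space M. P x \<noteq> Q x}"
proof -
  have 1: "prob {x \<in> space M. P x} \<le> prob {x \<in> space M. Q x} + prob {x \<in> space M. P x \<noteq> Q x}"
    if [measurable]: "Measurable.pred M P" "Measurable.pred M Q" for P Q
  proof -
    have "prob {x \<in> space M. P x} \<le> prob ({x \<in> space M. Q x} \<union> {x \<in> space M. P x \<noteq> Q x})"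
      by (rule finite_measure_mono) auto
    also have "\<dots> \<le> prob {x \<in> space M. Q x} + prob {x \<in> space M. P x \<noteq> Q x}"
      by (rule measure_Un_le) auto
    finally show ?thesis .
  qed
  have "{x \<in> space M. P x \<noteq> Q x} = {x \<in> space M. Q x \<noteq> P x}" by auto
  then show ?thesis using 1[of P Q] 1[of Q P] by simp
qed

locale item_seq = prob_space M + fcfs_weights G a b
  for M :: "'w measure" and G :: "('s::finite \<times> 'c::finite) set" and a b +
  fixes z :: "int \<Rightarrow> 'w \<Rightarrow> 'c + 's"
  assumes indep: "indep_vars (\<lambda>_. count_space UNIV) z UNIV"
    and law: "prob {x \<in> space M. z i x = y} = pr y"
begin

lemma z_measurable [measurable]: "z i \<in> measurable M (count_space UNIV)"
  using indep by (simp add: indep_vars_def)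

definition items :: "int \<Rightarrow> nat \<Rightarrow> 'w \<Rightarrow> ('c + 's) list" where
  "items m n x = map (\<lambda>i. z (m + int i) x) [0..<n]"

lemma items_measurable [measurable]: "items m n \<in> measurable M (count_space UNIV)"
  unfolding items_def[abs_def] by measurable

lemma length_items [simp]: "length (items m n x) = n"
  by (simp add: items_def)

lemma nth_items: "i < n \<Longrightarrow> items m n x ! i = z (m + int i) x"
  by (simp add: items_def)

lemma items_add: "items m (k + n) x = items m k x @ items (m + int k) n x"
  unfolding items_def by (subst map_upt_add) (simp add: add.assoc)

lemma prob_items: "prob {x \<in> space M. items m (length ys) x = ys} = prod_list (map pr ys)"
proof (cases "ys = []")
  case True
  then show ?thesis by (simp add: items_def prob_space)
next
  case False
  let ?I = "(\<lambda>i. m + int i) ` {..<length ys}"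
  have inj: "inj_on (\<lambda>i. m + int i) {..<length ys}" by (auto simp: inj_on_def)
  have "{x \<in> space M. items m (length ys) x = ys} =
      (\<Inter>j\<in>?I. z j -` {ys ! nat (j - m)} \<inter> space M)"
  proof (rule set_eqI)
    fix x
    have "items m (length ys) x = ys \<longleftrightarrow> (\<forall>i\<in>{..<length ys}. z (m + int i) x = ys ! i)"
    proof
      assume eq: "items m (length ys) x = ys"
      show "\<forall>i\<in>{..<length ys}. z (m + int i) x = ys ! i"
        by (subst (2) eq[symmetric]) (simp add: nth_items)
    next
      assume "\<forall>i\<in>{..<length ys}. z (m + int i) x = ys ! i"
      then show "items m (length ys) x = ys" by (intro nth_equalityI) (auto simp: nth_items)
    qed
    moreover have "0 \<in> {..<length ys}" using False by simp
    ultimately show "x \<in> {x \<in> space M. items m (length ys) x = ys} \<longleftrightarrow>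
        x \<in> (\<Inter>j\<in>?I. z j -` {ys ! nat (j - m)} \<inter> space M)"
      by simp blast
  qed
  also have "prob \<dots> = (\<Prod>j\<in>?I. prob (z j -` {ys ! nat (j - m)} \<inter> space M))"
    by (rule indep_varsD[OF indep]) (use False in auto)
  also have "\<dots> = (\<Prod>j\<in>?I. pr (ys ! nat (j - m)))"
  proof (intro prod.cong refl)
    fix j
    have "z j -` {ys ! nat (j - m)} \<inter> space M = {x \<in> space M. z j x = ys ! nat (j - m)}" by auto
    then show "prob (z j -` {ys ! nat (j - m)} \<inter> space M) = pr (ys ! nat (j - m))" by (simp add: law)
  qed
  also have "\<dots> = (\<Prod>i<length ys. pr (ys ! i))"
    by (subst prod.reindex[OF inj]) simp
  also have "\<dots> = prod_list (map pr ys)"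
    by (simp add: prod.list_conv_set_nth atLeast0LessThan)
  finally show ?thesis .
qed

lemma distr_items: "distr M (count_space UNIV) (items m n) = measure_pmf (replicate_pmf n item)"
proof (rule measure_eqI_countable[of _ UNIV])
  fix ys :: "('c + 's) list"
  have "prob (items m n -` {ys} \<inter> space M) = pmf (replicate_pmf n item) ys"
  proof (cases "length ys = n")
    case True
    have "items m n -` {ys} \<inter> space M = {x \<in> space M. items m (length ys) x = ys}"
      using True by auto
    then show ?thesis using prob_items[of m ys] True
      by (simp add: pmf_replicate_pmf) (simp add: fun_eq_iff[of "pmf item", symmetric] cong: map_cong)
  next
    case False
    then have "items m n -` {ys} \<inter> space M = {}" by (auto dest: arg_cong[of _ _ length])
    then show ?thesis using False by (simp add: pmf_replicate_pmf)
  qed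
  then show "emeasure (distr M (count_space UNIV) (items m n)) {ys} =
     emeasure (measure_pmf (replicate_pmf n item)) {ys}"
    by (simp add: emeasure_distr emeasure_eq_measure emeasure_pmf_single)
qed auto

lemma prob_items_in: "prob {x \<in> space M. items m n x \<in> Y} = measure_pmf.prob (replicate_pmf n item) Y"
proof -
  have "measure_pmf.prob (replicate_pmf n item) Y = measure (distr M (count_space UNIV) (items m n)) Y"
    by (simp add: distr_items)
  also have "\<dots> = prob {x \<in> space M. items m n x \<in> Y}"
    by (subst measure_distr) (auto intro: arg_cong[of _ _ prob])
  finally show ?thesis by simp
qed

lemma prob_items_then:
  "prob {x \<in> space M. items m n x \<in> Y \<and> items (m + int n) (length g) x = g} =
     prob {x \<in> space M. items m n x \<in> Y} * prod_list (map pr g)"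
proof -
  let ?X = "{zs. take n zs \<in> Y \<and> drop n zs = g}"
  let ?P = "pair_pmf (replicate_pmf n item) (replicate_pmf (length g) item)"
  have "prob {x \<in> space M. items m n x \<in> Y \<and> items (m + int n) (length g) x = g} =
      prob {x \<in> space M. items m (n + length g) x \<in> ?X}"
    by (simp add: items_add)
  also have "\<dots> = measure_pmf.prob (replicate_pmf (n + length g) item) ?X"
    by (rule prob_items_in)
  also have "replicate_pmf (n + length g) item = map_pmf (\<lambda>(xs, ys). xs @ ys) ?P"
    by (simp add: replicate_pmf_distrib pair_pmf_def map_pmf_def bind_assoc_pmf bind_return_pmf)
  also have "measure_pmf.prob \<dots> ?X = measure_pmf.prob ?P ((\<lambda>(xs, ys). xs @ ys) -` ?X)"
    by (rule measure_map_pmf)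
  also have "\<dots> = measure_pmf.prob ?P (Y \<times> {g})"
    by (rule measure_pmf.finite_measure_eq_AE) (auto simp: AE_measure_pmf_iff set_replicate_pmf)
  also have "\<dots> = measure_pmf.prob (replicate_pmf n item) Y * pmf (replicate_pmf (length g) item) g"
    by (subst measure_pmf_prob_product) (auto simp: measure_pmf_single)
  also have "pmf (replicate_pmf (length g) item) g = prod_list (map pr g)"
    by (simp add: pmf_replicate_pmf cong: map_cong)
  finally show ?thesis by (simp add: prob_items_in)
qed

text \<open>\<open>U m n x\<close> is the word waiting before item \<open>m + n\<close> if nobody waits before item \<open>m\<close>.\<close>

definition U :: "int \<Rightarrow> nat \<Rightarrow> 'w \<Rightarrow> 'c word" where
  "U m n x = trim (run G [] (items m n x))"

lemma U_measurable [measurable]: "U m n \<in> measurable M (count_space UNIV)"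
  unfolding U_def[abs_def] by measurable

lemma prob_chain: "prob {x \<in> space M. trim (run G w0 (items m n x)) = w} = pmf (chain n w0) w"
  using prob_items_in[of m n "{ys. trim (run G w0 ys) = w}"]
  by (simp add: chain_def pmf_map vimage_def)

text \<open>Only types of positive rate are listed, so that the whole block arrives with positive
  probability.\<close>

definition goods :: "'s list" where
  "goods = (SOME ss. set ss = {s. b s > 0})"

lemma set_goods: "set goods = {s. b s > 0}"
  unfolding goods_def by (rule someI_ex) (rule finite_list, simp)

text \<open>Stability for the singleton \<open>{c}\<close> forces positive total rate on the goods
  compatible with \<open>c\<close>.\<close>

lemma goods_serve: "\<exists>s\<in>set goods. (s, c) \<in> G"
proof (rule ccontr)
  assume "\<not> ?thesis"
  then have "sum b (compatible_goods G {c}) \<le> 0"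
    by (intro sum_nonpos) (auto simp: set_goods not_less)
  then show False using stable[of "{c}"] a_nonneg[of c] by simp
qed

text \<open>A flush forces every initial word onto the trajectory started from the empty word.\<close>

definition flushes :: "int \<Rightarrow> nat \<Rightarrow> 'w \<Rightarrow> bool" where
  "flushes m n x = flush G goods (\<lambda>i. z (m + int i) x) n"

lemma flushes_iff: "flushes m n x \<longleftrightarrow> U m n x = [] \<and> items (m + int n) (length goods) x = map Inr goods"
  by (simp add: flushes_def flush_def U_def items_def add.assoc)

lemma flushes_measurable [measurable]: "Measurable.pred M (flushes m n)"
  unfolding flushes_iff[abs_def] by measurable

text \<open>A later start from the empty word is dominated, so a flush of the earlier copy is one of
  the later copy. Conversely, infinitely many flushes of the later copy make both copies agree from
  some time on. The event therefore does not depend on the starting position.\<close>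

lemma flushes_shift:
  "(\<exists>\<^sub>\<infinity>n. flushes m n x) \<longleftrightarrow> (\<exists>\<^sub>\<infinity>n. flushes (m + int k) n x)"
proof
  assume inf: "\<exists>\<^sub>\<infinity>n. flushes m n x"
  show "\<exists>\<^sub>\<infinity>n. flushes (m + int k) n x"
    unfolding INFM_nat_le
  proof
    fix l
    obtain n where n: "n \<ge> k + l" "flushes m n x" using inf unfolding INFM_nat_le by blast
    define n' where "n' = n - k"
    have n': "n = k + n'" "n' \<ge> l" using n(1) by (auto simp: n'_def)
    have "trim (run G (run G [] (items m k x)) (items (m + int k) n' x)) = []"
      using n(2) by (simp add: flushes_iff U_def n' items_add)
    then have "U (m + int k) n' x = []" unfolding U_def by (rule trim_run_empty)
    then have "flushes (m + int k) n' x" using n(2) n'(1) by (simp add: flushes_iff add.assoc)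
    then show "\<exists>n\<ge>l. flushes (m + int k) n x" using n'(2) by blast
  qed
next
  assume inf: "\<exists>\<^sub>\<infinity>n. flushes (m + int k) n x"
  obtain n0 where n0: "\<forall>n\<ge>n0. run G (run G [] (items m k x)) (items (m + int k) n x) =
      replicate k None @ run G [] (items (m + int k) n x)"
    using eventually_coupled[OF goods_serve, of "\<lambda>i. z (m + int k + int i) x" "run G [] (items m k x)"] inf
    by (auto simp: flushes_def items_def)
  show "\<exists>\<^sub>\<infinity>n. flushes m n x"
    unfolding INFM_nat_le
  proof
    fix l
    obtain n where n: "n \<ge> max l n0" "flushes (m + int k) n x" using inf unfolding INFM_nat_le by blast
    then have "U m (k + n) x = U (m + int k) n x"
      using n0 by (simp add: U_def items_add)
    then have "flushes m (k + n) x" using n(2) by (simp add: flushes_iff add.assoc)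
    then show "\<exists>n\<ge>l. flushes m n x" using n(1) by (intro exI[of _ "k + n"]) auto
  qed
qed

lemma coupled:
  assumes "\<exists>\<^sub>\<infinity>n. flushes m n x"
  shows "\<forall>\<^sub>F n in sequentially. trim (run G w (items m n x)) = U m n x"
proof -
  obtain n0 where "\<forall>n\<ge>n0. run G w (items m n x) = replicate (length w) None @ run G [] (items m n x)"
    using eventually_coupled[OF goods_serve, of "\<lambda>i. z (m + int i) x" w] assms
    by (auto simp: flushes_def items_def)
  then show ?thesis unfolding eventually_sequentially U_def by (intro exI[of _ n0]) auto
qed

section \<open>Tail events of the items and recurrence of flushes\<close>

definition future :: "nat \<Rightarrow> 'w measure" where
  "future m = sigma (space M) (\<Union>i\<in>{m..}. sets (vimage_algebra (space M) (z (int i)) (count_space UNIV)))"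

lemma future_sub:
  "(\<Union>i\<in>I. sets (vimage_algebra (space M) (z (int i)) (count_space UNIV))) \<subseteq> Pow (space M)"
  using sets.space_closed[of "vimage_algebra (space M) (z (int i)) (count_space UNIV)" for i] by fastforce

lemma space_future [simp]: "space (future m) = space M"
  unfolding future_def by (rule space_measure_of[OF future_sub])

lemma sets_future: "sets (future m) = sigma_sets (space M)
    (\<Union>i\<in>{m..}. sets (vimage_algebra (space M) (z (int i)) (count_space UNIV)))"
  unfolding future_def by (rule sets_measure_of[OF future_sub])

lemma z_future [measurable]:
  assumes "i \<ge> m"
  shows "z (int i) \<in> measurable (future m) (count_space UNIV)"
proof (rule measurableI)
  fix X :: "('c + 's) set"
  have "z (int i) -` X \<inter> space M \<in> sets (vimage_algebra (space M) (z (int i)) (count_space UNIV))"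
    by (rule in_vimage_algebra) simp
  then show "z (int i) -` X \<inter> space (future m) \<in> sets (future m)"
    using assms unfolding sets_future space_future by (intro sigma_sets.Basic) auto
qed simp

lemma items_future [measurable]:
  assumes "k \<ge> m"
  shows "items (int k) n \<in> measurable (future m) (count_space UNIV)"
proof -
  have "z (int k + int i) \<in> measurable (future m) (count_space UNIV)" for i
    using z_future[of m "k + i"] assms by simp
  then show ?thesis unfolding items_def[abs_def] by (intro measurable_map_list)
qed

lemma U_future [measurable]: "k \<ge> m \<Longrightarrow> U (int k) n \<in> measurable (future m) (count_space UNIV)"
  unfolding U_def[abs_def]
  by (rule measurable_compose[OF items_future, where g = "\<lambda>ys. trim (run G [] ys)"]) auto

lemma flushes_future:
  assumes "k \<ge> m"
  shows "Measurable.pred (future m) (flushes (int k) n)"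
proof -
  have [measurable]: "U (int k) n \<in> measurable (future m) (count_space UNIV)"
    "items (int k + int n) (length goods) \<in> measurable (future m) (count_space UNIV)"
    using items_future[of m "k + n"] assms by (auto intro: U_future)
  show ?thesis unfolding flushes_iff[abs_def] by measurable
qed

text \<open>\<open>P m\<close> is a description of the same event in terms of the items from
  \<open>m\<close> on; having one for every \<open>m\<close> makes it a tail event.\<close>

lemma zero_one:
  assumes same: "\<And>m x. x \<in> space M \<Longrightarrow> P m x \<longleftrightarrow> P 0 x"
    and future: "\<And>m. {x \<in> space M. P m x} \<in> sets (future m)"
  shows "(AE x in M. P 0 x) \<or> (AE x in M. \<not> P 0 x)"
proof -
  let ?A = "\<lambda>i::nat. sets (vimage_algebra (space M) (z (int i)) (count_space UNIV))"
  have A: "?A i = {z (int i) -` X \<inter> space M | X. X \<in> sets (count_space UNIV)}" for i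
    by (rule sets_vimage_algebra2) auto
  have ind: "indep_sets ?A UNIV"
  proof (rule indep_setsI)
    show "?A i \<subseteq> events" for i by (auto simp: A)
    fix X :: "nat \<Rightarrow> 'w set" and J assume J: "J \<noteq> {}" "finite J" "\<forall>j\<in>J. X j \<in> ?A j"
    then have "\<forall>j\<in>J. \<exists>Y. X j = z (int j) -` Y \<inter> space M" by (auto simp: A)
    then obtain Y where Y: "\<And>j. j \<in> J \<Longrightarrow> X j = z (int j) -` Y j \<inter> space M" by metis
    have "(\<Inter>j\<in>J. X j) = (\<Inter>i\<in>int ` J. z i -` Y (nat i) \<inter> space M)" using Y by simp
    also have "prob \<dots> = (\<Prod>i\<in>int ` J. prob (z i -` Y (nat i) \<inter> space M))"
      by (rule indep_varsD[OF indep]) (use J in auto)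
    also have "\<dots> = (\<Prod>j\<in>J. prob (X j))"
      using Y by (simp add: prod.reindex)
    finally show "prob (\<Inter>j\<in>J. X j) = (\<Prod>j\<in>J. prob (X j))" .
  qed
  have ev: "{x \<in> space M. P 0 x} \<in> tail_events ?A"
    unfolding tail_events_def
  proof
    fix m
    have "{x \<in> space M. P 0 x} = {x \<in> space M. P m x}" using same by auto
    also have "\<dots> \<in> sigma_sets (space M) (\<Union> (?A ` {m..}))"
      using future[of m] by (simp add: sets_future)
    finally show "{x \<in> space M. P 0 x} \<in> sigma_sets (space M) (\<Union> (?A ` {m..}))" .
  qed
  have sa: "sigma_algebra (space M) (?A i)" for i
    using sets.sigma_algebra_axioms[of "vimage_algebra (space M) (z (int i)) (count_space UNIV)"] by simp
  have events: "{x \<in> space M. P 0 x} \<in> events"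
  proof -
    have "tail_events ?A \<subseteq> events"
      by (rule tail_events_sets) (auto simp: A)
    then show ?thesis using ev by blast
  qed
  from kolmogorov_0_1_law[OF sa ind ev] show ?thesis
    using events by (auto simp: prob_eq_0 prob_Collect_eq_1)
qed

text \<open>Every time \<open>n\<close> is a flush with probability at least
  \<open>\<delta>\<close>: the word is empty with probability at least \<open>1 / Wtot\<close>, and
  the block of goods that has to follow is independent of it. Continuity from above gives
  probability at least \<open>\<delta>\<close> to infinitely many flushes, and the 0-1 law raises it
  to 1.\<close>

lemma flushes_infinitely_often: "AE x in M. \<exists>\<^sub>\<infinity>n. flushes 0 n x"
proof -
  let ?P = "\<lambda>m::nat. \<lambda>x. \<exists>\<^sub>\<infinity>n. flushes (int m) n x"
  define \<delta> where "\<delta> = 1 / Wtot * prod_list (map pr (map Inr goods))"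
  have "prod_list (map pr (map Inr ss)) > 0" if "set ss \<subseteq> {s. b s > 0}" for ss :: "'s list"
    using that by (induction ss) auto
  then have \<delta>: "\<delta> > 0" using Wtot_pos set_goods by (simp add: \<delta>_def)
  have ge: "prob {x \<in> space M. flushes 0 n x} \<ge> \<delta>" for n
  proof -
    have "prob {x \<in> space M. flushes 0 n x} =
        prob {x \<in> space M. items 0 n x \<in> {ys. trim (run G [] ys) = []} \<and>
          items (0 + int n) (length (map Inr goods :: ('c + 's) list)) x = map Inr goods}"
      by (simp add: flushes_iff U_def)
    also have "\<dots> = pmf (chain n []) [] * prod_list (map pr (map Inr goods))"
      by (subst prob_items_then) (simp add: prob_chain)
    finally show ?thesis
      unfolding \<delta>_def by (simp only:) (intro mult_right_mono chain_empty_ge prod_list_nonneg, auto simp: b_nonneg)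
  qed
  have "(AE x in M. ?P 0 x) \<or> (AE x in M. \<not> ?P 0 x)"
  proof (rule zero_one[of ?P])
    show "?P m x \<longleftrightarrow> ?P 0 x" for m x using flushes_shift[of 0 x m] by simp
    show "{x \<in> space M. ?P m x} \<in> sets (future m)" for m
    proof -
      have [measurable]: "Measurable.pred (future m) (flushes (int m) n)" for n
        by (rule flushes_future) simp
      have "Measurable.pred (future m) (?P m)"
        unfolding INFM_nat_le by measurable
      then show ?thesis by (simp add: pred_def)
    qed
  qed
  moreover have "\<not> (AE x in M. \<not> ?P 0 x)"
  proof
    assume not: "AE x in M. \<not> ?P 0 x"
    define F where "F k = {x \<in> space M. \<exists>n\<ge>k. flushes 0 n x}" for k :: nat
    have [measurable]: "F k \<in> events" for k unfolding F_def by measurable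
    have "(\<lambda>k. prob (F k)) \<longlonglongrightarrow> prob (\<Inter>k. F k)"
      by (rule finite_Lim_measure_decseq) (auto simp: decseq_def F_def intro: order_trans)
    moreover have "\<delta> \<le> prob (F k)" for k
      using ge[of k] by (rule order_trans) (auto intro!: finite_measure_mono simp: F_def)
    ultimately have "\<delta> \<le> prob (\<Inter>k. F k)" by (intro LIMSEQ_le_const) auto
    moreover have "prob (\<Inter>k. F k) = 0"
    proof -
      have "AE x in M. x \<notin> (\<Inter>k. F k)"
        using not by eventually_elim (auto simp: F_def INFM_nat_le)
      then show ?thesis by (simp add: prob_eq_0)
    qed
    ultimately show False using \<delta> by simp
  qed
  ultimately show ?thesis by simp
qed

text \<open>By coupling, the laws started from \<open>w0\<close> and from the empty word merge.
  Averaging \<open>w0\<close> over \<open>stat\<close> turns the first of them into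
  \<open>stat\<close> by invariance.\<close>

lemma chain_tendsto: "(\<lambda>n. pmf (chain n []) w) \<longlonglongrightarrow> pmf stat w"
proof -
  have 1: "(\<lambda>n. pmf (chain n w0) w - pmf (chain n []) w) \<longlonglongrightarrow> 0" for w0
  proof (rule Lim_null_comparison)
    let ?D = "\<lambda>n x. (trim (run G w0 (items 0 n x)) = w) \<noteq> (trim (run G [] (items 0 n x)) = w)"
    show "\<forall>\<^sub>F n in sequentially. norm (pmf (chain n w0) w - pmf (chain n []) w) \<le>
        prob {x \<in> space M. ?D n x}"
      unfolding prob_chain[of _ 0, symmetric] real_norm_def
      by (intro always_eventually allI prob_diff_le) measurable
    show "(\<lambda>n. prob {x \<in> space M. ?D n x}) \<longlonglongrightarrow> 0"
    proof (rule prob_tendsto_0)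
      show "AE x in M. \<forall>\<^sub>F n in sequentially. \<not> ?D n x"
        using flushes_infinitely_often
      proof eventually_elim
        case (elim x)
        from coupled[OF elim, of w0] show ?case
          by eventually_elim (simp add: U_def)
      qed
    qed measurable
  qed
  have "(\<lambda>n. measure_pmf.expectation stat (\<lambda>w0. pmf (chain n w0) w - pmf (chain n []) w)) \<longlonglongrightarrow>
      measure_pmf.expectation stat (\<lambda>_. 0)"
  proof (rule integral_dominated_convergence[where w = "\<lambda>_. 1"])
    have "norm (pmf P w - pmf Q w) \<le> 1" for P Q :: "'c word pmf"
      using pmf_le_1[of P w] pmf_le_1[of Q w] pmf_nonneg[of P w] pmf_nonneg[of Q w]
      unfolding real_norm_def by linarith
    then show "AE w0 in measure_pmf stat. norm (pmf (chain n w0) w - pmf (chain n []) w) \<le> 1" for n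
      by simp
  qed (use 1 in auto)
  moreover have "measure_pmf.expectation stat (\<lambda>w0. pmf (chain n w0) w - pmf (chain n []) w) =
      pmf stat w - pmf (chain n []) w" for n
  proof -
    have "integrable (measure_pmf stat) (\<lambda>w0. pmf (chain n w0) w)"
      by (rule measure_pmf.integrable_const_bound[where B = 1]) (auto simp: pmf_le_1)
    then have "measure_pmf.expectation stat (\<lambda>w0. pmf (chain n w0) w - pmf (chain n []) w) =
      pmf (bind_pmf stat (chain n)) w - pmf (chain n []) w"
      by (simp add: pmf_bind)
    then show ?thesis by (simp add: stat_chain)
  qed
  ultimately have "(\<lambda>n. pmf stat w - pmf (chain n []) w) \<longlonglongrightarrow> 0" by simp
  from tendsto_diff[OF tendsto_const[of "pmf stat w"] this] show ?thesis by simp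
qed

end

section \<open>The word of a matching\<close>

lemma kill_nth: "k < length w \<Longrightarrow> kill G s w ! k =
    (if serves G s (w ! k) \<and> (\<forall>k'<k. \<not> serves G s (w ! k')) then None else w ! k)"
proof (induction w arbitrary: k)
  case (Cons o' w)
  show ?case
  proof (cases k)
    case (Suc k')
    then show ?thesis using Cons by (auto simp: All_less_Suc2)
  qed simp
qed simp

lemma agents_trim [simp]: "agents (trim w) = agents w"
proof -
  obtain k where "w = replicate k None @ trim w" by (rule trim_decomp)
  moreover have "agents (replicate k None) = []" by (induction k) auto
  ultimately show ?thesis by (metis agents_append append_Nil)
qed

lemma agents_map: "agents (map (\<lambda>i. if P i then Some (f i) else None) l) = map f (filter P l)"
  by (induction l) auto

text \<open>The next good is of type \<open>s\<close> and takes an agent of type \<open>c\<close>; the word lists older agents first.\<close>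

definition hit :: "('s \<times> 'c) set \<Rightarrow> 's \<Rightarrow> 'c \<Rightarrow> 'c word \<Rightarrow> bool" where
  "hit G s c w \<longleftrightarrow> find (serves G s) w = Some (Some c)"

lemma hit_trim [simp]: "hit G s c (trim w) = hit G s c w"
proof -
  obtain k where "w = replicate k None @ trim w" by (rule trim_decomp)
  moreover have "find (serves G s) (replicate k None @ v) = find (serves G s) v" for v
    by (induction k) auto
  ultimately show ?thesis by (metis hit_def)
qed

lemma wait_trim [simp]: "wait c (trim w) = wait c w"
proof -
  obtain k where "w = replicate k None @ trim w" by (rule trim_decomp)
  moreover have "wait c (replicate k None @ v) = wait c v" for v
    by (induction k) (auto simp: wait_def)
  ultimately show ?thesis by metis
qed

lemma hit_iff: "hit G s c w \<longleftrightarrow>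
    (\<exists>k<length w. w ! k = Some c \<and> (s, c) \<in> G \<and> (\<forall>k'<k. \<not> serves G s (w ! k')))"
  unfolding hit_def find_Some_iff by (metis serves_simps(2))

text \<open>An older agent of type \<open>c\<close> would have been compatible as well, so the
  served agent is the oldest one of its type, and this is the one that \<open>wait\<close>
  measures.\<close>

lemma wait_at:
  assumes "k < length w" "w ! k = Some c" "(s, c) \<in> G" "\<forall>k'<k. \<not> serves G s (w ! k')"
  shows "wait c w = length w - k"
proof -
  have "w = take k w @ Some c # drop (Suc k) w"
    using assms(1,2) by (metis id_take_nth_drop)
  moreover have "Some c \<notin> set (take k w)"
    using assms by (auto simp: in_set_conv_nth)
  then have "dropWhile (\<lambda>o'. o' \<noteq> Some c) (take k w @ Some c # drop (Suc k) w) = Some c # drop (Suc k) w"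
    by (subst dropWhile_append2) auto
  ultimately have "wait c w = length (Some c # drop (Suc k) w)" unfolding wait_def by metis
  then show ?thesis using assms(1) by simp
qed

definition waiting :: "(int \<Rightarrow> 'c + 's) \<Rightarrow> (int \<times> int) set \<Rightarrow> int \<Rightarrow> int \<Rightarrow> bool" where
  "waiting x A N i \<longleftrightarrow> i < N \<and> isl (x i) \<and> \<not> (\<exists>n<N. (i, n) \<in> A)"

definition letter :: "(int \<Rightarrow> 'c + 's) \<Rightarrow> (int \<times> int) set \<Rightarrow> int \<Rightarrow> int \<Rightarrow> 'c option" where
  "letter x A N i = (if waiting x A N i then Some (projl (x i)) else None)"

definition window :: "(int \<Rightarrow> 'c + 's) \<Rightarrow> (int \<times> int) set \<Rightarrow> int \<Rightarrow> nat \<Rightarrow> 'c word" where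
  "window x A N j = map (\<lambda>i. letter x A N (N - int j + int i)) [0..<j]"

definition depth :: "(int \<Rightarrow> 'c + 's) \<Rightarrow> (int \<times> int) set \<Rightarrow> int \<Rightarrow> nat" where
  "depth x A N = (LEAST j. \<forall>i<N - int j. \<not> waiting x A N i)"

text \<open>Position \<open>N\<close> itself is excluded. If infinitely many agents are waiting, then the depth is the
  least element of an empty set and the word is meaningless.\<close>

definition waiting_word :: "(int \<Rightarrow> 'c + 's) \<Rightarrow> (int \<times> int) set \<Rightarrow> int \<Rightarrow> 'c word" where
  "waiting_word x A N = trim (window x A N (depth x A N))"

lemma length_window [simp]: "length (window x A N j) = j"
  by (simp add: window_def)

lemma window_nth: "k < j \<Longrightarrow> window x A N j ! k = letter x A N (N - int j + int k)"
  by (simp add: window_def)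

lemma window_extend:
  assumes "\<forall>i<N - int j. \<not> waiting x A N i"
  shows "window x A N (k + j) = replicate k None @ window x A N j"
proof (rule nth_equalityI)
  fix i assume i: "i < length (window x A N (k + j))"
  show "window x A N (k + j) ! i = (replicate k None @ window x A N j) ! i"
  proof (cases "i < k")
    case True
    then show ?thesis using assms i by (simp add: window_nth nth_append letter_def)
  next
    case False
    then show ?thesis using i by (simp add: window_nth nth_append algebra_simps of_nat_diff)
  qed
qed simp

lemma waiting_word_eq:
  assumes "\<forall>i<N - int j. \<not> waiting x A N i"
  shows "waiting_word x A N = trim (window x A N j)"
proof -
  have d: "\<forall>i<N - int (depth x A N). \<not> waiting x A N i"
    unfolding depth_def by (rule LeastI) fact
  have "depth x A N \<le> j" unfolding depth_def by (rule Least_le) fact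
  then show ?thesis
    using window_extend[OF d, of "j - depth x A N"] by (simp add: waiting_word_def)
qed

lemma trim_waiting_word [simp]: "trim (waiting_word x A N) = waiting_word x A N"
  by (simp add: waiting_word_def)

locale good_path =
  fixes G :: "('s \<times> 'c::finite) set" and x :: "int \<Rightarrow> 'c + 's" and A :: "(int \<times> int) set"
  assumes fcfs: "directed_fcfs_matching G x A" and complete: "all_agents_matched x A"
begin

lemma A_items: "(m, n) \<in> A \<Longrightarrow> \<exists>c s. x m = Inl c \<and> x n = Inr s"
  using fcfs unfolding directed_fcfs_matching_def by blast

lemma A_unique: "(m, n) \<in> A \<Longrightarrow> (m', n) \<in> A \<Longrightarrow> m = m'"
  "(m, n) \<in> A \<Longrightarrow> (m, n') \<in> A \<Longrightarrow> n = n'"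
  using fcfs unfolding directed_fcfs_matching_def by blast+

lemma A_iff: "x m = Inl c \<Longrightarrow> x n = Inr s \<Longrightarrow> (m, n) \<in> A \<longleftrightarrow>
   m < n \<and> (s, c) \<in> G \<and>
   (\<forall>k<m. \<forall>c'. x k = Inl c' \<and> (s, c') \<in> G \<longrightarrow> (\<exists>l<n. (k, l) \<in> A)) \<and>
   \<not> (\<exists>l<n. (m, l) \<in> A)"
  using fcfs unfolding directed_fcfs_matching_def by blast

lemma A_less: "(m, n) \<in> A \<Longrightarrow> m < n"
  using A_items[of m n] A_iff[of m _ n] by blast

lemma serves_letter: "serves G s (letter x A N i) \<longleftrightarrow> waiting x A N i \<and> (\<exists>c. x i = Inl c \<and> (s, c) \<in> G)"
  by (auto simp: letter_def serves_def waiting_def split: if_splits elim: sum.collapse(1)[symmetric])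

text \<open>This is the link to \<open>kill\<close>: the matching rule at a good singles out the
  leftmost letter that the good serves.\<close>

lemma A_waiting_iff:
  assumes "x N = Inr s"
  shows "(i, N) \<in> A \<longleftrightarrow> serves G s (letter x A N i) \<and> (\<forall>k<i. \<not> serves G s (letter x A N k))"
proof
  assume iN: "(i, N) \<in> A"
  then obtain c where c: "x i = Inl c" using A_items by blast
  have *: "i < N" "(s, c) \<in> G" "\<forall>k<i. \<forall>c'. x k = Inl c' \<and> (s, c') \<in> G \<longrightarrow> (\<exists>l<N. (k, l) \<in> A)"
    "\<not> (\<exists>l<N. (i, l) \<in> A)"
    using iN A_iff[OF c assms] by blast+
  then show "serves G s (letter x A N i) \<and> (\<forall>k<i. \<not> serves G s (letter x A N k))"
    unfolding serves_letter using c by (auto simp: waiting_def)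
next
  assume *: "serves G s (letter x A N i) \<and> (\<forall>k<i. \<not> serves G s (letter x A N k))"
  then obtain c where c: "x i = Inl c" "(s, c) \<in> G" "waiting x A N i"
    unfolding serves_letter by blast
  have "\<exists>l<N. (k, l) \<in> A" if "k < i" "x k = Inl c'" "(s, c') \<in> G" for k c'
    using * that c(3) unfolding serves_letter by (auto simp: waiting_def)
  then show "(i, N) \<in> A" unfolding A_iff[OF c(1) assms] using c by (auto simp: waiting_def)
qed

text \<open>If infinitely many agents of one type were waiting, one of them, at \<open>m\<close>,
  would be matched at some \<open>n\<close>. The rule then requires all older ones of that type to
  be matched before \<open>n\<close>, hence in \<open>{N..<n}\<close>, as they are still waiting at
  \<open>N\<close>. Infinitely many agents would share finitely many goods.\<close>

lemma finitely_many_waiting: "\<exists>j. \<forall>i<N - int j. \<not> waiting x A N i"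
proof -
  let ?S = "\<lambda>c. {i. waiting x A N i \<and> x i = Inl c}"
  have "finite (?S c)" for c
  proof (rule ccontr)
    assume inf: "infinite (?S c)"
    then have "?S c \<noteq> {}" by (rule infinite_imp_nonempty)
    then obtain m where m: "m \<in> ?S c" by blast
    then obtain n where n: "(m, n) \<in> A" using complete unfolding all_agents_matched_def by blast
    then obtain s where s: "x n = Inr s" using A_items by blast
    have mc: "x m = Inl c" using m by simp
    have Am: "(s, c) \<in> G" "\<forall>k<m. \<forall>c'. x k = Inl c' \<and> (s, c') \<in> G \<longrightarrow> (\<exists>l<n. (k, l) \<in> A)"
      using n A_iff[OF mc s] by blast+
    let ?B = "{k \<in> ?S c. k < m}"
    have sub: "?S c \<subseteq> ?B \<union> {m..<N}" by (auto simp: waiting_def)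
    have infB: "infinite ?B"
    proof
      assume "finite ?B"
      then have "finite (?B \<union> {m..<N})" by simp
      from finite_subset[OF sub this] show False using inf by contradiction
    qed
    have "\<exists>l. (k, l) \<in> A \<and> l \<in> {N..<n}" if "k \<in> ?B" for k
    proof -
      have "\<exists>l<n. (k, l) \<in> A" using that Am by auto
      then obtain l where l: "l < n" "(k, l) \<in> A" by blast
      then have "N \<le> l" using that by (auto simp: waiting_def not_less)
      then show ?thesis using l by auto
    qed
    then obtain l where l: "\<And>k. k \<in> ?B \<Longrightarrow> (k, l k) \<in> A \<and> l k \<in> {N..<n}" by metis
    have "inj_on l ?B" using l A_unique(1) by (intro inj_onI) metis
    moreover have "l ` ?B \<subseteq> {N..<n}" using l by blast
    ultimately have "finite ?B" by (rule inj_on_finite) simp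
    then show False using infB by contradiction
  qed
  then have "finite (\<Union>c. ?S c)" by simp
  moreover have "{i. waiting x A N i} \<subseteq> (\<Union>c. ?S c)"
    by (auto simp: waiting_def) (metis sum.collapse(1))
  ultimately have fin: "finite {i. waiting x A N i}" by (rule finite_subset[rotated])
  then obtain L where L: "\<And>i. waiting x A N i \<Longrightarrow> L \<le> i"
    using bdd_below_finite[of "{i. waiting x A N i}"] unfolding bdd_below_def by auto
  show ?thesis
  proof (intro exI allI impI notI)
    fix i assume "i < N - int (nat (N - L))" "waiting x A N i"
    then show False using L[of i] by (cases "L \<le> N") auto
  qed
qed

lemma waiting_Suc: "i < N \<Longrightarrow> waiting x A (N + 1) i \<longleftrightarrow> waiting x A N i \<and> (i, N) \<notin> A"
  by (auto simp: waiting_def order_le_less)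

text \<open>The window has to reach back beyond all waiting agents; otherwise the good at
  \<open>N\<close> could take an agent outside it while \<open>kill\<close> blanks a letter
  inside.\<close>

lemma window_Suc:
  assumes "\<forall>i<N - int j. \<not> waiting x A N i"
  shows "window x A (N + 1) (Suc j) = arrive G (window x A N j) (x N)"
proof (rule nth_equalityI)
  fix k assume "k < length (window x A (N + 1) (Suc j))"
  then have k: "k \<le> j" by simp
  have l: "window x A (N + 1) (Suc j) ! k = letter x A (N + 1) (N - int j + int k)"
    using k by (simp add: window_nth)
  have noN: "\<not> (\<exists>n<N + 1. (N, n) \<in> A)" using A_less by fastforce
  show "window x A (N + 1) (Suc j) ! k = arrive G (window x A N j) (x N) ! k"
  proof (cases "k = j")
    case True
    then show ?thesis unfolding l using noN
      by (cases "x N") (auto simp: nth_append letter_def waiting_def)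
  next
    case False
    then have k: "k < j" using k by simp
    let ?i = "N - int j + int k"
    have i: "?i < N" using k by simp
    show ?thesis
    proof (cases "x N")
      case (Inl c)
      then have "(?i, N) \<notin> A" using A_items by fastforce
      then show ?thesis unfolding l using k Inl i
        by (simp add: nth_append window_nth letter_def waiting_Suc)
    next
      case (Inr s)
      have "(?i, N) \<in> A \<longleftrightarrow> serves G s (window x A N j ! k) \<and> (\<forall>k'<k. \<not> serves G s (window x A N j ! k'))"
        unfolding A_waiting_iff[OF Inr]
      proof (intro conj_cong iffI allI impI)
        fix k' assume "\<forall>i<?i. \<not> serves G s (letter x A N i)" "k' < k"
        then show "\<not> serves G s (window x A N j ! k')" using k by (simp add: window_nth)
      next
        fix i assume *: "\<forall>k'<k. \<not> serves G s (window x A N j ! k')" "i < ?i"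
        show "\<not> serves G s (letter x A N i)"
        proof (cases "i < N - int j")
          case True
          then show ?thesis using assms by (simp add: letter_def)
        next
          case False
          define k' where "k' = nat (i - (N - int j))"
          have "k' < k" "i = N - int j + int k'" using False *(2) by (auto simp: k'_def)
          then show ?thesis using *(1) k by (auto simp: window_nth)
        qed
      qed (use k in \<open>simp_all add: window_nth\<close>)
      then show ?thesis unfolding l using k Inr i
        by (simp add: nth_append kill_nth window_nth letter_def waiting_Suc)
    qed
  qed
qed simp

lemma waiting_word_Suc: "waiting_word x A (N + 1) = trim (arrive G (waiting_word x A N) (x N))"
proof -
  obtain j where j: "\<forall>i<N - int j. \<not> waiting x A N i" using finitely_many_waiting by blast
  then have "\<forall>i<N + 1 - int (Suc j). \<not> waiting x A (N + 1) i"
    using waiting_Suc[of _ N] by auto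
  then have "waiting_word x A (N + 1) = trim (window x A (N + 1) (Suc j))" by (rule waiting_word_eq)
  then show ?thesis unfolding window_Suc[OF j] waiting_word_eq[OF j] by (simp add: trim_arrive)
qed

lemma waiting_word_run:
  "waiting_word x A (N + int n) = trim (run G (waiting_word x A N) (map (\<lambda>i. x (N + int i)) [0..<n]))"
proof (induction n)
  case (Suc n)
  have "waiting_word x A (N + int (Suc n)) = waiting_word x A (N + int n + 1)"
    by (simp add: add.commute add.left_commute)
  also have "\<dots> = trim (arrive G (waiting_word x A (N + int n)) (x (N + int n)))"
    by (rule waiting_word_Suc)
  also have "\<dots> = trim (run G (waiting_word x A N) (map (\<lambda>i. x (N + int i)) [0..<Suc n]))"
    unfolding Suc by (simp add: trim_arrive)
  finally show ?case .
qed simp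

text \<open>\<open>unmatched_agents\<close> includes position \<open>N\<close>, whereas the word at
  \<open>N\<close> stops before it; hence the shift to \<open>N + 1\<close>.\<close>

lemma unmatched_agents_eq: "unmatched_agents x A N = agents (waiting_word x A (N + 1))"
proof -
  obtain j where j: "\<forall>i<N + 1 - int j. \<not> waiting x A (N + 1) i" using finitely_many_waiting by blast
  define l where "l = map (\<lambda>i. N + 1 - int j + int i) [0..<j]"
  have set_l: "set l = {N + 1 - int j..<N + 1}"
  proof -
    have "y \<in> set l" if "y \<in> {N + 1 - int j..<N + 1}" for y
      using that by (auto simp: l_def intro!: image_eqI[of _ _ "nat (y - (N + 1 - int j))"])
    then show ?thesis by (auto simp: l_def)
  qed
  have "{m. m \<le> N \<and> isl (x m) \<and> \<not> (\<exists>n\<le>N. (m, n) \<in> A)} = {m. waiting x A (N + 1) m}"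
    by (auto simp: waiting_def zless_add1_eq order_le_less)
  also have "\<dots> = set (filter (waiting x A (N + 1)) l)"
    using j by (auto simp: set_l waiting_def) (metis not_less waiting_def)
  finally have *: "{m. m \<le> N \<and> isl (x m) \<and> \<not> (\<exists>n\<le>N. (m, n) \<in> A)} =
      set (filter (waiting x A (N + 1)) l)" .
  have "sorted l" "distinct l"
    by (auto simp: l_def sorted_map distinct_map inj_on_def sorted_wrt_upt intro: sorted_wrt_mono_rel[OF _ sorted_wrt_upt])
  then have "sorted_list_of_set (set (filter (waiting x A (N + 1)) l)) = filter (waiting x A (N + 1)) l"
    by (intro sorted_list_of_set.idem_if_sorted_distinct) (auto intro: sorted_filter[of id, simplified])
  then have "unmatched_agents x A N = map (\<lambda>m. projl (x m)) (filter (waiting x A (N + 1)) l)"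
    unfolding unmatched_agents_def * by simp
  also have "\<dots> = agents (map (letter x A (N + 1)) l)"
    unfolding letter_def[abs_def] agents_map ..
  also have "map (letter x A (N + 1)) l = window x A (N + 1) j"
    by (simp add: l_def window_def)
  also have "agents (window x A (N + 1) j) = agents (waiting_word x A (N + 1))"
    by (simp add: waiting_word_eq[OF j])
  finally show ?thesis .
qed

lemma matched_to_iff: "matched_to x A s c n \<longleftrightarrow> x n = Inr s \<and> hit G s c (waiting_word x A n)"
  and delay_eq: "matched_to x A s c n \<Longrightarrow> delay A n = wait c (waiting_word x A n)"
proof -
  obtain j where j: "\<forall>i<n - int j. \<not> waiting x A n i" using finitely_many_waiting by blast
  let ?w = "window x A n j"
  have ww: "waiting_word x A n = trim ?w" by (rule waiting_word_eq[OF j])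
  have fwd: "\<exists>k<j. ?w ! k = Some c \<and> (s, c) \<in> G \<and> (\<forall>k'<k. \<not> serves G s (?w ! k')) \<and> m = n - int j + int k"
    if s: "x n = Inr s" and mn: "(m, n) \<in> A" and c: "x m = Inl c" for m
  proof -
    have sv: "serves G s (letter x A n m)" "\<forall>k<m. \<not> serves G s (letter x A n k)"
      using mn unfolding A_waiting_iff[OF s] by blast+
    then have wm: "waiting x A n m" "(s, c) \<in> G" unfolding serves_letter using c by auto
    then have "n - int j \<le> m" "m < n" using j by (meson not_less, simp add: waiting_def)
    then obtain k where k: "m = n - int j + int k" "k < j"
      by (intro that[of "nat (m - (n - int j))"]) auto
    then show ?thesis using sv(2) wm c
      by (intro exI[of _ k]) (auto simp: window_nth letter_def)
  qed
  show "matched_to x A s c n \<longleftrightarrow> x n = Inr s \<and> hit G s c (waiting_word x A n)"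
  proof
    assume "matched_to x A s c n"
    then obtain m where m: "x n = Inr s" "(m, n) \<in> A" "x m = Inl c" unfolding matched_to_def by blast
    obtain k where "k < j" "?w ! k = Some c" "(s, c) \<in> G" "\<forall>k'<k. \<not> serves G s (?w ! k')"
      using fwd[OF m] by blast
    then have "hit G s c ?w" unfolding hit_iff length_window by blast
    then show "x n = Inr s \<and> hit G s c (waiting_word x A n)" using m(1) by (simp add: ww)
  next
    assume *: "x n = Inr s \<and> hit G s c (waiting_word x A n)"
    then have "hit G s c ?w" by (simp add: ww)
    then obtain k where k: "k < j" "?w ! k = Some c" "(s, c) \<in> G" "\<forall>k'<k. \<not> serves G s (?w ! k')"
      unfolding hit_iff length_window by blast
    let ?i = "n - int j + int k"
    have li: "letter x A n ?i = Some c" using k(1,2) by (simp add: window_nth)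
    then have xi: "x ?i = Inl c"
      by (auto simp: letter_def waiting_def split: if_splits)
    have "\<not> serves G s (letter x A n i)" if "i < ?i" for i
    proof (cases "i < n - int j")
      case True
      then show ?thesis using j by (simp add: letter_def)
    next
      case False
      define k' where "k' = nat (i - (n - int j))"
      have "k' < k" "i = n - int j + int k'" using False that by (auto simp: k'_def)
      then show ?thesis using k(1,4) by (auto simp: window_nth)
    qed
    then have "(?i, n) \<in> A" using * li k(3) by (subst A_waiting_iff[of _ s]) auto
    then show "matched_to x A s c n" using * xi unfolding matched_to_def by blast
  qed
  assume "matched_to x A s c n"
  then obtain m where m: "x n = Inr s" "(m, n) \<in> A" "x m = Inl c" unfolding matched_to_def by blast
  obtain k where k: "k < j" "?w ! k = Some c" "(s, c) \<in> G" "\<forall>k'<k. \<not> serves G s (?w ! k')"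
      "m = n - int j + int k"
    using fwd[OF m] by blast
  have "delay A n = j - k"
    unfolding delay_def
  proof (rule Least_equality)
    show "(n - int (j - k), n) \<in> A" using m(2) k(1,5) by (simp add: of_nat_diff algebra_simps)
    fix d assume "(n - int d, n) \<in> A"
    then have "n - int d = m" using A_unique(1) m(2) by blast
    then show "j - k \<le> d" using k(1,5) by simp
  qed
  also have "\<dots> = wait c ?w" using wait_at[OF _ k(2,3,4)] k(1) by simp
  finally show "delay A n = wait c (waiting_word x A n)" by (simp add: ww)
qed

end

lemma waiting_word_shift:
  "waiting_word (\<lambda>n. x (n + i)) {q. (case q of (m, n) \<Rightarrow> (m + i, n + i) \<in> A)} N = waiting_word x A (N + i)"
proof -
  let ?x = "\<lambda>n. x (n + i)" and ?A = "{q. (case q of (m, n) \<Rightarrow> (m + i, n + i) \<in> A)}"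
  have w: "waiting ?x ?A N k \<longleftrightarrow> waiting x A (N + i) (k + i)" for k
  proof -
    have "(\<exists>n<N. (k, n) \<in> ?A) \<longleftrightarrow> (\<exists>n<N + i. (k + i, n) \<in> A)"
    proof
      assume "\<exists>n<N + i. (k + i, n) \<in> A"
      then obtain n where "n < N + i" "(k + i, n) \<in> A" by blast
      then show "\<exists>n<N. (k, n) \<in> ?A" by (intro exI[of _ "n - i"]) auto
    next
      assume "\<exists>n<N. (k, n) \<in> ?A"
      then obtain n where "n < N" "(k + i, n + i) \<in> A" by auto
      then show "\<exists>n<N + i. (k + i, n) \<in> A" by (intro exI[of _ "n + i"]) auto
    qed
    then show ?thesis by (simp add: waiting_def)
  qed
  have l: "letter ?x ?A N k = letter x A (N + i) (k + i)" for k
    by (simp add: letter_def w)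
  have win: "window ?x ?A N j = window x A (N + i) j" for j
    by (simp add: window_def l algebra_simps)
  have "(\<forall>k<N - int j. \<not> waiting ?x ?A N k) \<longleftrightarrow> (\<forall>k<N + i - int j. \<not> waiting x A (N + i) k)" for j
  proof
    assume *: "\<forall>k<N - int j. \<not> waiting ?x ?A N k"
    show "\<forall>k<N + i - int j. \<not> waiting x A (N + i) k"
    proof (intro allI impI)
      fix k assume "k < N + i - int j"
      then show "\<not> waiting x A (N + i) k" using *[rule_format, of "k - i"] unfolding w by simp
    qed
  qed (simp add: w)
  then have "depth ?x ?A N = depth x A (N + i)" unfolding depth_def by presburger
  then show ?thesis by (simp add: waiting_word_def win)
qed

section \<open>Law of the waiting word\<close>

text \<open>The space on which \<open>stationary_matching\<close> states invariance. An event has to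
  be phrased as a measurable condition on it before it can be translated.\<close>

definition paths :: "((int \<Rightarrow> 'c + 's) \<times> (int \<times> int \<Rightarrow> bool)) measure" where
  "paths = (\<Pi>\<^sub>M n\<in>(UNIV :: int set). count_space UNIV) \<Otimes>\<^sub>M
           (\<Pi>\<^sub>M p\<in>(UNIV :: (int \<times> int) set). count_space UNIV)"

lemma paths_fst [measurable]: "(\<lambda>q. fst q n) \<in> measurable paths (count_space UNIV)"
  unfolding paths_def
  by (rule measurable_compose[OF measurable_fst measurable_component_singleton]) simp

lemma paths_snd [measurable]: "(\<lambda>q. snd q p) \<in> measurable paths (count_space UNIV)"
  unfolding paths_def
  by (rule measurable_compose[OF measurable_snd measurable_component_singleton]) simp

definition path_word :: "int \<Rightarrow> (int \<Rightarrow> 'c + 's) \<times> (int \<times> int \<Rightarrow> bool) \<Rightarrow> 'c word" where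
  "path_word N q = waiting_word (fst q) {p. snd q p} N"

lemma path_word_measurable [measurable]:
  "(path_word N :: (int \<Rightarrow> 'c::finite + 's::finite) \<times> _ \<Rightarrow> _) \<in> measurable paths (count_space UNIV)"
proof -
  have [measurable]: "Measurable.pred paths (\<lambda>q :: (int \<Rightarrow> 'c + 's) \<times> _. waiting (fst q) {p. snd q p} N i)" for i
  proof -
    have [measurable]: "Measurable.pred paths (\<lambda>q :: (int \<Rightarrow> 'c + 's) \<times> (int \<times> int \<Rightarrow> bool). isl (fst q i))"
      by (rule measurable_compose[OF paths_fst]) simp
    show ?thesis unfolding waiting_def mem_Collect_eq by measurable
  qed
  have [measurable]: "(\<lambda>q :: (int \<Rightarrow> 'c + 's) \<times> _. letter (fst q) {p. snd q p} N i) \<in> measurable paths (count_space UNIV)" for i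
  proof -
    have [measurable]: "(\<lambda>q :: (int \<Rightarrow> 'c + 's) \<times> (int \<times> int \<Rightarrow> bool). Some (projl (fst q i))) \<in> measurable paths (count_space UNIV)"
      by (rule measurable_compose[OF paths_fst]) simp
    show ?thesis unfolding letter_def by measurable
  qed
  have "(\<lambda>q :: (int \<Rightarrow> 'c + 's) \<times> _. window (fst q) {p. snd q p} N j) \<in> measurable paths (count_space UNIV)" for j
    unfolding window_def by (rule measurable_map_list) measurable
  then have 1: "(\<lambda>q :: (int \<Rightarrow> 'c + 's) \<times> _. trim (window (fst q) {p. snd q p} N j)) \<in> measurable paths (count_space UNIV)" for j
    by (rule measurable_compose) simp
  have 2: "(\<lambda>q :: (int \<Rightarrow> 'c + 's) \<times> _. depth (fst q) {p. snd q p} N) \<in> measurable paths (count_space UNIV)"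
    unfolding depth_def by measurable
  show ?thesis
    unfolding path_word_def[abs_def] waiting_word_def
    by (rule measurable_compose_countable[OF 1 2])
qed

locale matching_seq = item_seq M G a b z
  for M :: "'w measure" and G :: "('s::finite \<times> 'c::finite) set" and a b and z :: "int \<Rightarrow> 'w \<Rightarrow> 'c + 's" +
  fixes A :: "'w \<Rightarrow> (int \<times> int) set"
  assumes fcfs: "AE x in M. directed_fcfs_matching G (\<lambda>i. z i x) (A x)"
    and complete: "AE x in M. all_agents_matched (\<lambda>i. z i x) (A x)"
    and stationary: "stationary_matching M z A"
begin

lemma good: "AE x in M. good_path G (\<lambda>i. z i x) (A x)"
  using fcfs complete by eventually_elim (simp add: good_path_def)

lemma A_measurable: "{x \<in> space M. (m, n) \<in> A x} \<in> events"
  using stationary by (simp add: stationary_matching_def)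

definition shifted :: "int \<Rightarrow> 'w \<Rightarrow> (int \<Rightarrow> 'c + 's) \<times> (int \<times> int \<Rightarrow> bool)" where
  "shifted i x = (\<lambda>n. z (n + i) x, \<lambda>(m, n). (m + i, n + i) \<in> A x)"

lemma shifted_measurable [measurable]: "shifted i \<in> measurable M paths"
  unfolding shifted_def[abs_def] paths_def
proof (rule measurable_Pair)
  show "(\<lambda>x n. z (n + i) x) \<in> measurable M (\<Pi>\<^sub>M n\<in>UNIV. count_space UNIV)"
    by (rule measurable_PiM_single') auto
  show "(\<lambda>x. \<lambda>(m, n). (m + i, n + i) \<in> A x) \<in> measurable M (\<Pi>\<^sub>M p\<in>UNIV. count_space UNIV)"
  proof (rule measurable_PiM_single')
    fix p :: "int \<times> int"
    show "(\<lambda>x. (\<lambda>(m, n). (m + i, n + i) \<in> A x) p) \<in> measurable M (count_space UNIV)"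
      using A_measurable[of "fst p + i" "snd p + i"] by (cases p) (simp add: pred_def)
  qed auto
qed

lemma prob_shifted:
  assumes [measurable]: "Measurable.pred paths R"
  shows "prob {x \<in> space M. R (shifted i x)} = prob {x \<in> space M. R (shifted 0 x)}"
proof -
  have eq: "distr M paths (shifted i) = distr M paths (\<lambda>x. (\<lambda>n. z n x, \<lambda>(m, n). (m, n) \<in> A x))" for i
    using stationary unfolding stationary_matching_def Let_def shifted_def[abs_def] paths_def by blast
  have *: "distr M paths (shifted i) = distr M paths (shifted 0)"
    by (rule trans[OF eq eq[symmetric]])
  have "prob {x \<in> space M. R (shifted i x)} = measure (distr M paths (shifted i)) {q \<in> space paths. R q}" for i
    using measurable_space[OF shifted_measurable]
    by (subst measure_distr) (auto intro!: arg_cong[of _ _ prob])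
  then show ?thesis by (simp only: *)
qed

definition V :: "int \<Rightarrow> 'w \<Rightarrow> 'c word" where
  "V N x = waiting_word (\<lambda>i. z i x) (A x) N"

lemma path_word_shifted: "path_word N (shifted i x) = V (N + i) x"
  unfolding path_word_def shifted_def V_def fst_conv snd_conv
  by (rule waiting_word_shift)

lemma V_measurable [measurable]: "V N \<in> measurable M (count_space UNIV)"
proof -
  have "(\<lambda>x. path_word N (shifted 0 x)) \<in> measurable M (count_space UNIV)" by measurable
  then show ?thesis unfolding path_word_shifted by simp
qed

text \<open>A priori the matching may depend on the future of the sequence; the coupling with \<open>U\<close> and the
  stationarity exclude this.\<close>

lemma V_coupled: "AE x in M. \<forall>\<^sub>F n in sequentially. V (int n) x = U 0 n x"
  using good flushes_infinitely_often
proof eventually_elim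
  case (elim x)
  interpret good_path G "\<lambda>i. z i x" "A x" by fact
  have "V (int n) x = trim (run G (V 0 x) (items 0 n x))" for n
    using waiting_word_run[of 0 n] by (simp add: V_def items_def)
  then show ?case using coupled[OF elim(2), of "V 0 x"] by simp
qed

text \<open>Pathwise coupling speaks of a fixed start and late times. Translation by
  \<open>N - int n\<close> turns it into a statement about a fixed position \<open>N\<close> and an
  ever earlier start, where it becomes convergence in probability.\<close>

lemma prob_V_neq_U: "(\<lambda>n. prob {x \<in> space M. V N x \<noteq> U (N - int n) n x}) \<longlonglongrightarrow> 0"
proof -
  have "prob {x \<in> space M. V N x \<noteq> U (N - int n) n x} = prob {x \<in> space M. V (int n) x \<noteq> U 0 n x}" for n
  proof -
    let ?R = "\<lambda>q. path_word (int n) q \<noteq> trim (run G [] (map (\<lambda>k. fst q (int k)) [0..<n]))"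
    have [measurable]: "(\<lambda>q :: (int \<Rightarrow> 'c + 's) \<times> _. trim (run G [] (map (\<lambda>k. fst q (int k)) [0..<n])))
        \<in> measurable paths (count_space UNIV)"
      by (rule measurable_compose[where g = "\<lambda>ys. trim (run G [] ys)" and N = "count_space UNIV"])
        (auto intro: measurable_map_list paths_fst)
    have R: "?R (shifted i x) \<longleftrightarrow> V (int n + i) x \<noteq> U i n x" for i x
      by (simp add: path_word_shifted U_def items_def) (simp add: shifted_def add.commute)
    have "Measurable.pred paths ?R" by measurable
    from prob_shifted[OF this, of "N - int n"] show ?thesis unfolding R by simp
  qed
  moreover have "(\<lambda>n. prob {x \<in> space M. V (int n) x \<noteq> U 0 n x}) \<longlonglongrightarrow> 0"
    by (rule prob_tendsto_0) (use V_coupled in auto)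
  ultimately show ?thesis by simp
qed

text \<open>\<open>U (N - int n) n\<close> is a function of the items before \<open>N\<close> and
  hence independent of \<open>z N\<close>. It differs from \<open>V N\<close> with probability
  tending to 0, so the independence passes to the limit.\<close>

lemma prob_V_z: "prob {x \<in> space M. V N x = w \<and> z N x = y} = pmf stat w * pr y"
proof -
  have U: "prob {x \<in> space M. U (N - int n) n x = w \<and> z N x = y} = pmf (chain n []) w * pr y" for n
  proof -
    have "prob {x \<in> space M. U (N - int n) n x = w \<and> z N x = y} =
       prob {x \<in> space M. items (N - int n) n x \<in> {ys. trim (run G [] ys) = w} \<and>
         items (N - int n + int n) (length [y]) x = [y]}"
      by (simp add: U_def items_def)
    also have "\<dots> = pmf (chain n []) w * pr y"
      by (subst prob_items_then) (simp add: prob_chain)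
    finally show ?thesis .
  qed
  have "(\<lambda>n. prob {x \<in> space M. V N x = w \<and> z N x = y} - pmf (chain n []) w * pr y) \<longlonglongrightarrow> 0"
  proof (rule Lim_null_comparison[OF _ prob_V_neq_U[of N]], intro always_eventually allI)
    fix n
    have "norm (prob {x \<in> space M. V N x = w \<and> z N x = y} - pmf (chain n []) w * pr y) \<le>
        prob {x \<in> space M. (V N x = w \<and> z N x = y) \<noteq> (U (N - int n) n x = w \<and> z N x = y)}"
      unfolding U[symmetric] real_norm_def by (rule prob_diff_le) measurable
    also have "\<dots> \<le> prob {x \<in> space M. V N x \<noteq> U (N - int n) n x}"
      by (rule finite_measure_mono) auto
    finally show "norm (prob {x \<in> space M. V N x = w \<and> z N x = y} - pmf (chain n []) w * pr y) \<le>
        prob {x \<in> space M. V N x \<noteq> U (N - int n) n x}" .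
  qed
  moreover have "(\<lambda>n. prob {x \<in> space M. V N x = w \<and> z N x = y} - pmf (chain n []) w * pr y) \<longlonglongrightarrow>
      prob {x \<in> space M. V N x = w \<and> z N x = y} - pmf stat w * pr y"
    by (intro tendsto_intros chain_tendsto)
  ultimately show ?thesis using LIMSEQ_unique by force
qed

lemma distr_V_z: "distr M (count_space UNIV) (\<lambda>x. (V N x, z N x)) = measure_pmf (pair_pmf stat item)"
proof (rule measure_eqI_countable[of _ UNIV])
  have [measurable]: "(\<lambda>x. (V N x, z N x)) \<in> measurable M (count_space UNIV)"
    by (rule measurable_compose_countable[where f = "\<lambda>w x. (w, z N x)"]) measurable
  fix wy :: "'c word \<times> ('c + 's)"
  obtain w y where wy: "wy = (w, y)" by (cases wy)
  have "(\<lambda>x. (V N x, z N x)) -` {wy} \<inter> space M = {x \<in> space M. V N x = w \<and> z N x = y}"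
    by (auto simp: wy)
  then show "emeasure (distr M (count_space UNIV) (\<lambda>x. (V N x, z N x))) {wy} =
      emeasure (measure_pmf (pair_pmf stat item)) {wy}"
    by (simp add: emeasure_distr emeasure_eq_measure prob_V_z emeasure_pmf_single pmf_pair wy)
qed auto

lemma V_z_measurable [measurable]: "(\<lambda>x. (V N x, z N x)) \<in> measurable M (count_space UNIV)"
  by (rule measurable_compose_countable[where f = "\<lambda>w x. (w, z N x)"]) measurable

lemma V_z_borel: "(\<lambda>x. h (V N x, z N x)) \<in> borel_measurable M"
  by (rule measurable_compose[OF V_z_measurable]) simp

text \<open>\<open>V\<close> need not be a function of the items, but it eventually equals the copy
  \<open>U\<close> started empty at 0, and that copy may be replaced by one restarted empty at any
  later \<open>m\<close>. These changes affect finitely many terms only, which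
  \<open>exceeds\<close> does not see.\<close>

lemma zero_one_V_z:
  fixes h :: "'c word \<times> ('c + 's) \<Rightarrow> real"
  shows "(AE x in M. exceeds (\<lambda>j. h (V (1 + int j) x, z (1 + int j) x)) t) \<or>
    (AE x in M. \<not> exceeds (\<lambda>j. h (V (1 + int j) x, z (1 + int j) x)) t)"
proof -
  \<comment> \<open>Index \<open>j\<close> stands for position \<open>j + 1\<close>, as the averages
    start at position 1. The terms before the restart are set to 0, so that \<open>g m\<close>
    involves only items from \<open>m\<close> on.\<close>
  define g where "g m j x = (if Suc j < m then 0 else h (U (int m) (Suc j - m) x, z (int (Suc j)) x))" for m j x
  \<comment> \<open>Including the flushes makes \<open>E m\<close> and \<open>E 0\<close> equivalent
    at every point, as \<open>zero_one\<close> demands, and not merely almost everywhere.\<close>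
  define E where "E m x \<longleftrightarrow> (\<exists>\<^sub>\<infinity>n. flushes (int m) n x) \<and> exceeds (\<lambda>j. g m j x) t" for m :: nat and x
  have "(AE x in M. E 0 x) \<or> (AE x in M. \<not> E 0 x)"
  proof (rule zero_one[of E])
    fix m x
    have fl: "(\<exists>\<^sub>\<infinity>n. flushes 0 n x) \<longleftrightarrow> (\<exists>\<^sub>\<infinity>n. flushes (int m) n x)"
      using flushes_shift[of 0 x m] by simp
    have "exceeds (\<lambda>j. g m j x) t \<longleftrightarrow> exceeds (\<lambda>j. g 0 j x) t" if inf: "\<exists>\<^sub>\<infinity>n. flushes (int m) n x"
    proof (rule exceeds_cong)
      obtain n0 where n0: "\<And>n. n \<ge> n0 \<Longrightarrow>
          trim (run G (run G [] (items 0 m x)) (items (int m) n x)) = U (int m) n x"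
        using coupled[OF inf, of "run G [] (items 0 m x)"] unfolding eventually_sequentially by blast
      have "g m j x = g 0 j x" if "j \<ge> m + n0" for j
      proof -
        obtain n where n: "Suc j = m + n" "n \<ge> n0" by (rule that[of "Suc j - m"]) (use \<open>j \<ge> m + n0\<close> in auto)
        have "U 0 (Suc j) x = U (int m) n x"
          using n0[OF n(2)] unfolding n(1) by (simp add: U_def items_add)
        then show ?thesis using n(1) that by (simp add: g_def)
      qed
      then show "\<exists>j0. \<forall>j\<ge>j0. g m j x = g 0 j x" by blast
    qed
    then show "E m x \<longleftrightarrow> E 0 x" using fl by (auto simp: E_def)
  next
    fix m
    have [measurable]: "Measurable.pred (future m) (flushes (int m) n)" for n
      by (rule flushes_future) simp
    have [measurable]: "g m j \<in> borel_measurable (future m)" for j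
    proof (cases "Suc j < m")
      case False
      then have 1: "z (int (Suc j)) \<in> measurable (future m) (count_space UNIV)" by (intro z_future) simp
      have 2: "U (int m) (Suc j - m) \<in> measurable (future m) (count_space UNIV)" by (intro U_future) simp
      have "(\<lambda>x. h (U (int m) (Suc j - m) x, z (int (Suc j)) x)) \<in> borel_measurable (future m)"
      proof (rule measurable_compose_countable[OF _ 2, where f = "\<lambda>w x. h (w, z (int (Suc j)) x)"])
        show "(\<lambda>x. h (w, z (int (Suc j)) x)) \<in> borel_measurable (future m)" for w
          by (rule measurable_compose[OF 1]) simp
      qed
      then show ?thesis using False by (simp add: g_def[abs_def])
    qed (simp add: g_def[abs_def])
    have "Measurable.pred (future m) (E m)"
      unfolding E_def exceeds_def INFM_nat_le by measurable
    then show "{x \<in> space M. E m x} \<in> sets (future m)" by (simp add: pred_def)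
  qed
  moreover have "AE x in M. exceeds (\<lambda>j. h (V (1 + int j) x, z (1 + int j) x)) t \<longleftrightarrow> E 0 x"
    using V_coupled flushes_infinitely_often
  proof eventually_elim
    case (elim x)
    obtain n0 where n0: "\<And>n. n \<ge> n0 \<Longrightarrow> V (int n) x = U 0 n x"
      using elim(1) unfolding eventually_sequentially by blast
    have "exceeds (\<lambda>j. h (V (1 + int j) x, z (1 + int j) x)) t \<longleftrightarrow> exceeds (\<lambda>j. g 0 j x) t"
    proof (rule exceeds_cong, intro exI[of _ n0] allI impI)
      fix j assume "n0 \<le> j"
      then show "h (V (1 + int j) x, z (1 + int j) x) = g 0 j x"
        using n0[of "Suc j"] by (simp add: g_def)
    qed
    then show ?case using elim(2) by (simp add: E_def)
  qed
  ultimately show ?thesis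
  proof (elim disjE)
    assume iff: "AE x in M. exceeds (\<lambda>j. h (V (1 + int j) x, z (1 + int j) x)) t \<longleftrightarrow> E 0 x"
      and E: "AE x in M. E 0 x"
    from iff E have "AE x in M. exceeds (\<lambda>j. h (V (1 + int j) x, z (1 + int j) x)) t"
      by eventually_elim simp
    then show ?thesis ..
  next
    assume iff: "AE x in M. exceeds (\<lambda>j. h (V (1 + int j) x, z (1 + int j) x)) t \<longleftrightarrow> E 0 x"
      and E: "AE x in M. \<not> E 0 x"
    from iff E have "AE x in M. \<not> exceeds (\<lambda>j. h (V (1 + int j) x, z (1 + int j) x)) t"
      by eventually_elim simp
    then show ?thesis ..
  qed
qed

lemma expectation_V_z:
  fixes h :: "'c word \<times> ('c + 's) \<Rightarrow> 'k::{banach, second_countable_topology}"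
  shows "expectation (\<lambda>x. h (V N x, z N x)) = measure_pmf.expectation (pair_pmf stat item) h"
    and "integrable M (\<lambda>x. h (V N x, z N x)) \<longleftrightarrow> integrable (measure_pmf (pair_pmf stat item)) h"
  unfolding distr_V_z[of N, symmetric]
  by (subst integral_distr, simp_all) (subst integrable_distr_eq, simp_all)

lemma average_V_z:
  fixes h :: "'c word \<times> ('c + 's) \<Rightarrow> real"
  assumes h: "\<And>u. 0 \<le> h u" "\<And>u. h u \<le> 1"
  shows "AE x in M. (\<lambda>N. (\<Sum>j<N. h (V (1 + int j) x, z (1 + int j) x)) / real N) \<longlonglongrightarrow>
    measure_pmf.expectation (pair_pmf stat item) h"
proof -
  have le: "AE x in M. \<forall>e>0. \<exists>K. \<forall>\<^sub>F N in sequentially. (\<Sum>j<N. h (V (1 + int j) x, z (1 + int j) x)) \<le>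
      (measure_pmf.expectation (pair_pmf stat item) h + e) * real N + real K"
    if h: "\<And>u. 0 \<le> h u" "\<And>u. h u \<le> 1" for h :: "'c word \<times> ('c + 's) \<Rightarrow> real"
  proof (rule stationary_average_le)
    fix i L :: nat and t :: real
    let ?R = "\<lambda>q. \<forall>n\<in>{1..L}. (\<Sum>j<n. h (path_word (1 + int j) q, fst q (1 + int j))) < t * real n"
    have [measurable]: "(\<lambda>q. h (path_word (1 + int j) q, fst q (1 + int j))) \<in> borel_measurable paths" for j
    proof (rule measurable_compose_countable[OF _ path_word_measurable, where f = "\<lambda>w q. h (w, fst q (1 + int j))"])
      show "(\<lambda>q. h (w, fst q (1 + int j))) \<in> borel_measurable paths" for w
        by (rule measurable_compose[OF paths_fst]) simp
    qed
    have "Measurable.pred paths ?R" by measurable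
    from prob_shifted[OF this, of "int i"]
    show "prob {x \<in> space M. \<forall>n\<in>{1..L}. (\<Sum>j<n. h (V (1 + int (i + j)) x, z (1 + int (i + j)) x)) < t * real n} =
      prob {x \<in> space M. \<forall>n\<in>{1..L}. (\<Sum>j<n. h (V (1 + int j) x, z (1 + int j) x)) < t * real n}"
      unfolding path_word_shifted by (simp add: shifted_def add_ac)
  qed (use h in \<open>auto simp: V_z_borel expectation_V_z zero_one_V_z\<close>)
  have one: "measure_pmf.expectation (pair_pmf stat item) (\<lambda>u. 1 - h u) =
      1 - measure_pmf.expectation (pair_pmf stat item) h"
  proof -
    have "integrable (measure_pmf (pair_pmf stat item)) h"
      by (rule measure_pmf.integrable_const_bound[where B = 1]) (auto simp: h)
    then show ?thesis by simp
  qed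
  \<comment> \<open>The lower bound for the averages of \<open>h\<close> is the upper bound for
    those of \<open>1 - h\<close>.\<close>
  have h': "0 \<le> 1 - h u" "1 - h u \<le> 1" for u using h[of u] by auto
  show ?thesis
    using le[of h, OF h] le[of "\<lambda>u. 1 - h u", OF h']
    unfolding one
    by eventually_elim (rule average_tendsto, auto)
qed

end

section \<open>Matching rate and delay\<close>

lemma find_first_appearances: "find P (first_appearances xs) = find P xs"
proof (induction xs rule: rev_induct)
  case (snoc x xs)
  have app: "find P (ys @ [x]) = (case find P ys of None \<Rightarrow> if P x then Some x else None | Some y \<Rightarrow> Some y)" for ys
    by (induction ys) auto
  show ?case
    using snoc by (auto simp: first_appearances_snoc app find_None_iff split: option.splits)
qed (simp add: first_appearances_def)

lemma hit_agents: "hit G s c w \<longleftrightarrow> find (\<lambda>c. (s, c) \<in> G) (agents w) = Some c"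
  unfolding hit_def by (induction w rule: agents.induct) auto

lemma find_eq_Some_takeWhile:
  "find P xs = Some x \<longleftrightarrow> x \<in> set xs \<and> P x \<and> (\<forall>y\<in>set (takeWhile (\<lambda>y. y \<noteq> x) xs). \<not> P y)"
proof (induction xs)
  case (Cons y xs)
  then show ?case by (cases "y = x"; cases "P y") simp_all
qed simp

definition first_served :: "('s \<times> 'c) set \<Rightarrow> 's \<Rightarrow> 'c \<Rightarrow> 'c list \<Rightarrow> bool" where
  "first_served G s c Cs \<longleftrightarrow> c \<in> set Cs \<and> s \<notin> compatible_goods G (set (takeWhile (\<lambda>y. y \<noteq> c) Cs))"

text \<open>Repetitions do not affect which type is reached first. The event is thus constant on
  \<open>words_of Cs\<close> and factors out of the block sums.\<close>

lemma hit_words_of: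
  assumes "w \<in> words_of Cs" "(s, c) \<in> G"
  shows "hit G s c w \<longleftrightarrow> first_served G s c Cs"
proof -
  have "hit G s c w \<longleftrightarrow> find (\<lambda>c. (s, c) \<in> G) Cs = Some c"
    using assms(1) find_first_appearances[of _ "agents w"] by (simp add: hit_agents words_of_def)
  then show ?thesis
    using assms(2) by (auto simp: find_eq_Some_takeWhile first_served_def compatible_goods_def)
qed

lemma nth_eq_takeWhile:
  assumes "distinct xs" "l < length xs"
  shows "xs ! l = x \<longleftrightarrow> x \<in> set xs \<and> l = length (takeWhile (\<lambda>y. y \<noteq> x) xs)"
  using assms
proof (induction xs arbitrary: l)
  case (Cons y xs)
  then show ?case by (cases l) auto
qed simp

context fcfs_weights
begin

text \<open>The outer sums run once through every ordering of a nonempty set, and the empty list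
  contributes nothing. The indicator leaves at most one \<open>l\<close>, namely
  \<open>idx c Cs\<close>.\<close>

lemma sum_orderings:
  fixes f :: "'c list \<Rightarrow> nat \<Rightarrow> 'k::real_vector"
  shows "(\<Sum>k = 1..CARD('c). \<Sum>C | card C = k. \<Sum>Cs\<in>permutations_of_set C. \<Sum>l = 1..k.
        (P Cs * of_bool (Cs ! (l - 1) = c \<and> s \<notin> compatible_goods G (set (take (l - 1) Cs)))) *\<^sub>R f Cs l) =
    (\<Sum>Cs | distinct Cs. (P Cs * of_bool (first_served G s c Cs)) *\<^sub>R f Cs (idx c Cs))"
proof -
  let ?F = "\<lambda>Cs. (P Cs * of_bool (first_served G s c Cs)) *\<^sub>R f Cs (idx c Cs)"
  have inner: "(\<Sum>l = 1..k. (P Cs * of_bool (Cs ! (l - 1) = c \<and> s \<notin> compatible_goods G (set (take (l - 1) Cs)))) *\<^sub>R f Cs l)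
      = ?F Cs" if "card C = k" "Cs \<in> permutations_of_set C" for k C Cs
  proof -
    have Cs: "distinct Cs" "length Cs = k"
      using that by (auto simp: permutations_of_set_def distinct_card)
    have "(P Cs * of_bool (Cs ! (l - 1) = c \<and> s \<notin> compatible_goods G (set (take (l - 1) Cs)))) *\<^sub>R f Cs l =
        (if l = idx c Cs then ?F Cs else 0)" if "l \<in> {1..k}" for l
    proof -
      have "Cs ! (l - 1) = c \<longleftrightarrow> c \<in> set Cs \<and> l = idx c Cs"
        using nth_eq_takeWhile[OF Cs(1), of "l - 1" c] that Cs(2) by (auto simp: idx_def)
      moreover have "take (idx c Cs - 1) Cs = takeWhile (\<lambda>y. y \<noteq> c) Cs"
        by (simp add: idx_def takeWhile_eq_take[symmetric])
      ultimately show ?thesis by (auto simp: first_served_def)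
    qed
    then have "(\<Sum>l = 1..k. (P Cs * of_bool (Cs ! (l - 1) = c \<and> s \<notin> compatible_goods G (set (take (l - 1) Cs)))) *\<^sub>R f Cs l)
      = (\<Sum>l = 1..k. if l = idx c Cs then ?F Cs else 0)"
      by (intro sum.cong refl)
    also have "\<dots> = (if idx c Cs \<in> {1..k} then ?F Cs else 0)" by simp
    also have "\<dots> = ?F Cs"
    proof (cases "c \<in> set Cs")
      case True
      then obtain i where i: "i < length Cs" "Cs ! i = c" by (auto simp: in_set_conv_nth)
      then have "idx c Cs \<le> k"
        using Cs(2) nth_eq_takeWhile[OF Cs(1) i(1), of c] by (auto simp: idx_def)
      then show ?thesis by (simp add: idx_def)
    qed (simp add: first_served_def)
    finally show ?thesis .
  qed
  have "(\<Sum>k = 1..CARD('c). \<Sum>C | card C = k. \<Sum>Cs\<in>permutations_of_set C. \<Sum>l = 1..k.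
        (P Cs * of_bool (Cs ! (l - 1) = c \<and> s \<notin> compatible_goods G (set (take (l - 1) Cs)))) *\<^sub>R f Cs l)
     = (\<Sum>k = 1..CARD('c). \<Sum>C | C \<in> UNIV \<and> card C = k. \<Sum>Cs\<in>permutations_of_set C. ?F Cs)"
    by (intro sum.cong refl inner) auto
  also have "\<dots> = (\<Sum>k \<in> {0..CARD('c)}. \<Sum>C | C \<in> UNIV \<and> card C = k. \<Sum>Cs\<in>permutations_of_set C. ?F Cs)"
  proof (rule sum.mono_neutral_left)
    show "\<forall>k\<in>{0..CARD('c)} - {1..CARD('c)}.
        (\<Sum>C | C \<in> UNIV \<and> card C = k. \<Sum>Cs\<in>permutations_of_set C. ?F Cs) = 0"
      by (auto simp: first_served_def not_le less_Suc_eq_0_disj)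
  qed auto
  also have "\<dots> = (\<Sum>C\<in>UNIV. \<Sum>Cs\<in>permutations_of_set C. ?F Cs)"
    by (rule sum.group) (auto intro!: card_mono)
  also have "\<dots> = (\<Sum>C\<in>UNIV. \<Sum>Cs | Cs \<in> {Cs. distinct Cs} \<and> set Cs = C. ?F Cs)"
    by (intro sum.cong refl) (auto simp: permutations_of_set_def)
  also have "\<dots> = (\<Sum>Cs | distinct Cs. ?F Cs)"
    using finite_distinct_lists[of "\<lambda>_. True"] by (intro sum.group) auto
  finally show ?thesis .
qed

end

context matching_seq
begin

lemma matched_to_measurable [measurable]:
  "Measurable.pred M (\<lambda>x. matched_to (\<lambda>i. z i x) (A x) s c n)"
proof -
  have [measurable]: "Measurable.pred M (\<lambda>x. (m, n) \<in> A x)" for m n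
    using A_measurable by (simp add: pred_def)
  show ?thesis unfolding matched_to_def by measurable
qed

lemma delay_measurable [measurable]: "(\<lambda>x. delay (A x) n) \<in> measurable M (count_space UNIV)"
proof -
  have [measurable]: "Measurable.pred M (\<lambda>x. (m, n) \<in> A x)" for m n
    using A_measurable by (simp add: pred_def)
  show ?thesis unfolding delay_def by measurable
qed

lemma matched_to_V: "AE x in M. matched_to (\<lambda>i. z i x) (A x) s c n \<longleftrightarrow> z n x = Inr s \<and> hit G s c (V n x)"
  using good by eventually_elim (simp add: good_path.matched_to_iff V_def)

lemma delay_V: "AE x in M. matched_to (\<lambda>i. z i x) (A x) s c n \<longrightarrow> delay (A x) n = wait c (V n x)"
  using good by eventually_elim (simp add: good_path.delay_eq V_def)

lemma prob_V: "prob {x \<in> space M. V N x \<in> X} = measure_pmf.prob stat X"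
proof -
  have "prob {x \<in> space M. V N x \<in> X} = measure (distr M (count_space UNIV) (\<lambda>x. (V N x, z N x))) (X \<times> UNIV)"
    by (subst measure_distr) (auto intro!: arg_cong[of _ _ prob])
  also have "\<dots> = measure_pmf.prob stat X"
    by (simp add: distr_V_z measure_pmf_prob_product)
  finally show ?thesis .
qed

lemma pi_Y_eq:
  assumes "distinct Cs"
  shows "pi_Y M z A N Cs = W Cs / Wtot"
proof -
  have [measurable]: "Measurable.pred M (\<lambda>x. (m, n) \<in> A x)" for m n
    using A_measurable by (simp add: pred_def)
  have [measurable]: "Measurable.pred M (\<lambda>x. isl (z i x))" for i
    by (rule measurable_compose[OF z_measurable]) simp
  define S where "S x = {m. m \<le> N \<and> isl (z m x) \<and> \<not> (\<exists>n\<le>N. (m, n) \<in> A x)}" for x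
  have [measurable]: "Measurable.pred M (\<lambda>x. S x = F)" for F
    unfolding S_def set_eq_iff mem_Collect_eq by measurable
  have [measurable]: "Measurable.pred M (\<lambda>x. first_appearances (map (\<lambda>m. projl (z m x)) l) = Cs)" for l
  proof -
    have "(\<lambda>x. map (\<lambda>m. projl (z m x)) l) \<in> measurable M (count_space UNIV)"
      by (intro measurable_map_list measurable_compose[OF z_measurable]) simp
    then show ?thesis by (rule measurable_compose) simp
  qed
  let ?P = "\<lambda>x. first_appearances (unmatched_agents (\<lambda>i. z i x) (A x) N) = Cs"
  have fin: "countable {F :: int set. finite F}" by (rule countable_Collect_finite)
  \<comment> \<open>The event agrees with one about \<open>V\<close> only almost surely, so its
    measurability is shown separately, by a countable case distinction over the finite position
    sets; on infinite sets the default list is empty.\<close>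
  have P: "?P x \<longleftrightarrow>
      (\<exists>F\<in>{F. finite F}. S x = F \<and> first_appearances (map (\<lambda>m. projl (z m x)) (sorted_list_of_set F)) = Cs) \<or>
      (\<forall>F\<in>{F. finite F}. S x \<noteq> F) \<and> first_appearances (map (\<lambda>m. projl (z m x)) []) = Cs" for x
    unfolding unmatched_agents_def S_def[symmetric] by (cases "finite (S x)") auto
  have [measurable]: "Measurable.pred M ?P"
    unfolding P using fin by measurable
  have "pi_Y M z A N Cs = prob {x \<in> space M. V (N + 1) x \<in> {w. first_appearances (agents w) = Cs}}"
    unfolding pi_Y_def
  proof (rule finite_measure_eq_AE)
    show "AE x in M. x \<in> {x \<in> space M. ?P x} \<longleftrightarrow>
        x \<in> {x \<in> space M. V (N + 1) x \<in> {w. first_appearances (agents w) = Cs}}"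
      using good by eventually_elim (simp add: good_path.unmatched_agents_eq V_def)
  qed measurable
  also have "\<dots> = measure_pmf.expectation stat (indicator {w. first_appearances (agents w) = Cs})"
    unfolding prob_V by simp
  also have "\<dots> = (\<Sum>Cs' | distinct Cs'. if Cs' = Cs then W Cs else 0) / of_real Wtot"
  proof (rule expectation_stat(2))
    fix Cs' :: "'c list" assume d: "distinct Cs'"
    show "abs_sums (\<lambda>w. of_real (wt {} w) * indicator {w. first_appearances (agents w) = Cs} w) (words_of Cs')
        (if Cs' = Cs then W Cs else 0)"
    proof (cases "Cs' = Cs")
      case True
      show ?thesis
        by (rule abs_sums_cong[THEN iffD1, OF _ _ abs_sums_W[OF d]]) (auto simp: words_of_def True)
    next
      case False
      have "abs_sums (\<lambda>w. 0 * wt {} w) (words_of Cs') (0 * W Cs')"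
        by (intro abs_sums_cmult abs_sums_W d)
      then show ?thesis
        by (rule abs_sums_cong[THEN iffD1, rotated -1]) (auto simp: words_of_def False)
    qed
  qed
  also have "\<dots> = W Cs / Wtot"
    using assms finite_distinct_lists[where P = "\<lambda>_. True" and ?'c = 'c] by simp
  finally show ?thesis .
qed

lemma expectation_matched:
  fixes f :: "nat \<Rightarrow> 'k::{banach, real_normed_field, second_countable_topology}"
  assumes "(s, c) \<in> G"
    and f: "\<And>Cs. distinct Cs \<Longrightarrow>
      abs_sums (\<lambda>w. of_real (wt {} w) * f (wait c w)) (words_of Cs) (of_real (W Cs) * F Cs)"
  shows "integrable (measure_pmf (pair_pmf stat item)) (\<lambda>(w, y). of_bool (y = Inr s \<and> hit G s c w) * f (wait c w))"
    and "measure_pmf.expectation (pair_pmf stat item) (\<lambda>(w, y). of_bool (y = Inr s \<and> hit G s c w) * f (wait c w)) =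
      of_real (b s) * (\<Sum>Cs | distinct Cs. of_real (W Cs / Wtot * of_bool (first_served G s c Cs)) * F Cs)"
proof -
  let ?h = "\<lambda>(w, y). of_bool (y = Inr s \<and> hit G s c w) * f (wait c w)"
  let ?S = "\<Sum>Cs | distinct Cs. of_real (W Cs / Wtot * of_bool (first_served G s c Cs)) * F Cs"
  have "abs_sums (\<lambda>w. of_real (if trim w = w then wt {} w / Wtot else 0) * (of_bool (hit G s c w) * f (wait c w))) UNIV
    ((\<Sum>Cs | distinct Cs. of_bool (first_served G s c Cs) * (of_real (W Cs) * F Cs)) / of_real Wtot)"
  proof (rule abs_sums_trimmed)
    fix Cs :: "'c list" assume "distinct Cs"
    from abs_sums_cmult[OF f[OF this], of "of_bool (first_served G s c Cs)"]
    show "abs_sums (\<lambda>w. of_real (wt {} w) * (of_bool (hit G s c w) * f (wait c w))) (words_of Cs)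
        (of_bool (first_served G s c Cs) * (of_real (W Cs) * F Cs))"
      by (rule abs_sums_cong[THEN iffD1, rotated -1]) (auto simp: hit_words_of[OF _ assms(1)])
  qed
  also have "(\<Sum>Cs | distinct Cs. of_bool (first_served G s c Cs) * (of_real (W Cs) * F Cs)) / of_real Wtot = ?S"
    unfolding sum_divide_distrib by (intro sum.cong refl) auto
  finally have "abs_sums (\<lambda>w. of_real (pmf stat w) * (of_bool (hit G s c w) * f (wait c w))) UNIV ?S"
    by (simp add: pmf_stat)
  from abs_sums_cmult[OF this, of "of_real (b s)"]
  have "abs_sums (\<lambda>w. pmf (pair_pmf stat item) (w, Inr s) *\<^sub>R ?h (w, Inr s)) UNIV (of_real (b s) * ?S)"
    by (rule abs_sums_cong[THEN iffD1, rotated -1]) (auto simp: pmf_pair scaleR_conv_of_real)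
  then have "abs_sums (\<lambda>u. pmf (pair_pmf stat item) u *\<^sub>R ?h u) ((\<lambda>w. (w, Inr s)) ` UNIV) (of_real (b s) * ?S)"
    by (subst abs_sums_reindex) (auto simp: inj_on_def)
  then have "abs_sums (\<lambda>u. pmf (pair_pmf stat item) u *\<^sub>R ?h u) UNIV (of_real (b s) * ?S)"
    unfolding abs_sums_def
    by (auto elim!: has_sum_cong_neutral[THEN iffD1, rotated -1] summable_on_cong_neutral[THEN iffD1, rotated -1]
        split: if_splits)
  from abs_sums_expectation[OF this]
  show "integrable (measure_pmf (pair_pmf stat item)) ?h"
    "measure_pmf.expectation (pair_pmf stat item) ?h = of_real (b s) * ?S" by simp_all
qed

text \<open>A probability per position, whereas the matching rate is counted per good; the two
  differ by the factor \<open>sum b UNIV\<close>.\<close>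

definition hit_prob :: "'s \<Rightarrow> 'c \<Rightarrow> real" where
  "hit_prob s c = b s * (\<Sum>Cs | distinct Cs. W Cs / Wtot * of_bool (first_served G s c Cs))"

lemma expectation_hit:
  assumes "(s, c) \<in> G"
  shows "measure_pmf.expectation (pair_pmf stat item) (\<lambda>(w, y). of_bool (y = Inr s \<and> hit G s c w)) = hit_prob s c"
  using expectation_matched(2)[OF assms, of "\<lambda>_. 1 :: real" "\<lambda>_. 1"] abs_sums_W
  by (simp add: hit_prob_def)

lemma prob_matched:
  assumes "(s, c) \<in> G"
  shows "prob {x \<in> space M. matched_to (\<lambda>i. z i x) (A x) s c n} = hit_prob s c"
proof -
  have "prob {x \<in> space M. matched_to (\<lambda>i. z i x) (A x) s c n} =
      expectation (\<lambda>x. indicator {x \<in> space M. matched_to (\<lambda>i. z i x) (A x) s c n} x)"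
    by simp
  also have "\<dots> = expectation (\<lambda>x. case (V n x, z n x) of (w, y) \<Rightarrow> of_bool (y = Inr s \<and> hit G s c w))"
  proof (rule integral_cong_AE)
    show "AE x in M. indicator {x \<in> space M. matched_to (\<lambda>i. z i x) (A x) s c n} x =
        (case (V n x, z n x) of (w, y) \<Rightarrow> of_bool (y = Inr s \<and> hit G s c w))"
      using matched_to_V[of s c n] AE_space by eventually_elim (auto simp: indicator_def)
  qed (auto intro: V_z_borel)
  also have "\<dots> = hit_prob s c"
    unfolding expectation_V_z by (rule expectation_hit) fact
  finally show ?thesis .
qed

lemma sum_indicator_card:
  "real (card {n \<in> {1..int N}. P n}) = (\<Sum>j<N. of_bool (P (1 + int j)))"
proof -
  have "{n \<in> {1..int N}. P n} = (\<lambda>j. 1 + int j) ` {j \<in> {..<N}. P (1 + int j)}"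
  proof (intro set_eqI iffI)
    fix n assume "n \<in> {n \<in> {1..int N}. P n}"
    then show "n \<in> (\<lambda>j. 1 + int j) ` {j \<in> {..<N}. P (1 + int j)}"
      by (intro image_eqI[of _ _ "nat (n - 1)"]) auto
  qed auto
  then have "card {n \<in> {1..int N}. P n} = card {j \<in> {..<N}. P (1 + int j)}"
    by (simp add: card_image inj_on_def)
  then show ?thesis by (simp add: of_bool_def sum.If_cases Int_def)
qed

text \<open>Divided by \<open>N\<close>, numerator and denominator are both ergodic averages. Almost
  sure limits are unique on a probability space, so the definite description denotes this
  value.\<close>

lemma matching_rate_eq:
  assumes edge: "(s, c) \<in> G" and pos: "sum b UNIV > 0"
  shows "matching_rate M z A s c = hit_prob s c / sum b UNIV"
proof -
  let ?ratio = "\<lambda>x N. real (card {n \<in> {1..int N}. matched_to (\<lambda>i. z i x) (A x) s c n}) /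
      real (card {n \<in> {1..int N}. \<exists>s'. z n x = Inr s'})"
  have goods: "measure_pmf.expectation (pair_pmf stat item) (\<lambda>(w, y). of_bool (\<exists>s'. y = Inr s')) = sum b UNIV"
  proof -
    have "measure_pmf.expectation (pair_pmf stat item) (\<lambda>(w, y). of_bool (\<exists>s'. y = Inr s')) =
       measure_pmf.expectation (map_pmf snd (pair_pmf stat item)) (\<lambda>y. of_bool (\<exists>s'. y = Inr s') :: real)"
      by (simp only: integral_map_pmf case_prod_unfold)
    also have "\<dots> = (\<Sum>y\<in>UNIV. pr y * of_bool (\<exists>s'. y = Inr s'))"
      unfolding map_snd_pair_pmf by (subst integral_measure_pmf_real[of UNIV]) (auto simp: mult.commute)
    also have "\<dots> = (\<Sum>y\<in>Inr ` UNIV. pr y)"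
      by (rule sum.mono_neutral_cong_right) auto
    finally show ?thesis by (simp add: sum.reindex)
  qed
  have matched: "AE x in M. (\<forall>n. matched_to (\<lambda>i. z i x) (A x) s c n \<longleftrightarrow> z n x = Inr s \<and> hit G s c (V n x))"
    using matched_to_V by (subst AE_all_countable) auto
  have bounds: "(0 :: real) \<le> (case u of (w, y) \<Rightarrow> of_bool (Q w y))" "(case u of (w, y) \<Rightarrow> of_bool (Q w y)) \<le> (1 :: real)"
    for u :: "'c word \<times> ('c + 's)" and Q by (auto split: prod.split)
  have lim: "AE x in M. ?ratio x \<longlonglongrightarrow> hit_prob s c / sum b UNIV"
    using matched
      average_V_z[of "\<lambda>(w, y). of_bool (y = Inr s \<and> hit G s c w)", OF bounds]
      average_V_z[of "\<lambda>(w, y). of_bool (\<exists>s'. y = Inr s')", OF bounds]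
  proof eventually_elim
    case (elim x)
    have "(\<lambda>N. ((\<Sum>j<N. of_bool (z (1 + int j) x = Inr s \<and> hit G s c (V (1 + int j) x))) / real N) /
        ((\<Sum>j<N. of_bool (\<exists>s'. z (1 + int j) x = Inr s')) / real N)) \<longlonglongrightarrow> hit_prob s c / sum b UNIV"
      using elim(2,3) pos unfolding goods expectation_hit[OF edge]
      by (intro tendsto_divide) (auto simp: case_prod_unfold)
    moreover have "\<forall>\<^sub>F N in sequentially. ((\<Sum>j<N. of_bool (z (1 + int j) x = Inr s \<and> hit G s c (V (1 + int j) x))) / real N) /
        ((\<Sum>j<N. of_bool (\<exists>s'. z (1 + int j) x = Inr s')) / real N) = ?ratio x N"
      using eventually_gt_at_top[of 0]
      by eventually_elim (simp only: sum_indicator_card elim(1), simp)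
    ultimately show ?case by (rule Lim_transform_eventually)
  qed
  show ?thesis
    unfolding matching_rate_def
  proof (rule the_equality)
    show "AE x in M. ?ratio x \<longlonglongrightarrow> hit_prob s c / sum b UNIV" by (rule lim)
    fix r assume "AE x in M. ?ratio x \<longlonglongrightarrow> r"
    with lim have "AE x in M. r = hit_prob s c / sum b UNIV"
      by eventually_elim (rule LIMSEQ_unique)
    then show "r = hit_prob s c / sum b UNIV" by simp
  qed
qed

lemma delay_law_prob_space:
  assumes "(s, c) \<in> G" "hit_prob s c > 0"
  shows "prob_space (delay_law M z A s c n)"
proof -
  let ?E = "{x \<in> space M. matched_to (\<lambda>i. z i x) (A x) s c n}"
  have "emeasure M ?E \<noteq> 0"
    using prob_matched[OF assms(1), of n] assms(2) by (simp add: emeasure_eq_measure)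
  then have "prob_space (uniform_measure M ?E)" by (intro prob_space_uniform_measure) auto
  then show ?thesis unfolding delay_law_def
    by (intro prob_space.prob_space_distr) simp_all
qed

text \<open>Conditioning on the match is a density with the constant
  \<open>1 / hit_prob s c\<close>. On that event the delay is \<open>wait c\<close> of the word, so
  everything reduces to \<open>expectation_matched\<close>.\<close>

lemma delay_law_integral:
  fixes f :: "nat \<Rightarrow> 'k::{banach, real_normed_field, second_countable_topology}"
  assumes edge: "(s, c) \<in> G" and pos: "hit_prob s c > 0"
    and f: "\<And>Cs. distinct Cs \<Longrightarrow>
      abs_sums (\<lambda>w. of_real (wt {} w) * f (wait c w)) (words_of Cs) (of_real (W Cs) * F Cs)"
  shows "integrable (delay_law M z A s c n) f"
    and "(LINT d|delay_law M z A s c n. f d) =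
      of_real (b s / hit_prob s c) * (\<Sum>Cs | distinct Cs. of_real (W Cs / Wtot * of_bool (first_served G s c Cs)) * F Cs)"
proof -
  let ?E = "{x \<in> space M. matched_to (\<lambda>i. z i x) (A x) s c n}"
  let ?h = "\<lambda>(w, y). of_bool (y = Inr s \<and> hit G s c w) * f (wait c w)"
  have P: "prob ?E = hit_prob s c" by (rule prob_matched) fact
  have u: "uniform_measure M ?E = density M (\<lambda>x. ennreal (indicator ?E x / hit_prob s c))"
  proof -
    have "indicator ?E x / emeasure M ?E = ennreal (indicator ?E x / hit_prob s c)" for x
      using pos by (simp add: emeasure_eq_measure P indicator_def divide_ennreal flip: ennreal_1)
    then show ?thesis by (simp add: uniform_measure_def)
  qed
  have fm: "(\<lambda>x. f (delay (A x) n)) \<in> borel_measurable M"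
    by (rule measurable_compose[OF delay_measurable]) simp
  have eq: "AE x in M. (indicator ?E x / hit_prob s c) *\<^sub>R f (delay (A x) n) =
      of_real (1 / hit_prob s c) * ?h (V n x, z n x)"
    using matched_to_V[of s c n] delay_V[of s c n] AE_space
    by eventually_elim (auto simp: indicator_def scaleR_conv_of_real)
  have m1: "(\<lambda>x. (indicator ?E x / hit_prob s c) *\<^sub>R f (delay (A x) n)) \<in> borel_measurable M"
    using fm by measurable
  have m2: "(\<lambda>x. of_real (1 / hit_prob s c) * ?h (V n x, z n x)) \<in> borel_measurable M"
    using V_z_borel[of "\<lambda>u. of_real (1 / hit_prob s c) * ?h u" n] by simp
  have int: "integrable M (\<lambda>x. of_real (1 / hit_prob s c) * ?h (V n x, z n x))"
    using expectation_matched(1)[OF edge f] unfolding expectation_V_z(2)[symmetric, of _ n]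
    by (intro integrable_mult_right) auto
  have "integrable (delay_law M z A s c n) f \<longleftrightarrow>
      integrable M (\<lambda>x. (indicator ?E x / hit_prob s c) *\<^sub>R f (delay (A x) n))"
    unfolding delay_law_def u using fm pos
    by (subst integrable_distr_eq; simp) (subst integrable_density; simp)
  then show "integrable (delay_law M z A s c n) f"
    using int integrable_cong_AE[OF m1 m2 eq] by simp
  have "(LINT d|delay_law M z A s c n. f d) = (LINT x|M. (indicator ?E x / hit_prob s c) *\<^sub>R f (delay (A x) n))"
    unfolding delay_law_def u using fm pos
    by (subst integral_distr; simp) (subst integral_density; simp)
  also have "\<dots> = (LINT x|M. of_real (1 / hit_prob s c) * ?h (V n x, z n x))"
    by (rule integral_cong_AE[OF m1 m2 eq])
  also have "\<dots> = of_real (1 / hit_prob s c) * (LINT x|M. ?h (V n x, z n x))"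
    by simp
  also have "(LINT x|M. ?h (V n x, z n x)) =
      of_real (b s) * (\<Sum>Cs | distinct Cs. of_real (W Cs / Wtot * of_bool (first_served G s c Cs)) * F Cs)"
    unfolding expectation_V_z(1) by (rule expectation_matched(2)[OF edge f])
  finally show "(LINT d|delay_law M z A s c n. f d) = of_real (b s / hit_prob s c) *
      (\<Sum>Cs | distinct Cs. of_real (W Cs / Wtot * of_bool (first_served G s c Cs)) * F Cs)"
    by simp
qed

end

theorem corollary1:
  fixes M :: "'w measure"
    and z :: "int \<Rightarrow> 'w \<Rightarrow> 'c::finite + 's::finite"
    and A :: "'w \<Rightarrow> (int \<times> int) set"
    and G :: "('s \<times> 'c) set"
    and lbar mbar r :: real
    and alpha lam :: "'c \<Rightarrow> real"
    and beta mu :: "'s \<Rightarrow> real"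
    and s :: 's and c :: 'c
    and N n :: int
    and p :: "'c list \<Rightarrow> nat \<Rightarrow> real"
    and E_real :: "('c list \<Rightarrow> nat \<Rightarrow> real) \<Rightarrow> real"
    and E_complex :: "('c list \<Rightarrow> nat \<Rightarrow> complex) \<Rightarrow> complex"
    and L :: "nat measure"
  assumes "prob_space M"
    and "lbar > 0" and "mbar > 0"
    and "\<And>a. alpha a \<ge> 0" and "sum alpha UNIV = 1"
    and "\<And>b. beta b \<ge> 0" and "sum beta UNIV = 1"
    and lam: "lam = (\<lambda>a. lbar * alpha a)"
    and mu: "mu = (\<lambda>b. mbar * beta b)"
    and indep: "prob_space.indep_vars M (\<lambda>_. count_space UNIV) z UNIV"
    and agent_prob: "\<And>i a. measure M {w \<in> space M. z i w = Inl a} = lam a / (lbar + mbar)"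
    and good_prob: "\<And>i b. measure M {w \<in> space M. z i w = Inr b} = mu b / (lbar + mbar)"
    and stability: "\<And>C. C \<noteq> {} \<Longrightarrow> sum lam C < sum mu (compatible_goods G C)"
    and fcfs: "AE w in M. directed_fcfs_matching G (\<lambda>i. z i w) (A w)"
    and complete: "AE w in M. all_agents_matched (\<lambda>i. z i w) (A w)"
    and stationary: "stationary_matching M z A"
    and edge: "(s, c) \<in> G"
    and r: "r = matching_rate M z A s c" and "r > 0"
    and p: "p = geom_param G lbar mbar lam mu"
    and E_real: "E_real = delay_mean G mbar mu r (pi_Y M z A N) s c"
    and E_complex: "E_complex = delay_mean G mbar mu r (pi_Y M z A N) s c"
    and L: "L = delay_law M z A s c n"
  shows "(\<forall>Z :: complex. norm Z \<le> 1 \<longrightarrow>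
           (LINT d|L. Z ^ d) =
             E_complex (\<lambda>Cs l. \<Prod>h = l..length Cs.
               Z * of_real (p Cs h) / (1 - Z * (1 - of_real (p Cs h)))))
       \<and> integrable L (\<lambda>d. real d)
       \<and> (LINT d|L. real d) = E_real (\<lambda>Cs l. \<Sum>h = l..length Cs. 1 / p Cs h)
       \<and> integrable L (\<lambda>d. (real d)\<^sup>2)
       \<and> prob_space.variance L real =
             E_real (\<lambda>Cs l. (\<Sum>h = l..length Cs. (1 - p Cs h) / (p Cs h)\<^sup>2) +
                            (\<Sum>h = l..length Cs. 1 / p Cs h)\<^sup>2)
               - (LINT d|L. real d)\<^sup>2"
proof -
  let ?T = "lbar + mbar"
  define a where "a = (\<lambda>i. lam i / ?T)"
  define b where "b = (\<lambda>j. mu j / ?T)"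
  have T: "?T > 0" using \<open>lbar > 0\<close> \<open>mbar > 0\<close> by simp
  have sum_b: "sum b UNIV = mbar / ?T"
    using \<open>sum beta UNIV = 1\<close> by (simp add: b_def mu flip: sum_divide_distrib sum_distrib_left)
  have sum_a: "sum a UNIV = lbar / ?T"
    using \<open>sum alpha UNIV = 1\<close> by (simp add: a_def lam flip: sum_divide_distrib sum_distrib_left)
  interpret prob_space M by fact
  interpret fcfs_weights G a b
  proof
    show "a i \<ge> 0" for i
      using T \<open>lbar > 0\<close> \<open>\<And>i. alpha i \<ge> 0\<close> by (simp add: a_def lam)
    show "b j \<ge> 0" for j
      using T \<open>mbar > 0\<close> \<open>\<And>j. beta j \<ge> 0\<close> by (simp add: b_def mu)
    show "sum a UNIV + sum b UNIV = 1"
      using T by (simp add: sum_a sum_b flip: add_divide_distrib)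
    show "sum a C < sum b (compatible_goods G C)" if "C \<noteq> {}" for C
      using stability[OF that] T by (simp add: a_def b_def divide_strict_right_mono flip: sum_divide_distrib)
  qed
  have law: "prob {x \<in> space M. z i x = y} = pr y" for i y
    by (cases y; simp add: agent_prob good_prob) (simp_all add: a_def b_def)
  interpret matching_seq M G a b z A
    by unfold_locales (use indep law fcfs complete stationary in auto)
  let ?H = "hit_prob s c"
  have r_eq: "r = ?H / (mbar / ?T)"
    using matching_rate_eq[OF edge] T \<open>mbar > 0\<close> by (simp add: r sum_b)
  have H: "?H > 0"
    using \<open>r > 0\<close> T \<open>mbar > 0\<close> unfolding r_eq by (auto simp: zero_less_divide_iff zero_less_mult_iff)
  \<comment> \<open>The normalisation \<open>mbar / ?T\<close>, the frequency of goods, cancels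
    between \<open>r\<close> and \<open>mu s / mbar\<close>.\<close>
  have rate: "b s / ?H = 1 / r * (mu s / mbar)"
    using H T \<open>mbar > 0\<close> by (simp add: r_eq b_def field_simps)
  have p_eq: "p Cs h = pp Cs h" for Cs h
    unfolding p geom_param_def p_def
    by (simp add: a_def b_def diff_divide_distrib flip: sum_divide_distrib)
  have E: "delay_mean G mbar mu r (pi_Y M z A N) s c f =
      of_real (b s / ?H) * (\<Sum>Cs | distinct Cs. of_real (W Cs / Wtot * of_bool (first_served G s c Cs)) * f Cs (idx c Cs))"
    for f :: "'c list \<Rightarrow> nat \<Rightarrow> 'k::{banach, real_normed_field, second_countable_topology}"
    unfolding delay_mean_def sum_orderings rate
    by (auto simp: scaleR_conv_of_real pi_Y_eq intro!: arg_cong2[where f = "(*)"] sum.cong)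
  note law_integral = delay_law_integral[OF edge H, where n = n, folded L]
  interpret D: prob_space L unfolding L by (rule delay_law_prob_space[OF edge H])
  have gf: "(LINT d|L. Z ^ d) = E_complex (\<lambda>Cs l. \<Prod>h = l..length Cs.
      Z * of_real (p Cs h) / (1 - Z * (1 - of_real (p Cs h))))" if "norm Z \<le> 1" for Z :: complex
    unfolding E_complex E p_eq by (rule law_integral(2)[OF abs_sums_gf[OF _ that]])
  have m1: "abs_sums (\<lambda>w. of_real (wt {} w) * real (wait c w)) (words_of Cs)
      (of_real (W Cs) * (\<Sum>h = idx c Cs..length Cs. 1 / pp Cs h))" if "distinct Cs" for Cs
    using abs_sums_mean[OF that] by simp
  have mean: "integrable L real" "(LINT d|L. real d) = E_real (\<lambda>Cs l. \<Sum>h = l..length Cs. 1 / p Cs h)"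
    unfolding E_real E p_eq using law_integral[OF m1] by auto
  have m2: "abs_sums (\<lambda>w. of_real (wt {} w) * (real (wait c w))\<^sup>2) (words_of Cs)
      (of_real (W Cs) * ((\<Sum>h = idx c Cs..length Cs. (1 - pp Cs h) / (pp Cs h)\<^sup>2) +
        (\<Sum>h = idx c Cs..length Cs. 1 / pp Cs h)\<^sup>2))" if "distinct Cs" for Cs
    using abs_sums_second_moment[OF that] by simp
  have second: "integrable L (\<lambda>d. (real d)\<^sup>2)" "(LINT d|L. (real d)\<^sup>2) =
      E_real (\<lambda>Cs l. (\<Sum>h = l..length Cs. (1 - p Cs h) / (p Cs h)\<^sup>2) + (\<Sum>h = l..length Cs. 1 / p Cs h)\<^sup>2)"
    unfolding E_real E p_eq using law_integral[OF m2] by auto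
  show ?thesis
    using gf mean second D.variance_eq[OF mean(1) second(1)] by auto
qed

end
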